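(* Let $d\ge 3$ and let $W\subset\mathbb{R}^d$ be a convex body. For $t>0$ let $X_t$ be the measure of planes that contain zero crossings: $$X_t:=\nu_d\big(\{L\in \mathbf{G}_2(d):\ \mathrm{cr}(L)=0\}\big).$$ Then there exists $c^*=c^*(d,W)>0$ such that if $c'<c^*$ and $$t^4 r_t^{2d+2}\le c'\ln t$$ for all large enough $t$, then $$\lim_{t\to\infty}\mathbb{P}(X_t>0)=1.$$
   Context: A convex body is a compact convex set with nonempty interior. For $t>0$, $\eta_t$ is a homogeneous Poisson point process on $W$ with intensity $t$ (intensity measure $t$ times Lebesgue measure restricted to $W$), identified with its support. The connectivity radius $r_t>0$ is a deterministic function of $t$ with $r_t\to 0$ as $t\to\infty$. The random geometric graph has vertex set $\eta_t$ and edge set $\{\{v,w\}\subset\eta_t:\ 0<\|v-w\|\le r_t\}$, with $\|\cdot\|$ the Euclidean norm. $\mathbf{G}_2(d)$ is the Grassmannian of two-dimensional linear subspaces of $\mathbb{R}^d$, called planes, and $\nu_d$ is the uniform (rotation-invariant Haar) probability measure on it. $[v,w]$ is the line segment between $v$ and $w$, and $A|_L$ is the orthogonal projection of a point or set $A$ onto the plane $L$. For $L\in\mathbf{G}_2(d)$ define $$\begin{aligned}h_L(v_1,v_2,v_3,v_4)={}&\mathbb{1}\big(\|v_1-v_2\|\le r_t,\ \|v_3-v_4\|\le r_t,\ [v_1,v_2]|_L\cap[v_3,v_4]|_L\ne\emptyset\big)\\&+\mathbb{1}\big(\|v_1-v_3\|\le r_t,\ \|v_2-v_4\|\le r_t,\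 [v_1,v_3]|_L\cap[v_2,v_4]|_L\ne\emptyset\big)\\&+\mathbb{1}\big(\|v_1-v_4\|\le r_t,\ \|v_2-v_3\|\le r_t,\ [v_1,v_4]|_L\cap[v_2,v_3]|_L\ne\emptyset\big).\end{aligned}$$ The number of crossings on $L$ is $$\mathrm{cr}(L)=\frac1{24}\sum_{(v_1,v_2,v_3,v_4)\in\eta_{t,\ne}^4}h_L(v_1,v_2,v_3,v_4),$$ where $\eta_{t,\ne}^4$ is the set of $4$-tuples of pairwise distinct points of $\eta_t$. The dependence of $\mathrm{cr}(L)$ on $t$ is suppressed in the notation. *)

theory Defs
  imports "HOL-Probability.Probability"
begin

definition convex_body :: "'a::euclidean_space set \<Rightarrow> bool" where
  "convex_body W \<longleftrightarrow> compact W \<and> convex W \<and> interior W \<noteq> {}"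

section \<open>Homogeneous Poisson point process on a compact set\<close>

text \<open>Since \<open>W\<close> is compact and the Poisson process is simple, its realisations, identified with
  their supports, are the finite subsets of \<open>W\<close>; they carry the \<open>\<sigma>\<close>-algebra generated by
  the counts in Borel sets.\<close>

definition config_space :: "'a::euclidean_space set \<Rightarrow> 'a set measure" where
  "config_space W =
     sigma {\<eta>. finite \<eta> \<and> \<eta> \<subseteq> W}
       {{\<eta>. finite \<eta> \<and> \<eta> \<subseteq> W \<and> card (\<eta> \<inter> A) = k} | A k. A \<in> sets borel}"

text \<open>\<open>P\<close> is the law, on the space of configurations, of a homogeneous Poisson point process on
  \<open>W\<close> with intensity \<open>t\<close>. The Poisson probabilities are written out because \<open>poisson_pmf\<close> does
  not cover rate \<open>0\<close>, which occurs when \<open>W \<inter> A\<close> is a null set.\<close>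

definition poisson_process :: "real \<Rightarrow> 'a::euclidean_space set \<Rightarrow> 'a set measure \<Rightarrow> bool" where
  "poisson_process t W P \<longleftrightarrow>
     prob_space P \<and>
     space P = space (config_space W) \<and>
     sets P = sets (config_space W) \<and>
     (\<forall>A\<in>sets borel. \<forall>k::nat.
        measure P {\<eta>\<in>space P. card (\<eta> \<inter> A) = k} =
          (t * measure lborel (W \<inter> A)) ^ k / fact k * exp (- (t * measure lborel (W \<inter> A)))) \<and>
     (\<forall>(n::nat) A. (\<forall>i<n. A i \<in> sets borel) \<and> disjoint_family_on A {..<n} \<longrightarrow>
        prob_space.indep_vars P (\<lambda>_. count_space UNIV) (\<lambda>i \<eta>. card (\<eta> \<inter> A i)) {..<n})"

section \<open>Planes and the uniform measure on the Grassmannian\<close>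

definition orth_proj :: "'a::euclidean_space set \<Rightarrow> 'a \<Rightarrow> 'a" where
  "orth_proj L x = (THE y. y \<in> L \<and> x - y \<in> L\<^sup>\<bottom>)"

lemma orth_proj_unique:
  fixes L :: "'a::euclidean_space set"
  assumes "subspace L"
  shows "\<exists>!y. y \<in> L \<and> x - y \<in> L\<^sup>\<bottom>"
proof -
  obtain y z where yz: "y \<in> span L" "\<And>w. w \<in> span L \<Longrightarrow> orthogonal z w" "x = y + z"
    using orthogonal_subspace_decomp_exists[of L x] by metis
  have L: "span L = L" using assms by (simp add: span_eq_iff)
  show ?thesis
  proof (intro ex1I[of _ y] conjI)
    show "y \<in> L" using yz(1) L by simp
    show "x - y \<in> L\<^sup>\<bottom>"
      using yz(2,3) L by (auto simp: orthogonal_comp_def orthogonal_commute)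
  next
    fix u assume u: "u \<in> L \<and> x - u \<in> L\<^sup>\<bottom>"
    have "y - u \<in> L" using u yz(1) L assms by (simp add: subspace_diff)
    then have "(y - u) \<bullet> (x - u) = 0" and "(y - u) \<bullet> (x - y) = 0"
      using u yz(2)[of "y - u"] yz(3) L
      by (auto simp: orthogonal_comp_def orthogonal_def inner_commute[of z])
    then have "(y - u) \<bullet> (y - u) = 0" by (simp add: inner_diff_right)
    then show "u = y" by simp
  qed
qed

lemma orth_proj:
  fixes L :: "'a::euclidean_space set"
  assumes "subspace L"
  shows "orth_proj L x \<in> L" and "x - orth_proj L x \<in> L\<^sup>\<bottom>"
  using theI'[OF orth_proj_unique[OF assms, of x]] by (simp_all add: orth_proj_def)

definition planes :: "(real^'d) set set" where
  "planes = {L. subspace L \<and> dim L = 2}"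

text \<open>The Borel \<open>\<sigma>\<close>-algebra of the Grassmannian: its topology is the one inherited from the
  embedding that sends a plane to the matrix of the orthogonal projection onto it.\<close>

definition grassmann_borel :: "(real^'d) set measure" where
  "grassmann_borel = vimage_algebra planes (\<lambda>L. matrix (orth_proj L)) borel"

text \<open>The rotation-invariant Borel probability measure on the Grassmannian of planes exists and is
  unique, so this predicate characterises it.\<close>

definition uniform_plane_measure :: "(real^'d) set measure \<Rightarrow> bool" where
  "uniform_plane_measure \<nu> \<longleftrightarrow>
     prob_space \<nu> \<and>
     space \<nu> = planes \<and>
     sets \<nu> = sets grassmann_borel \<and>
     (\<forall>Q::real^'d^'d. rotation_matrix Q \<longrightarrow>
        (\<forall>A\<in>sets \<nu>. emeasure \<nu> ((\<lambda>L. (*v) Q ` L) ` A) = emeasure \<nu> A))"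

section \<open>Crossings of the projected random geometric graph\<close>

definition edges_cross ::
  "real \<Rightarrow> 'a::euclidean_space set \<Rightarrow> 'a \<Rightarrow> 'a \<Rightarrow> 'a \<Rightarrow> 'a \<Rightarrow> bool" where
  "edges_cross \<rho> L a b c d \<longleftrightarrow>
     norm (a - b) \<le> \<rho> \<and> norm (c - d) \<le> \<rho> \<and>
     orth_proj L ` closed_segment a b \<inter> orth_proj L ` closed_segment c d \<noteq> {}"

definition crossing_kernel ::
  "real \<Rightarrow> 'a::euclidean_space set \<Rightarrow> 'a \<Rightarrow> 'a \<Rightarrow> 'a \<Rightarrow> 'a \<Rightarrow> real" where
  "crossing_kernel \<rho> L v1 v2 v3 v4 =
     of_bool (edges_cross \<rho> L v1 v2 v3 v4) +
     of_bool (edges_cross \<rho> L v1 v3 v2 v4) +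
     of_bool (edges_cross \<rho> L v1 v4 v2 v3)"

definition crossing_number :: "real \<Rightarrow> 'a::euclidean_space set \<Rightarrow> 'a set \<Rightarrow> real" where
  "crossing_number \<rho> \<eta> L =
     1 / 24 * (\<Sum>(v1, v2, v3, v4) \<in> {(v1, v2, v3, v4).
         {v1, v2, v3, v4} \<subseteq> \<eta> \<and> distinct [v1, v2, v3, v4]}. crossing_kernel \<rho> L v1 v2 v3 v4)"

definition zero_crossing_measure ::
  "(real^'d) set measure \<Rightarrow> real \<Rightarrow> (real^'d) set \<Rightarrow> real" where
  "zero_crossing_measure \<nu> \<rho> \<eta> = measure \<nu> {L \<in> planes. crossing_number \<rho> \<eta> L = 0}"

end

theory Submission
  imports Defs
begin

text \<open>Fix a plane \<open>L\<close> and put \<open>\<kappa> = t ^ 4 * r ^ (2 * d + 2)\<close>. The expected number of crossings on \<open>L\<close> is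
at most of order \<open>\<kappa>\<close>, and the absence of crossings on \<open>L\<close> is a decreasing event, so by
positive correlation it has probability at least \<open>exp (- C * \<kappa>)\<close>. If \<open>\<kappa> \<le> c * ln t\<close>, this is at least a
small negative power of \<open>t\<close>. Planes that are not too close to each other are nearly independent, because a pair
of edges that crosses on one of them rarely crosses on the other, and pairs of edges that share points
are rare as well. So among \<open>N\<close> planes, \<open>N\<close> a larger (but still small) power of \<open>t\<close>, at least
one is free of crossings with probability tending to \<open>1\<close>. The constant \<open>c\<close> only has to be so small
that \<open>N\<close> beats \<open>exp (C * \<kappa>)\<close>.

One crossing-free plane is enough: for a finite set of points the crossing-free planes form an open
set, and the uniform measure charges every nonempty open set
(\<open>uniform_plane_measure_open_pos\<close>), since countably many rotated copies of the set cover all planes.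

The near-independence is made quantitative in a discrete model. Space is cut
into cells so small that each contains at most one point, which turns the Poisson process into a random
subset of a finite set of cells with independent elements. A crossing on the plane \<open>i\<close> becomes
the presence of a four-element pattern from a family \<open>\<Q> i\<close>. If every family is hit, then either the
hits can be chosen pairwise disjoint, an event whose probability is at most the product of the
individual ones by the van den Berg-Kesten inequality (\<open>subset_prob_disj_occ_le\<close>), or two
intersecting patterns from different families are both present. Hence
(\<open>subset_prob_all_families_hit_le\<close>) the probability that all planes have crossings is at most
\<open>(1 - exp (- C * \<kappa>)) ^ N\<close> plus a sum over intersecting pairs of patterns, and both can be bounded by
counting patterns only. The count is over lattice points: a pattern consists of two edges of length at
most \<open>r\<close> whose projections to a plane are at distance of order \<open>r\<close>, and two patterns that
intersect cost an extra factor of order \<open>r\<close>, up to small powers of \<open>t\<close>. As \<open>r\<close> is at most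
\<open>t powr (- 1 / (d + 1))\<close>, this extra factor wins over the \<open>N\<^sup>2\<close> pairs of planes.\<close>

section \<open>Random subsets with independent elements\<close>

text \<open>The probability of the event \<open>A\<close> for a random subset of \<open>V\<close> that contains each \<open>x\<close>
independently with probability \<open>p x\<close>. An explicit finite sum suits the inductions below, which reveal
one element of \<open>V\<close> at a time.\<close>

definition subset_prob :: "'a set \<Rightarrow> ('a \<Rightarrow> real) \<Rightarrow> ('a set \<Rightarrow> bool) \<Rightarrow> real" where
  "subset_prob V p A = (\<Sum>H\<in>Pow V. if A H then (\<Prod>x\<in>V. if x \<in> H then p x else 1 - p x) else 0)"

lemma subset_prob_empty: "subset_prob {} p A = (if A {} then 1 else 0)"
  by (simp add: subset_prob_def)

lemma subset_prob_cong: "(\<And>H. H \<subseteq> V \<Longrightarrow> A H = B H) \<Longrightarrow> subset_prob V p A = subset_prob V p B"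
  unfolding subset_prob_def by (intro sum.cong) auto

text \<open>Conditioning on whether \<open>x\<close> is present is the induction step of the correlation inequalities below.\<close>

lemma subset_prob_insert:
  assumes "finite V" "x \<notin> V"
  shows "subset_prob (insert x V) p A = p x * subset_prob V p (\<lambda>H. A (insert x H)) + (1 - p x) * subset_prob V p A"
proof -
  let ?w = "\<lambda>V H. \<Prod>x\<in>V. if x \<in> H then p x else 1 - p x"
  have w1: "?w (insert x V) (insert x H) = p x * ?w V H" if "H \<subseteq> V" for H
    using assms by (auto intro!: prod.cong)
  have w0: "?w (insert x V) H = (1 - p x) * ?w V H" if "H \<subseteq> V" for H
    using assms that by auto
  have inj: "inj_on (insert x) (Pow V)"
    using assms by (auto intro!: inj_onI)
  have disj: "Pow V \<inter> insert x ` Pow V = {}" using assms by auto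
  have "subset_prob (insert x V) p A =
      (\<Sum>H\<in>Pow V. if A H then ?w (insert x V) H else 0)
      + (\<Sum>H\<in>insert x ` Pow V. if A H then ?w (insert x V) H else 0)"
    unfolding subset_prob_def Pow_insert using assms disj by (intro sum.union_disjoint) auto
  also have "(\<Sum>H\<in>insert x ` Pow V. if A H then ?w (insert x V) H else 0)
      = (\<Sum>H\<in>Pow V. if A (insert x H) then ?w (insert x V) (insert x H) else 0)"
    using inj by (simp add: sum.reindex)
  also have "\<dots> = (\<Sum>H\<in>Pow V. p x * (if A (insert x H) then ?w V H else 0))"
    by (intro sum.cong) (use w1 in auto)
  also have "(\<Sum>H\<in>Pow V. if A H then ?w (insert x V) H else 0)
      = (\<Sum>H\<in>Pow V. (1 - p x) * (if A H then ?w V H else 0))"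
    by (intro sum.cong) (use w0 in auto)
  finally show ?thesis
    unfolding subset_prob_def by (simp add: sum_distrib_left)
qed

lemma subset_prob_mono:
  assumes "\<And>x. x \<in> V \<Longrightarrow> 0 \<le> p x \<and> p x \<le> 1" "\<And>H. H \<subseteq> V \<Longrightarrow> A H \<Longrightarrow> B H"
  shows "subset_prob V p A \<le> subset_prob V p B"
  unfolding subset_prob_def
  by (intro sum_mono) (use assms in \<open>auto intro!: prod_nonneg\<close>)

lemma subset_prob_nonneg:
  assumes "\<And>x. x \<in> V \<Longrightarrow> 0 \<le> p x \<and> p x \<le> 1"
  shows "0 \<le> subset_prob V p A"
  unfolding subset_prob_def
  by (intro sum_nonneg) (use assms in \<open>auto intro!: prod_nonneg\<close>)

lemma subset_prob_disj_conj:
  "subset_prob V p (\<lambda>H. A H \<or> B H) = subset_prob V p A + subset_prob V p B - subset_prob V p (\<lambda>H. A H \<and> B H)"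
  unfolding subset_prob_def sum.distrib[symmetric] sum_subtractf[symmetric]
  by (intro sum.cong) auto

lemma subset_prob_superset:
  assumes "finite V" "S \<subseteq> V"
  shows "subset_prob V p (\<lambda>H. S \<subseteq> H) = (\<Prod>x\<in>S. p x)"
  using assms
proof (induction V arbitrary: S rule: finite_induct)
  case empty
  then show ?case by (simp add: subset_prob_empty)
next
  case (insert x V)
  show ?case
  proof (cases "x \<in> S")
    case True
    have f: "finite S" using insert finite_subset by blast
    have "subset_prob V p (\<lambda>H. S \<subseteq> insert x H) = subset_prob V p (\<lambda>H. S - {x} \<subseteq> H)"
      by (intro subset_prob_cong) auto
    moreover have "subset_prob V p (\<lambda>H. S \<subseteq> H) = subset_prob V p (\<lambda>H. False)"
      by (intro subset_prob_cong) (use True insert in auto)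
    moreover have "subset_prob V p (\<lambda>H. False) = 0" by (simp add: subset_prob_def)
    moreover have "subset_prob V p (\<lambda>H. S - {x} \<subseteq> H) = prod p (S - {x})"
      by (rule insert.IH) (use insert.prems in auto)
    ultimately show ?thesis
      using True f by (simp add: subset_prob_insert insert prod.remove[of S x])
  next
    case False
    then have "S \<subseteq> V" using insert by auto
    moreover have "subset_prob V p (\<lambda>H. S \<subseteq> insert x H) = subset_prob V p (\<lambda>H. S \<subseteq> H)"
      by (intro subset_prob_cong) (use False in auto)
    ultimately show ?thesis
      by (simp add: subset_prob_insert insert algebra_simps)
  qed
qed

lemma subset_prob_True: "finite V \<Longrightarrow> subset_prob V p (\<lambda>H. True) = 1"
  using subset_prob_superset[of V "{}" p] by simp

lemma subset_prob_not:
  assumes "finite V"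
  shows "subset_prob V p (\<lambda>H. \<not> A H) = 1 - subset_prob V p A"
  using subset_prob_disj_conj[of V p A "\<lambda>H. \<not> A H"] subset_prob_True[OF assms, of p]
  by (simp add: subset_prob_def)

lemma subset_prob_union_le:
  assumes "finite I" "\<And>x. x \<in> V \<Longrightarrow> 0 \<le> p x \<and> p x \<le> 1"
  shows "subset_prob V p (\<lambda>H. \<exists>i\<in>I. A i H) \<le> (\<Sum>i\<in>I. subset_prob V p (A i))"
  using assms(1)
proof (induction I rule: finite_induct)
  case empty
  then show ?case by (simp add: subset_prob_def)
next
  case (insert i I)
  have "subset_prob V p (\<lambda>H. \<exists>i\<in>insert i I. A i H) = subset_prob V p (\<lambda>H. A i H \<or> (\<exists>i\<in>I. A i H))"
    by simp
  also have "\<dots> \<le> subset_prob V p (A i) + subset_prob V p (\<lambda>H. \<exists>i\<in>I. A i H)"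
    using subset_prob_nonneg[OF assms(2), where A="\<lambda>H. A i H \<and> (\<exists>i\<in>I. A i H)"]
    by (subst subset_prob_disj_conj) auto
  finally show ?case using insert by simp
qed

text \<open>Harris' inequality. Conditionally on the revealed element the events are positively correlated by
induction, and the conditional probabilities are themselves both decreasing functions of that element.\<close>

lemma subset_prob_harris:
  assumes "finite V" "\<And>x. x \<in> V \<Longrightarrow> 0 \<le> p x \<and> p x \<le> 1" "antimono A" "antimono B"
  shows "subset_prob V p A * subset_prob V p B \<le> subset_prob V p (\<lambda>H. A H \<and> B H)"
  using assms
proof (induction V arbitrary: A B rule: finite_induct)
  case empty
  then show ?case by (simp add: subset_prob_empty)
next
  case (insert x V)
  let ?A = "\<lambda>H. A (insert x H)" and ?B = "\<lambda>H. B (insert x H)"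
  have p: "0 \<le> p x" "p x \<le> 1" using insert.prems(1) by auto
  have pV: "\<And>x. x \<in> V \<Longrightarrow> 0 \<le> p x \<and> p x \<le> 1" using insert.prems(1) by auto
  have AB: "A H" if "A H'" "H \<subseteq> H'" for H H' using insert.prems(2) that
    by (auto simp: monotone_def le_bool_def)
  have BB: "B H" if "B H'" "H \<subseteq> H'" for H H' using insert.prems(3) that
    by (auto simp: monotone_def le_bool_def)
  have anti: "antimono ?A" "antimono ?B"
    by (intro monotoneI le_boolI; erule AB BB; blast)+
  have le: "subset_prob V p ?A \<le> subset_prob V p A" "subset_prob V p ?B \<le> subset_prob V p B"
    by (intro subset_prob_mono pV; (assumption | erule AB BB; blast))+
  have i1: "subset_prob V p ?A * subset_prob V p ?B \<le> subset_prob V p (\<lambda>H. ?A H \<and> ?B H)"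
    by (rule insert.IH) (use anti pV in auto)
  have i0: "subset_prob V p A * subset_prob V p B \<le> subset_prob V p (\<lambda>H. A H \<and> B H)"
    by (rule insert.IH) (use insert.prems pV in auto)
  define q a0 a1 b0 b1 where defs: "q = p x" "a0 = subset_prob V p A" "a1 = subset_prob V p ?A"
     "b0 = subset_prob V p B" "b1 = subset_prob V p ?B"
  have pos: "0 \<le> q * (1-q) * ((a0 - a1) * (b0 - b1))"
    unfolding defs using p le by (intro mult_nonneg_nonneg) auto
  have "(q * a1 + (1-q) * a0) * (q * b1 + (1-q) * b0)
     = q * (a1*b1) + (1-q) * (a0*b0) - q * (1-q) * ((a0 - a1) * (b0 - b1))"
    by (simp add: algebra_simps)
  also have "\<dots> \<le> q * (a1*b1) + (1-q) * (a0*b0)" using pos by simp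
  also have "\<dots> \<le> q * subset_prob V p (\<lambda>H. ?A H \<and> ?B H) + (1-q) * subset_prob V p (\<lambda>H. A H \<and> B H)"
    using i1 i0 p unfolding defs by (intro add_mono mult_left_mono) auto
  finally show ?case
    using insert.hyps by (simp add: subset_prob_insert defs)
qed

text \<open>The disjoint occurrence of two increasing events in the sense of van den Berg and Kesten.\<close>

definition disj_occ :: "('a set \<Rightarrow> bool) \<Rightarrow> ('a set \<Rightarrow> bool) \<Rightarrow> 'a set \<Rightarrow> bool" where
  "disj_occ A B H \<longleftrightarrow> (\<exists>S T. S \<inter> T = {} \<and> S \<union> T \<subseteq> H \<and> A S \<and> B T)"

lemma mono_disj_occ: "mono (disj_occ A B)"
  unfolding disj_occ_def by (intro monoI le_boolI) blast

text \<open>The van den Berg-Kesten inequality for increasing events. When the revealed element \<open>x\<close> is present,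
it can serve as a witness for only one of the two events. The two resulting possibilities both contain
the disjoint occurrence without \<open>x\<close>, so that inclusion-exclusion applies. With this simple argument
the weight \<open>1 - 2 * p x\<close> of the configuration without \<open>x\<close> has to be nonnegative, hence the bound
\<open>1/2\<close>; probabilities of small cells satisfy it.\<close>

lemma subset_prob_disj_occ_le:
  assumes "finite V" "\<And>x. x \<in> V \<Longrightarrow> 0 \<le> p x \<and> p x \<le> 1/2" "mono A" "mono B"
  shows "subset_prob V p (disj_occ A B) \<le> subset_prob V p A * subset_prob V p B"
  using assms
proof (induction V arbitrary: A B rule: finite_induct)
  case empty
  then show ?case by (auto simp: subset_prob_empty disj_occ_def)
next
  case (insert x V)
  let ?A = "\<lambda>H. A (insert x H)" and ?B = "\<lambda>H. B (insert x H)"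
  have p: "0 \<le> p x" "p x \<le> 1/2" using insert.prems(1) by auto
  have pV: "\<And>x. x \<in> V \<Longrightarrow> 0 \<le> p x \<and> p x \<le> 1/2" using insert.prems(1) by auto
  then have pV1: "\<And>x. x \<in> V \<Longrightarrow> 0 \<le> p x \<and> p x \<le> 1" by force
  have AB: "A H'" if "A H" "H \<subseteq> H'" for H H' using insert.prems(2) that
    by (auto simp: monotone_def le_bool_def)
  have BB: "B H'" if "B H" "H \<subseteq> H'" for H H' using insert.prems(3) that
    by (auto simp: monotone_def le_bool_def)
  have mon: "mono ?A" "mono ?B"
    by (intro monoI le_boolI; erule AB BB; blast)+
  have le: "subset_prob V p A \<le> subset_prob V p ?A" "subset_prob V p B \<le> subset_prob V p ?B"
    by (intro subset_prob_mono pV1; (assumption | erule AB BB; blast))+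
  have i00: "subset_prob V p (disj_occ A B) \<le> subset_prob V p A * subset_prob V p B"
    by (rule insert.IH) (use insert.prems pV in auto)
  have i10: "subset_prob V p (disj_occ ?A B) \<le> subset_prob V p ?A * subset_prob V p B"
    by (intro insert.IH pV mon insert.prems(2,3))
  have i01: "subset_prob V p (disj_occ A ?B) \<le> subset_prob V p A * subset_prob V p ?B"
    by (intro insert.IH pV mon insert.prems(2,3))
  have "subset_prob V p (\<lambda>H. disj_occ A B (insert x H)) \<le> subset_prob V p (\<lambda>H. disj_occ ?A B H \<or> disj_occ A ?B H)"
  proof (intro subset_prob_mono pV1)
    fix H assume H: "H \<subseteq> V" "disj_occ A B (insert x H)"
    then obtain S T where ST: "S \<inter> T = {}" "S \<union> T \<subseteq> insert x H" "A S" "B T"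
      unfolding disj_occ_def by auto
    show "disj_occ ?A B H \<or> disj_occ A ?B H"
    proof (cases "x \<in> T")
      case True
      have "disj_occ A ?B H"
        unfolding disj_occ_def
        by (rule exI[of _ S], rule exI[of _ "T - {x}"])
           (use ST True in \<open>auto simp: insert_absorb\<close>)
      then show ?thesis ..
    next
      case False
      have "?A (S - {x})" by (rule AB[OF ST(3)]) auto
      then have "disj_occ ?A B H"
        unfolding disj_occ_def
        by (intro exI[of _ "S - {x}"] exI[of _ T])
           (use ST False in auto)
      then show ?thesis ..
    qed
  qed
  also have "\<dots> = subset_prob V p (disj_occ ?A B) + subset_prob V p (disj_occ A ?B)
      - subset_prob V p (\<lambda>H. disj_occ ?A B H \<and> disj_occ A ?B H)"
    by (rule subset_prob_disj_conj)
  finally have i1: "subset_prob V p (\<lambda>H. disj_occ A B (insert x H))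
     \<le> subset_prob V p (disj_occ ?A B) + subset_prob V p (disj_occ A ?B)
      - subset_prob V p (\<lambda>H. disj_occ ?A B H \<and> disj_occ A ?B H)" .
  have i2: "subset_prob V p (disj_occ A B) \<le> subset_prob V p (\<lambda>H. disj_occ ?A B H \<and> disj_occ A ?B H)"
  proof (intro subset_prob_mono pV1)
    fix H assume "disj_occ A B H"
    then obtain S T where ST: "S \<inter> T = {}" "S \<union> T \<subseteq> H" "A S" "B T"
      unfolding disj_occ_def by auto
    moreover have "?A S" by (rule AB[OF ST(3)]) auto
    moreover have "?B T" by (rule BB[OF ST(4)]) auto
    ultimately show "disj_occ ?A B H \<and> disj_occ A ?B H"
      unfolding disj_occ_def by blast
  qed
  define q a0 a1 b0 b1 where defs: "q = p x" "a0 = subset_prob V p A" "a1 = subset_prob V p ?A"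
     "b0 = subset_prob V p B" "b1 = subset_prob V p ?B"
  have pos: "0 \<le> q * q * ((a1 - a0) * (b1 - b0))"
    unfolding defs using p le by (intro mult_nonneg_nonneg) auto
  have "subset_prob (insert x V) p (disj_occ A B)
     = q * subset_prob V p (\<lambda>H. disj_occ A B (insert x H)) + (1 - q) * subset_prob V p (disj_occ A B)"
    using insert.hyps by (simp add: subset_prob_insert defs)
  also have "\<dots> \<le> q * (subset_prob V p (disj_occ ?A B) + subset_prob V p (disj_occ A ?B) - subset_prob V p (disj_occ A B))
      + (1 - q) * subset_prob V p (disj_occ A B)"
    using i1 i2 p defs by (intro add_right_mono mult_left_mono) auto
  also have "\<dots> = q * subset_prob V p (disj_occ ?A B) + q * subset_prob V p (disj_occ A ?B)
      + (1 - 2 * q) * subset_prob V p (disj_occ A B)"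
    by (simp add: algebra_simps)
  also have "\<dots> \<le> q * (a1 * b0) + q * (a0 * b1) + (1 - 2*q) * (a0 * b0)"
    using i00 i10 i01 p unfolding defs by (intro add_mono mult_left_mono) auto
  also have "\<dots> \<le> q * (a1 * b0) + q * (a0 * b1) + (1 - 2*q) * (a0 * b0)
      + q * q * ((a1 - a0) * (b1 - b0))"
    using pos by simp
  also have "\<dots> = (q * a1 + (1-q) * a0) * (q * b1 + (1-q) * b0)"
    by (simp add: algebra_simps)
  finally show ?case
    using insert.hyps by (simp add: subset_prob_insert defs)
qed

definition contains_some :: "'a set set \<Rightarrow> 'a set \<Rightarrow> bool" where
  "contains_some \<Q> H \<longleftrightarrow> (\<exists>S\<in>\<Q>. S \<subseteq> H)"

lemma mono_contains_some: "mono (contains_some \<Q>)"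
  unfolding contains_some_def by (intro monoI le_boolI) blast

text \<open>Avoiding each pattern is a decreasing event, so Harris' inequality bounds the probability of avoiding
them all by the product.\<close>

lemma subset_prob_avoid_ge:
  assumes "finite V" "\<And>x. x \<in> V \<Longrightarrow> 0 \<le> p x \<and> p x \<le> 1" "finite \<Q>" "\<And>S. S \<in> \<Q> \<Longrightarrow> S \<subseteq> V"
  shows "(\<Prod>S\<in>\<Q>. 1 - (\<Prod>x\<in>S. p x)) \<le> subset_prob V p (\<lambda>H. \<not> contains_some \<Q> H)"
  using assms(3,4)
proof (induction \<Q> rule: finite_induct)
  case empty
  then show ?case using assms by (simp add: subset_prob_True contains_some_def)
next
  case (insert S \<Q>)
  have a1: "antimono (\<lambda>H. \<not> S \<subseteq> H)"
    by (intro monotoneI le_boolI) auto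
  have a2: "antimono (\<lambda>H. \<not> contains_some \<Q> H)"
    by (intro monotoneI le_boolI) (auto simp: contains_some_def)
  have S: "subset_prob V p (\<lambda>H. \<not> S \<subseteq> H) = 1 - (\<Prod>x\<in>S. p x)"
    using subset_prob_not[OF assms(1)] subset_prob_superset[OF assms(1)] insert.prems by simp
  have S0: "0 \<le> 1 - (\<Prod>x\<in>S. p x)"
    using subset_prob_nonneg[where V=V and p=p and A="\<lambda>H. \<not> S \<subseteq> H"] assms(2) S by simp
  have "(\<Prod>S\<in>insert S \<Q>. 1 - (\<Prod>x\<in>S. p x)) = (1 - (\<Prod>x\<in>S. p x)) * (\<Prod>S\<in>\<Q>. 1 - (\<Prod>x\<in>S. p x))"
    using insert by simp
  also have "\<dots> \<le> (1 - (\<Prod>x\<in>S. p x)) * subset_prob V p (\<lambda>H. \<not> contains_some \<Q> H)"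
    using insert S0 by (intro mult_left_mono) auto
  also have "\<dots> \<le> subset_prob V p (\<lambda>H. \<not> S \<subseteq> H \<and> \<not> contains_some \<Q> H)"
    using subset_prob_harris[where p=p, OF assms(1) _ a1 a2] assms(2) S by simp
  also have "\<dots> = subset_prob V p (\<lambda>H. \<not> contains_some (insert S \<Q>) H)"
    by (simp add: contains_some_def)
  finally show ?case .
qed

primrec multi_disj_occ :: "(nat \<Rightarrow> 'a set \<Rightarrow> bool) \<Rightarrow> nat \<Rightarrow> 'a set \<Rightarrow> bool" where
  "multi_disj_occ B 0 = (\<lambda>H. True)"
| "multi_disj_occ B (Suc n) = disj_occ (multi_disj_occ B n) (B n)"

lemma mono_multi_disj_occ: "mono (multi_disj_occ B n)"
  by (cases n) (auto simp: mono_disj_occ intro: monoI)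

lemma subset_prob_multi_disj_occ_le:
  assumes "finite V" "\<And>x. x \<in> V \<Longrightarrow> 0 \<le> p x \<and> p x \<le> 1/2" "\<And>i. mono (B i)"
  shows "subset_prob V p (multi_disj_occ B n) \<le> (\<Prod>i<n. subset_prob V p (B i))"
proof (induction n)
  case 0
  then show ?case using assms by (simp add: subset_prob_True)
next
  case (Suc n)
  have p1: "\<And>x. x \<in> V \<Longrightarrow> 0 \<le> p x \<and> p x \<le> 1" using assms(2) by force
  have "subset_prob V p (multi_disj_occ B (Suc n)) \<le> subset_prob V p (multi_disj_occ B n) * subset_prob V p (B n)"
    using subset_prob_disj_occ_le[OF assms(1,2) mono_multi_disj_occ assms(3)] by simp
  also have "\<dots> \<le> (\<Prod>i<n. subset_prob V p (B i)) * subset_prob V p (B n)"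
    using Suc subset_prob_nonneg[OF p1] by (intro mult_right_mono) auto
  finally show ?case by simp
qed

lemma multi_disj_occI:
  assumes "\<And>i. i < n \<Longrightarrow> B i (S i)" "\<And>i j. i < j \<Longrightarrow> j < n \<Longrightarrow> S i \<inter> S j = {}"
  shows "multi_disj_occ B n (\<Union>i<n. S i)"
  using assms
proof (induction n)
  case 0
  then show ?case by simp
next
  case (Suc n)
  have "multi_disj_occ B n (\<Union>i<n. S i)"
    by (rule Suc.IH) (use Suc.prems in auto)
  moreover have "B n (S n)" using Suc.prems by auto
  moreover have "(\<Union>i<n. S i) \<inter> S n = {}" using Suc.prems(2) by fastforce
  moreover have "(\<Union>i<Suc n. S i) = (\<Union>i<n. S i) \<union> S n"
    by (auto simp: lessThan_Suc)
  ultimately show ?case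
    unfolding multi_disj_occ.simps disj_occ_def
    by (intro exI[of _ "\<Union>i<n. S i"] exI[of _ "S n"]) auto
qed

text \<open>Choose one present pattern from each family. Either the choices are pairwise disjoint, and then the
events occur disjointly, or two of them intersect, which is covered by the union bound.\<close>

lemma subset_prob_all_families_hit_le:
  fixes n :: nat
  assumes V: "finite V" and p: "\<And>x. x \<in> V \<Longrightarrow> 0 \<le> p x \<and> p x \<le> 1/2"
    and \<Q>: "\<And>i. finite (\<Q> i)" "\<And>i S. S \<in> \<Q> i \<Longrightarrow> S \<subseteq> V"
  shows "subset_prob V p (\<lambda>H. \<forall>i<n. contains_some (\<Q> i) H)
     \<le> (\<Prod>i<n. subset_prob V p (contains_some (\<Q> i)))
       + (\<Sum>(i, j)\<in>{(i, j). i < j \<and> j < n}.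
            \<Sum>(S, T)\<in>{(S, T). S \<in> \<Q> i \<and> T \<in> \<Q> j \<and> S \<inter> T \<noteq> {}}. \<Prod>x\<in>S \<union> T. p x)"
proof -
  let ?B = "\<lambda>i. contains_some (\<Q> i)"
  let ?I = "{(i, j). i < j \<and> j < n}"
  let ?R = "\<lambda>i j. {(S, T). S \<in> \<Q> i \<and> T \<in> \<Q> j \<and> S \<inter> T \<noteq> {}}"
  let ?X = "\<lambda>H. \<exists>(i, j)\<in>?I. \<exists>(S, T)\<in>?R i j. S \<union> T \<subseteq> H"
  have p1: "\<And>x. x \<in> V \<Longrightarrow> 0 \<le> p x \<and> p x \<le> 1" using p by force
  have fI: "finite ?I"
  proof (rule finite_subset)
    show "?I \<subseteq> {..<n} \<times> {..<n}" by auto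
  qed simp
  have fR: "finite (?R i j)" for i j
  proof (rule finite_subset)
    show "?R i j \<subseteq> \<Q> i \<times> \<Q> j" by auto
  qed (use \<Q> in auto)
  have "subset_prob V p (\<lambda>H. \<forall>i<n. ?B i H) \<le> subset_prob V p (\<lambda>H. multi_disj_occ ?B n H \<or> ?X H)"
  proof (intro subset_prob_mono p1)
    fix H assume H: "\<forall>i<n. ?B i H"
    then obtain S where S: "\<And>i. i < n \<Longrightarrow> S i \<in> \<Q> i \<and> S i \<subseteq> H"
      unfolding contains_some_def by metis
    show "multi_disj_occ ?B n H \<or> ?X H"
    proof (cases "\<forall>i j. i < j \<longrightarrow> j < n \<longrightarrow> S i \<inter> S j = {}")
      case True
      have "multi_disj_occ ?B n (\<Union>i<n. S i)"
        by (rule multi_disj_occI) (use S True in \<open>auto simp: contains_some_def\<close>)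
      moreover have "(\<Union>i<n. S i) \<subseteq> H" using S by auto
      ultimately show ?thesis
        using mono_multi_disj_occ[of ?B n] by (auto simp: monotone_def le_bool_def)
    next
      case False
      then obtain i j where ij: "i < j" "j < n" "S i \<inter> S j \<noteq> {}" by auto
      have "(i, j) \<in> ?I" "(S i, S j) \<in> ?R i j" "S i \<union> S j \<subseteq> H"
        using ij S[of i] S[of j] by auto
      then show ?thesis by blast
    qed
  qed
  also have "\<dots> \<le> subset_prob V p (multi_disj_occ ?B n) + subset_prob V p ?X"
    using subset_prob_nonneg[OF p1] by (simp add: subset_prob_disj_conj)
  also have "\<dots> \<le> (\<Prod>i<n. subset_prob V p (?B i)) + subset_prob V p ?X"
    by (intro add_right_mono subset_prob_multi_disj_occ_le V p mono_contains_some)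
  also have "subset_prob V p ?X \<le> (\<Sum>(i, j)\<in>?I. subset_prob V p (\<lambda>H. \<exists>(S, T)\<in>?R i j. S \<union> T \<subseteq> H))"
    using subset_prob_union_le[OF fI p1, where A="\<lambda>(i,j) H. \<exists>(S, T)\<in>?R i j. S \<union> T \<subseteq> H"]
    by (simp add: case_prod_unfold)
  also have "\<dots> \<le> (\<Sum>(i, j)\<in>?I. \<Sum>(S, T)\<in>?R i j. subset_prob V p (\<lambda>H. S \<union> T \<subseteq> H))"
  proof (intro sum_mono, clarify)
    fix i j
    show "subset_prob V p (\<lambda>H. \<exists>(S, T)\<in>?R i j. S \<union> T \<subseteq> H) \<le> (\<Sum>(S, T)\<in>?R i j. subset_prob V p (\<lambda>H. S \<union> T \<subseteq> H))"
      using subset_prob_union_le[OF fR p1, where A="\<lambda>(S,T) H. S \<union> T \<subseteq> H"]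
      by (simp add: case_prod_unfold)
  qed
  also have "\<dots> = (\<Sum>(i, j)\<in>?I. \<Sum>(S, T)\<in>?R i j. \<Prod>x\<in>S \<union> T. p x)"
    using \<Q>(2) by (intro sum.cong refl, clarify, intro sum.cong refl, clarify)
      (intro subset_prob_superset V, blast)
  finally show ?thesis by simp
qed

section \<open>Counting patterns of four points\<close>

text \<open>The discrete version of crossings: two edges \<open>a b\<close> and \<open>c d\<close> all of whose points are near
to each other. Requiring nearness for all four pairs makes the condition symmetric under exchanging the
end points of an edge, so that in the counting below any point may be taken as the first one.\<close>

definition quads :: "'a set \<Rightarrow> ('a \<Rightarrow> 'a \<Rightarrow> bool) \<Rightarrow> ('a \<Rightarrow> 'a \<Rightarrow> bool) \<Rightarrow> 'a set set" where
  "quads V adj near = {{a, b, c, d} | a b c d. {a, b, c, d} \<subseteq> V \<and> distinct [a, b, c, d] \<and>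
     adj a b \<and> adj c d \<and> near a c \<and> near a d \<and> near b c \<and> near b d}"

lemma quadsD:
  assumes "S \<in> quads V adj near"
  shows "S \<subseteq> V" "card S = 4" "finite S"
  using assms unfolding quads_def by auto

lemma finite_quads: "finite V \<Longrightarrow> finite (quads V adj near)"
  by (rule finite_subset[of _ "Pow V"]) (auto dest: quadsD)

lemma card_Sigma_le:
  assumes "finite X" "\<And>x. x \<in> X \<Longrightarrow> finite (Y x)" "\<And>x. x \<in> X \<Longrightarrow> real (card (Y x)) \<le> b"
  shows "real (card (Sigma X Y)) \<le> real (card X) * b"
proof -
  have "real (card (Sigma X Y)) = (\<Sum>x\<in>X. real (card (Y x)))"
    using assms by (subst card_SigmaI) auto
  also have "\<dots> \<le> real (card X) * b"
    using sum_bounded_above[of X "\<lambda>x. real (card (Y x))" b] assms(3) by simp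
  finally show ?thesis .
qed

lemma card_path_le:
  fixes \<alpha> \<beta> :: real
  assumes X: "finite X" and V: "finite V"
    and near: "\<And>x. x \<in> X \<Longrightarrow> real (card {y\<in>V. near x y}) \<le> \<beta>"
    and adj: "\<And>y. y \<in> V \<Longrightarrow> real (card {z\<in>V. adj y z}) \<le> \<alpha>" and "0 \<le> \<alpha>"
  shows "finite (SIGMA x:X. SIGMA y:{y\<in>V. near x y}. {z\<in>V. adj y z})"
    and "real (card (SIGMA x:X. SIGMA y:{y\<in>V. near x y}. {z\<in>V. adj y z})) \<le> real (card X) * (\<beta> * \<alpha>)"
proof -
  show "finite (SIGMA x:X. SIGMA y:{y\<in>V. near x y}. {z\<in>V. adj y z})"
    using X V by (intro finite_SigmaI) auto
  show "real (card (SIGMA x:X. SIGMA y:{y\<in>V. near x y}. {z\<in>V. adj y z})) \<le> real (card X) * (\<beta> * \<alpha>)"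
  proof (rule card_Sigma_le[OF X])
    fix x assume x: "x \<in> X"
    show "finite (SIGMA y:{y\<in>V. near x y}. {z\<in>V. adj y z})"
      using V by (intro finite_SigmaI) auto
    have "real (card (SIGMA y:{y\<in>V. near x y}. {z\<in>V. adj y z})) \<le> real (card {y\<in>V. near x y}) * \<alpha>"
      using V by (intro card_Sigma_le) (auto intro: adj)
    also have "\<dots> \<le> \<beta> * \<alpha>" using near[OF x] \<open>0 \<le> \<alpha>\<close> by (rule mult_right_mono)
    finally show "real (card (SIGMA y:{y\<in>V. near x y}. {z\<in>V. adj y z})) \<le> \<beta> * \<alpha>" .
  qed
qed

text \<open>Such a pattern is found by choosing \<open>a\<close>, then the neighbour \<open>b\<close>, then \<open>c\<close> near \<open>a\<close> and
finally the neighbour \<open>d\<close>.\<close>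

lemma card_near_edge_pairs_le:
  fixes \<alpha> \<beta> :: real
  assumes V: "finite V"
    and near: "\<And>x. x \<in> V \<Longrightarrow> real (card {y\<in>V. near x y}) \<le> \<beta>"
    and adj: "\<And>y. y \<in> V \<Longrightarrow> real (card {z\<in>V. adj y z}) \<le> \<alpha>" and "0 \<le> \<alpha>" "0 \<le> \<beta>"
    and sub: "\<And>S. S \<in> \<Q> \<Longrightarrow> \<exists>a b c d. S = {a, b, c, d} \<and> {a, b, c, d} \<subseteq> V \<and> adj a b \<and> near a c \<and> adj c d"
  shows "real (card \<Q>) \<le> real (card V) * \<alpha> * (\<beta> * \<alpha>)"
proof -
  let ?X = "SIGMA a:V. {b\<in>V. adj a b}"
  let ?P = "SIGMA x:?X. SIGMA c:{c\<in>V. near (fst x) c}. {d\<in>V. adj c d}"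
  let ?f = "\<lambda>((a, b), (c, d)). {a, b, c, d}"
  have fX: "finite ?X" using V by (intro finite_SigmaI) auto
  have cX: "real (card ?X) \<le> real (card V) * \<alpha>"
    using V adj by (intro card_Sigma_le) auto
  have fP: "finite ?P" and cP: "real (card ?P) \<le> real (card ?X) * (\<beta> * \<alpha>)"
    using card_path_le[OF fX V, of "\<lambda>x. near (fst x)" \<beta> adj \<alpha>] near adj \<open>0 \<le> \<alpha>\<close> by auto
  have "\<Q> \<subseteq> ?f ` ?P"
  proof
    fix S assume "S \<in> \<Q>"
    from sub[OF this] obtain a b c d where "S = {a, b, c, d}" "{a, b, c, d} \<subseteq> V"
      "adj a b" "near a c" "adj c d" by blast
    then show "S \<in> ?f ` ?P" by (intro image_eqI[of _ _ "((a, b), (c, d))"]) auto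
  qed
  then have "card \<Q> \<le> card ?P"
    using surj_card_le[OF fP] by blast
  then have "real (card \<Q>) \<le> real (card ?P)" by simp
  also have "\<dots> \<le> real (card V) * \<alpha> * (\<beta> * \<alpha>)"
    using cP cX mult_right_mono[OF cX, of "\<beta> * \<alpha>"] assms(4,5) by auto
  finally show ?thesis .
qed

lemma card_quads_le:
  fixes \<alpha> \<beta> :: real
  assumes "finite V"
    and "\<And>x. x \<in> V \<Longrightarrow> real (card {y\<in>V. near x y}) \<le> \<beta>"
    and "\<And>y. y \<in> V \<Longrightarrow> real (card {z\<in>V. adj y z}) \<le> \<alpha>" and "0 \<le> \<alpha>" "0 \<le> \<beta>"
  shows "real (card (quads V adj near)) \<le> real (card V) * \<alpha> * (\<beta> * \<alpha>)"
proof (rule card_near_edge_pairs_le[OF assms])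
  fix S assume "S \<in> quads V adj near"
  then obtain a b c d where "S = {a, b, c, d}" "{a, b, c, d} \<subseteq> V" "adj a b" "near a c" "adj c d"
    unfolding quads_def by blast
  then show "\<exists>a b c d. S = {a, b, c, d} \<and> {a, b, c, d} \<subseteq> V \<and> adj a b \<and> near a c \<and> adj c d"
    by blast
qed

text \<open>A four-point set that crosses on two planes may be split into edges in two different ways. The points \<open>a\<close> and
\<open>c\<close> belong to different edges for the first plane. For the second plane they either belong to different edges
as well, and are near for both planes, or they are joined by an edge, and adjacent points are near for all planes.\<close>

lemma quads_Int_cases:
  assumes S: "S \<in> quads V adj near" "S \<in> quads V adj near'"
    and sym: "symp adj"
    and both: "\<And>x y. x \<in> V \<Longrightarrow> y \<in> V \<Longrightarrow> near x y \<Longrightarrow> near' x y \<Longrightarrow> near2 x y"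
    and nsym: "symp near'"
    and local: "\<And>x y. x \<in> V \<Longrightarrow> y \<in> V \<Longrightarrow> adj x y \<Longrightarrow> near2 x y"
  shows "\<exists>a b c d. S = {a, b, c, d} \<and> {a, b, c, d} \<subseteq> V \<and> adj a b \<and> near2 a c \<and> adj c d"
proof -
  from S(1) obtain a b c d where 1: "S = {a, b, c, d}" "{a, b, c, d} \<subseteq> V" "distinct [a, b, c, d]"
     "adj a b" "adj c d" "near a c" "near a d" "near b c" "near b d"
    unfolding quads_def by blast
  from S(2) obtain e f g h where 2: "S = {e, f, g, h}" "distinct [e, f, g, h]"
     "adj e f" "adj g h" "near' e g" "near' e h" "near' f g" "near' f h"
    unfolding quads_def by blast
  have 3: "adj f e" "adj h g" "near' g e" "near' h e" "near' g f" "near' h f"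
    using 2 sympD[OF sym] sympD[OF nsym] by blast+
  have "a \<in> {e,f,g,h}" "c \<in> {e,f,g,h}" "a \<noteq> c" using 1 2 by auto
  then have "near' a c \<or> adj a c"
    unfolding insert_iff empty_iff using 2(3-) 3 by (elim disjE) simp_all
  then have "near2 a c" using local both 1 by auto
  then show ?thesis using 1 by blast
qed

text \<open>Starting from a shared point, the rest of the pattern is reached along edges and near pairs. In every case the new points
include a neighbour of \<open>S\<close> or an edge near \<open>S\<close>. Both are rare, which is where intersecting patterns gain a
factor over disjoint ones.\<close>

lemma quads_overlap_cases:
  assumes T: "T \<in> quads V adj near" and S: "finite S" "card S = 4" "T \<inter> S \<noteq> {}" "T \<noteq> S"
    and sym: "symp adj" "symp near"
  shows "(\<exists>x\<in>V. T - S = {x} \<and> (\<exists>s\<in>S. adj s x)) \<or>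
     (\<exists>x\<in>V. \<exists>y\<in>V. x \<noteq> y \<and> T - S = {x, y} \<and> (\<exists>s\<in>S. adj s x) \<and> (\<exists>s\<in>S. adj s y)) \<or>
     (\<exists>x\<in>V. \<exists>y\<in>V. x \<noteq> y \<and> T - S = {x, y} \<and> (\<exists>s\<in>S. near s x) \<and> adj x y) \<or>
     (\<exists>x\<in>V. \<exists>y\<in>V. \<exists>z\<in>V. distinct [x, y, z] \<and> T - S = {x, y, z} \<and>
         (\<exists>s\<in>S. adj s x) \<and> (\<exists>s\<in>S. near s y) \<and> adj y z)"
proof -
  from T obtain a b c d where 1: "T = {a, b, c, d}" "{a, b, c, d} \<subseteq> V" "distinct [a, b, c, d]"
     "adj a b" "adj c d" "near a c" "near a d" "near b c" "near b d"
    unfolding quads_def by blast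
  have c4: "card T = 4" using 1 by simp
  have "\<not> T \<subseteq> S"
    using card_subset_eq[OF S(1)] S c4 by auto
  have D1: ?thesis if "x \<in> V" "T - S = {x}" "s \<in> S" "adj s x" for x s
    by (rule disjI1, intro bexI conjI; fact)
  have D2: ?thesis
    if "x \<in> V" "y \<in> V" "x \<noteq> y" "T - S = {x, y}" "s \<in> S" "adj s x" "u \<in> S" "adj u y" for x y s u
    by (rule disjI2, rule disjI1, intro bexI conjI; fact)
  have D3: ?thesis
    if "x \<in> V" "y \<in> V" "x \<noteq> y" "T - S = {x, y}" "s \<in> S" "near s x" "adj x y" for x y s
    by (rule disjI2, rule disjI2, rule disjI1, intro bexI conjI; fact)
  have D4: ?thesis
    if "x \<in> V" "y \<in> V" "z \<in> V" "distinct [x, y, z]" "T - S = {x, y, z}" "s \<in> S" "adj s x"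
      "u \<in> S" "near u y" "adj y z" for x y z s u
    by (rule disjI2, rule disjI2, rule disjI2, intro bexI conjI; fact)
  \<comment> \<open>up to relabelling within the pattern, \<open>a\<close> is a shared point\<close>
  have main: ?thesis
    if 1: "T = {a, b, c, d}" "{a, b, c, d} \<subseteq> V" "distinct [a, b, c, d]"
     "adj a b" "adj c d" "near a c" "near a d" "near b c" "near b d" and aS: "a \<in> S" for a b c d
  proof -
    have e: "T - S = (if b \<in> S then {} else {b}) \<union> (if c \<in> S then {} else {c}) \<union> (if d \<in> S then {} else {d})"
      using 1 aS by auto
    have adj_cd: "adj c d" "adj d c" and adj_ab: "adj a b" and near_ac: "near a c"
      using 1 sympD[OF sym(1)] by auto
    have inV: "b \<in> V" "c \<in> V" "d \<in> V" and dist: "b \<noteq> c" "b \<noteq> d" "c \<noteq> d"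
      using 1 by auto
    consider "b \<in> S" "c \<in> S" "d \<in> S" | "b \<in> S" "c \<in> S" "d \<notin> S" | "b \<in> S" "c \<notin> S" "d \<in> S"
       | "b \<in> S" "c \<notin> S" "d \<notin> S" | "b \<notin> S" "c \<in> S" "d \<in> S" | "b \<notin> S" "c \<in> S" "d \<notin> S"
       | "b \<notin> S" "c \<notin> S" "d \<in> S" | "b \<notin> S" "c \<notin> S" "d \<notin> S" by blast
    then show ?thesis
    proof cases
      case 1 then show ?thesis using 1 that(1) aS \<open>\<not> T \<subseteq> S\<close> by auto
    next
      case 2 then have "T - S = {d}" using e by auto
      then show ?thesis using 2(2) adj_cd(1) inV by - (rule D1; assumption)
    next
      case 3 then have "T - S = {c}" using e by auto
      then show ?thesis using 3(3) adj_cd(2) inV by - (rule D1; assumption)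
    next
      case 4 then have "T - S = {c, d}" using e by auto
      then show ?thesis using near_ac adj_cd(1) dist inV aS by - (rule D3; assumption)
    next
      case 5 then have "T - S = {b}" using e by auto
      then show ?thesis using adj_ab inV aS by - (rule D1; assumption)
    next
      case 6 then have "T - S = {b, d}" using e by auto
      then show ?thesis using 6(2) adj_ab adj_cd(1) dist inV aS by - (rule D2; assumption)
    next
      case 7 then have "T - S = {b, c}" using e by auto
      then show ?thesis using 7(3) adj_ab adj_cd(2) dist inV aS by - (rule D2; assumption)
    next
      case 8 then have "T - S = {b, c, d}" using e by auto
      moreover have "distinct [b, c, d]" using dist by simp
      ultimately show ?thesis using adj_ab adj_cd(1) near_ac inV aS by - (rule D4; assumption)
    qed
  qed
  have 2: "adj b a" "adj d c" "near c a" "near d a" "near c b" "near d b"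
    using 1 sympD[OF sym(1)] sympD[OF sym(2)] by blast+
  consider "a \<in> S" | "b \<in> S" | "c \<in> S" | "d \<in> S" using 1 S by auto
  then show ?thesis
  proof cases
    assume "a \<in> S"
    from main[OF 1 this] show ?thesis .
  next
    assume S': "b \<in> S"
    have "T = {b, a, c, d}" "{b, a, c, d} \<subseteq> V" "distinct [b, a, c, d]"
      using 1(1,2,3) by auto
    from main[OF this _ _ _ _ _ _ S'] show ?thesis using 1(4-) 2 by blast
  next
    assume S': "c \<in> S"
    have "T = {c, d, a, b}" "{c, d, a, b} \<subseteq> V" "distinct [c, d, a, b]"
      using 1(1,2,3) by auto
    from main[OF this _ _ _ _ _ _ S'] show ?thesis using 1(4-) 2 by blast
  next
    assume S': "d \<in> S"
    have "T = {d, c, a, b}" "{d, c, a, b} \<subseteq> V" "distinct [d, c, a, b]"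
      using 1(1,2,3) by auto
    from main[OF this _ _ _ _ _ _ S'] show ?thesis using 1(4-) 2 by blast
  qed
qed

lemma sum_Un4_le:
  fixes f :: "'a \<Rightarrow> real"
  assumes "finite A" "finite B" "finite C" "finite D" "\<And>x. 0 \<le> f x"
  shows "sum f (A \<union> B \<union> C \<union> D) \<le> sum f A + sum f B + sum f C + sum f D"
proof -
  have un: "sum f (X \<union> Y) \<le> sum f X + sum f Y" if "finite X" "finite Y" for X Y
    using sum.union_inter[OF that, of f] sum_nonneg[of "X \<inter> Y" f] assms(5) by simp
  show ?thesis
    using un[of "A \<union> B \<union> C" D] un[of "A \<union> B" C] un[of A B] assms by simp
qed

text \<open>Here \<open>p\<close> is the price of one new point, \<open>p * \<alpha>\<close> that of a new neighbour of a given point, and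
\<open>p\<^sup>2 * (\<beta> * \<alpha>)\<close> that of a new edge near a given point. Every case of
\<open>quads_overlap_cases\<close> pays at least one of the latter two. The factor \<open>16\<close> in the proof counts the
possible sets of shared points.\<close>

lemma sum_quads_overlap_le:
  fixes \<alpha> \<beta> p :: real
  assumes V: "finite V"
    and near: "\<And>x. x \<in> V \<Longrightarrow> real (card {y\<in>V. near x y}) \<le> \<beta>"
    and adj: "\<And>y. y \<in> V \<Longrightarrow> real (card {z\<in>V. adj y z}) \<le> \<alpha>" and pos: "0 \<le> \<alpha>" "0 \<le> \<beta>" "0 \<le> p"
    and small: "p * \<alpha> \<le> 1" "p\<^sup>2 * (\<beta> * \<alpha>) \<le> 1"
    and S: "S \<subseteq> V" "card S = 4"
    and sym: "symp adj" "symp near"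
  shows "(\<Sum>T | T \<in> quads V adj near \<and> T \<inter> S \<noteq> {} \<and> T \<noteq> S. p ^ card (T - S))
    \<le> 320 * (p * \<alpha> + p\<^sup>2 * (\<beta> * \<alpha>))"
proof -
  let ?\<T> = "{T. T \<in> quads V adj near \<and> T \<inter> S \<noteq> {} \<and> T \<noteq> S}"
  have fS: "finite S" using S V finite_subset by blast
  let ?A = "SIGMA s:S. {x\<in>V. adj s x}"
  let ?B = "SIGMA s:S. SIGMA x:{x\<in>V. near s x}. {y\<in>V. adj x y}"
  let ?R1 = "(\<lambda>(s, x). {x}) ` ?A"
  let ?R2 = "(\<lambda>((s, x), (u, y)). {x, y}) ` {((s, x), (u, y)). (s, x) \<in> ?A \<and> (u, y) \<in> ?A \<and> x \<noteq> y}"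
  let ?R3 = "(\<lambda>(s, x, y). {x, y}) ` {(s, x, y). (s, x, y) \<in> ?B \<and> x \<noteq> y}"
  let ?R4 = "(\<lambda>((s, x), (u, y, z)). {x, y, z}) ` {((s, x), (u, y, z)). (s, x) \<in> ?A \<and> (u, y, z) \<in> ?B \<and> distinct [x, y, z]}"
  have fA: "finite ?A" using fS V by (intro finite_SigmaI) auto
  have cA: "real (card ?A) \<le> 4 * \<alpha>"
    using card_Sigma_le[OF fS, of "\<lambda>s. {x\<in>V. adj s x}" \<alpha>] S V adj by auto
  have fB: "finite ?B" and cB: "real (card ?B) \<le> 4 * (\<beta> * \<alpha>)"
    using card_path_le[OF fS V, of near \<beta> adj \<alpha>] near adj pos S by auto
  have f2: "finite {((s, x), (u, y)). (s, x) \<in> ?A \<and> (u, y) \<in> ?A \<and> x \<noteq> y}" (is "finite ?X2")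
    by (rule finite_subset[of _ "?A \<times> ?A"]) (use fA in auto)
  have f3: "finite {(s, x, y). (s, x, y) \<in> ?B \<and> x \<noteq> y}" (is "finite ?X3")
    by (rule finite_subset[of _ "?B"]) (use fB in auto)
  have f4: "finite {((s, x), (u, y, z)). (s, x) \<in> ?A \<and> (u, y, z) \<in> ?B \<and> distinct [x, y, z]}" (is "finite ?X4")
    by (rule finite_subset[of _ "?A \<times> ?B"]) (use fA fB in auto)
  have c1: "real (card ?R1) \<le> 4 * \<alpha>"
    using card_image_le[OF fA, of "\<lambda>(s, x). {x}"] cA by linarith
  have "card ?R2 \<le> card (?A \<times> ?A)"
    using card_image_le[OF f2] card_mono[of "?A \<times> ?A" ?X2] fA by (auto intro: order_trans)
  then have "real (card ?R2) \<le> real (card ?A) * real (card ?A)"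
    unfolding card_cartesian_product of_nat_mult[symmetric] of_nat_le_iff .
  also have "\<dots> \<le> (4 * \<alpha>) * (4 * \<alpha>)" using cA pos by (intro mult_mono) auto
  finally have c2: "real (card ?R2) \<le> 16 * \<alpha>\<^sup>2" by (simp add: power2_eq_square)
  have "card ?R3 \<le> card ?B"
    using card_image_le[OF f3] card_mono[of "?B" ?X3] fB by (auto intro: order_trans)
  then have c3: "real (card ?R3) \<le> 4 * (\<beta> * \<alpha>)" using cB by linarith
  have "card ?R4 \<le> card (?A \<times> ?B)"
    using card_image_le[OF f4] card_mono[of "?A \<times> ?B" ?X4] fA fB by (auto intro: order_trans)
  then have "real (card ?R4) \<le> real (card ?A) * real (card ?B)"
    unfolding card_cartesian_product of_nat_mult[symmetric] of_nat_le_iff .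
  also have "\<dots> \<le> (4 * \<alpha>) * (4 * (\<beta> * \<alpha>))" using cA cB pos by (intro mult_mono) auto
  finally have c4: "real (card ?R4) \<le> (4 * \<alpha>) * (4 * (\<beta> * \<alpha>))" .
  let ?R = "?R1 \<union> ?R2 \<union> ?R3 \<union> ?R4"
  have fR: "finite ?R1" "finite ?R2" "finite ?R3" "finite ?R4" using fA f2 f3 f4 by auto
  have sub: "(\<lambda>T. (T \<inter> S, T - S)) ` ?\<T> \<subseteq> Pow S \<times> ?R"
  proof (rule image_subsetI)
    fix T assume "T \<in> ?\<T>"
    then have T: "T \<in> quads V adj near" "T \<inter> S \<noteq> {}" "T \<noteq> S" by auto
    have "T - S \<in> ?R"
      using quads_overlap_cases[OF T(1) fS S(2) T(2,3) sym]
    proof (elim disjE bexE conjE, goal_cases)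
      case (1 x s)
      then have "T - S \<in> ?R1" by (intro image_eqI[of _ _ "(s, x)"]) auto
      then show ?case by blast
    next
      case (2 x y s u)
      then have "T - S \<in> ?R2" by (intro image_eqI[of _ _ "((s, x), (u, y))"]) auto
      then show ?case by blast
    next
      case (3 x y s)
      then have "T - S \<in> ?R3" by (intro image_eqI[of _ _ "(s, x, y)"]) auto
      then show ?case by blast
    next
      case (4 x y z s u)
      then have "T - S \<in> ?R4" by (intro image_eqI[of _ _ "((s, x), (u, y, z))"]) auto
      then show ?case by blast
    qed
    then show "(T \<inter> S, T - S) \<in> Pow S \<times> ?R" by auto
  qed
  \<comment> \<open>a pattern is determined by its shared points and its new points\<close>
  have inj: "inj_on (\<lambda>T. (T \<inter> S, T - S)) ?\<T>"
    by (intro inj_onI) (metis Int_Diff_Un prod.inject)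
  have "(\<Sum>T\<in>?\<T>. p ^ card (T - S)) = (\<Sum>(T0, R)\<in>(\<lambda>T. (T \<inter> S, T - S)) ` ?\<T>. p ^ card R)"
    by (simp add: sum.reindex[OF inj])
  also have "\<dots> \<le> (\<Sum>(T0, R)\<in>Pow S \<times> ?R. p ^ card R)"
    using sub fS fR pos by (intro sum_mono2) auto
  also have "\<dots> = (\<Sum>T0\<in>Pow S. \<Sum>R\<in>?R. p ^ card R)"
    by (rule sum.cartesian_product[symmetric])
  also have "\<dots> = 16 * (\<Sum>R\<in>?R. p ^ card R)"
    using S fS by (simp add: card_Pow)
  finally have split: "(\<Sum>T\<in>?\<T>. p ^ card (T - S)) \<le> 16 * (\<Sum>R\<in>?R. p ^ card R)" .
  have "(\<Sum>R\<in>?R. p ^ card R) \<le> (\<Sum>R\<in>?R1. p ^ card R) + (\<Sum>R\<in>?R2. p ^ card R)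
      + (\<Sum>R\<in>?R3. p ^ card R) + (\<Sum>R\<in>?R4. p ^ card R)"
    by (rule sum_Un4_le) (use fR pos in auto)
  also have c: "(\<Sum>R\<in>?R1. p ^ card R) = card ?R1 * p"
    by (subst sum.cong[OF refl, of _ _ "\<lambda>_. p"]) auto
  also have "(\<Sum>R\<in>?R2. p ^ card R) = card ?R2 * p\<^sup>2"
    by (subst sum.cong[OF refl, of _ _ "\<lambda>_. p\<^sup>2"]) (auto simp: power2_eq_square)
  also have "(\<Sum>R\<in>?R3. p ^ card R) = card ?R3 * p\<^sup>2"
    by (subst sum.cong[OF refl, of _ _ "\<lambda>_. p\<^sup>2"]) (auto simp: power2_eq_square)
  also have "(\<Sum>R\<in>?R4. p ^ card R) = card ?R4 * p^3"
    by (subst sum.cong[OF refl, of _ _ "\<lambda>_. p^3"]) (auto simp: power3_eq_cube)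
  also have "real (card ?R1) * p + real (card ?R2) * p\<^sup>2 + real (card ?R3) * p\<^sup>2 + real (card ?R4) * p^3
     \<le> 4 * \<alpha> * p + 16 * \<alpha>\<^sup>2 * p\<^sup>2 + 4 * (\<beta> * \<alpha>) * p\<^sup>2 + (4 * \<alpha>) * (4 * (\<beta> * \<alpha>)) * p^3"
    using c1 c2 c3 c4 pos by (intro add_mono mult_right_mono) auto
  also have "\<dots> = 4 * (p * \<alpha>) + 16 * ((p * \<alpha>) * (p * \<alpha>)) + 4 * (p\<^sup>2 * (\<beta> * \<alpha>)) + 16 * ((p * \<alpha>) * (p\<^sup>2 * (\<beta> * \<alpha>)))"
    by (simp add: power2_eq_square power3_eq_cube)
  also have "\<dots> \<le> 4 * (p * \<alpha>) + 16 * ((p * \<alpha>) * 1) + 4 * (p\<^sup>2 * (\<beta> * \<alpha>)) + 16 * (1 * (p\<^sup>2 * (\<beta> * \<alpha>)))"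
    using small pos by (intro add_mono mult_left_mono mult_right_mono) auto
  also have "\<dots> = 20 * (p * \<alpha> + p\<^sup>2 * (\<beta> * \<alpha>))" by (simp add: algebra_simps)
  finally have key: "(\<Sum>R\<in>?R. p ^ card R) \<le> 20 * (p * \<alpha> + p\<^sup>2 * (\<beta> * \<alpha>))" .
  show ?thesis using split key by linarith
qed

section \<open>Hitting several families of patterns\<close>

lemma exp_minus_le_one_minus:
  fixes x :: real
  assumes "0 \<le> x" "x \<le> 1/2"
  shows "exp (- (2 * x)) \<le> 1 - x"
proof -
  have "x * x \<le> (1/2) * x" using assms by (intro mult_right_mono) auto
  then have "- (2 * x) \<le> - x - 2 * x\<^sup>2" by (simp add: power2_eq_square)
  also have "\<dots> \<le> ln (1 - x)" using assms by (intro ln_one_minus_pos_lower_bound)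
  finally have "exp (- (2 * x)) \<le> exp (ln (1 - x))" by simp
  then show ?thesis using assms by simp
qed

text \<open>The bound for \<open>N\<close> families of patterns with common edges. The exponential comes from the disjoint hits.
In the second term, \<open>N\<^sup>2\<close> counts pairs of families, and the two summands belong to pairs of patterns
that intersect without being equal and to patterns that lie in both families.\<close>

lemma subset_prob_all_quads_hit_le:
  fixes V :: "'a set" and p' :: "'a \<Rightarrow> real" and N :: nat and \<alpha> \<beta> \<beta>2 p :: real
    and near :: "nat \<Rightarrow> 'a \<Rightarrow> 'a \<Rightarrow> bool"
  assumes V: "finite V" and p': "\<And>x. x \<in> V \<Longrightarrow> 0 \<le> p' x \<and> p' x \<le> p" and p: "0 \<le> p" "p \<le> 1/2"
    and adj: "\<And>y. y \<in> V \<Longrightarrow> real (card {z\<in>V. adj y z}) \<le> \<alpha>"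
    and near: "\<And>i x. i < N \<Longrightarrow> x \<in> V \<Longrightarrow> real (card {y\<in>V. near i x y}) \<le> \<beta>"
    and near2: "\<And>x. x \<in> V \<Longrightarrow> real (card {y\<in>V. near2 x y}) \<le> \<beta>2"
    and pos: "0 \<le> \<alpha>" "0 \<le> \<beta>" "0 \<le> \<beta>2"
    and small: "p * \<alpha> \<le> 1" "p\<^sup>2 * (\<beta> * \<alpha>) \<le> 1"
    and sym: "symp adj" "\<And>i. symp (near i)"
    and both: "\<And>i j x y. i < j \<Longrightarrow> j < N \<Longrightarrow> near i x y \<Longrightarrow> near j x y \<Longrightarrow> near2 x y"
    and local: "\<And>x y. adj x y \<Longrightarrow> near2 x y"
  shows "subset_prob V p' (\<lambda>H. \<forall>i<N. contains_some (quads V adj (near i)) H)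
    \<le> exp (- (real N * exp (- (2 * (p ^ 4 * (card V * \<alpha> * (\<beta> * \<alpha>)))))))
      + (real N)\<^sup>2 * (p ^ 4 * (card V * \<alpha> * (\<beta> * \<alpha>)) * (320 * (p * \<alpha> + p\<^sup>2 * (\<beta> * \<alpha>)))
          + p ^ 4 * (card V * \<alpha> * (\<beta>2 * \<alpha>)))"
proof -
  let ?Q = "\<lambda>i. quads V adj (near i)"
  let ?q = "exp (- (2 * (p ^ 4 * (card V * \<alpha> * (\<beta> * \<alpha>)))))"
  let ?e = "p ^ 4 * (card V * \<alpha> * (\<beta> * \<alpha>)) * (320 * (p * \<alpha> + p\<^sup>2 * (\<beta> * \<alpha>)))
          + p ^ 4 * (card V * \<alpha> * (\<beta>2 * \<alpha>))"
  let ?I = "{(i, j). i < j \<and> j < N}"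
  have p1: "0 \<le> p' x \<and> p' x \<le> 1" and p2: "0 \<le> p' x \<and> p' x \<le> 1/2" if "x \<in> V" for x
    using p'[OF that] p by auto
  have p4: "0 \<le> p ^ 4" "p ^ 4 \<le> 1/2"
  proof -
    have "p ^ 4 \<le> (1/2) ^ 4" using p by (intro power_mono) auto
    then show "p ^ 4 \<le> 1/2" by (simp add: power4_eq_xxxx)
  qed (use p in simp)
  have fQ: "finite (?Q i)" for i using V by (rule finite_quads)
  have cQ: "real (card (?Q i)) \<le> card V * \<alpha> * (\<beta> * \<alpha>)" if "i < N" for i
    using card_quads_le[OF V near[OF that] adj pos(1,2)] by simp
  have weight: "(\<Prod>x\<in>S. p' x) \<le> p ^ card S" if "S \<subseteq> V" for S
  proof -
    have "(\<Prod>x\<in>S. p' x) \<le> (\<Prod>x\<in>S. p)" using p' that by (intro prod_mono) auto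
    then show ?thesis by simp
  qed
  \<comment> \<open>\<open>?q\<close> bounds the probability of avoiding one family from below\<close>
  have hit: "subset_prob V p' (contains_some (?Q i)) \<le> exp (- ?q)" if i: "i < N" for i
  proof -
    have "?q \<le> exp (- (2 * (p ^ 4 * real (card (?Q i)))))"
      using cQ[OF i] p4 by (simp add: mult_left_mono)
    also have "\<dots> = exp (- (2 * p ^ 4)) ^ card (?Q i)"
      by (simp add: exp_of_nat_mult[symmetric] algebra_simps)
    also have "\<dots> \<le> (1 - p ^ 4) ^ card (?Q i)"
      using exp_minus_le_one_minus[OF p4] by (intro power_mono) auto
    also have "\<dots> = (\<Prod>S\<in>?Q i. 1 - p ^ 4)" by simp
    also have "\<dots> \<le> (\<Prod>S\<in>?Q i. 1 - (\<Prod>x\<in>S. p' x))"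
    proof (intro prod_mono conjI)
      fix S assume S: "S \<in> ?Q i"
      show "1 - p ^ 4 \<le> 1 - (\<Prod>x\<in>S. p' x)" using weight[OF quadsD(1)[OF S]] quadsD(2)[OF S] by simp
    qed (use p4 in auto)
    also have "\<dots> \<le> subset_prob V p' (\<lambda>H. \<not> contains_some (?Q i) H)"
      using subset_prob_avoid_ge[where p=p' and V=V, OF V _ fQ] p1 quadsD(1) by blast
    also have "\<dots> = 1 - subset_prob V p' (contains_some (?Q i))" by (rule subset_prob_not[OF V])
    finally have "subset_prob V p' (contains_some (?Q i)) \<le> 1 + (- ?q)" by simp
    also have "\<dots> \<le> exp (- ?q)" by (rule exp_ge_add_one_self)
    finally show ?thesis .
  qed
  have "(\<Prod>i<N. subset_prob V p' (contains_some (?Q i))) \<le> (\<Prod>i<N. exp (- ?q))"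
    using hit subset_prob_nonneg[of V p'] p1 by (intro prod_mono) auto
  also have "\<dots> = exp (- (real N * ?q))" by (simp add: exp_of_nat_mult[symmetric])
  finally have main: "(\<Prod>i<N. subset_prob V p' (contains_some (?Q i))) \<le> exp (- (real N * ?q))" .
  have err: "(\<Sum>(S, T)\<in>{(S, T). S \<in> ?Q i \<and> T \<in> ?Q j \<and> S \<inter> T \<noteq> {}}. \<Prod>x\<in>S \<union> T. p' x) \<le> ?e"
    if ij: "i < j" "j < N" for i j
  proof -
    have iN: "i < N" using ij by simp
    let ?T = "\<lambda>S. {T. T \<in> ?Q j \<and> T \<inter> S \<noteq> {} \<and> T \<noteq> S}"
    have fT: "finite (?T S)" for S using fQ[of j] by (rule finite_subset[rotated]) auto
    have "{(S, T). S \<in> ?Q i \<and> T \<in> ?Q j \<and> S \<inter> T \<noteq> {}} = (SIGMA S:?Q i. {T\<in>?Q j. S \<inter> T \<noteq> {}})" by auto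
    then have "(\<Sum>(S, T)\<in>{(S, T). S \<in> ?Q i \<and> T \<in> ?Q j \<and> S \<inter> T \<noteq> {}}. \<Prod>x\<in>S \<union> T. p' x)
      = (\<Sum>S\<in>?Q i. \<Sum>T\<in>{T\<in>?Q j. S \<inter> T \<noteq> {}}. \<Prod>x\<in>S \<union> T. p' x)"
      using fQ by (subst sum.Sigma) auto
    also have "\<dots> \<le> (\<Sum>S\<in>?Q i. p ^ 4 * (320 * (p * \<alpha> + p\<^sup>2 * (\<beta> * \<alpha>))) + (if S \<in> ?Q j then p ^ 4 else 0))"
    proof (rule sum_mono)
      fix S assume S: "S \<in> ?Q i"
      note SV = quadsD(1)[OF S] and cS = quadsD(2)[OF S] and fS = quadsD(3)[OF S]
      have w: "(\<Prod>x\<in>S \<union> T. p' x) \<le> p ^ 4 * p ^ card (T - S)" if "T \<in> ?Q j" for T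
      proof -
        have "card (S \<union> T) = card S + card (T - S)"
          using fS quadsD(3)[OF that] by (metis Un_Diff_cancel card_Un_disjoint Diff_disjoint finite_Diff)
        then show ?thesis using weight[of "S \<union> T"] SV quadsD(1)[OF that] cS by (simp add: power_add)
      qed
      have "(\<Sum>T\<in>{T\<in>?Q j. S \<inter> T \<noteq> {}}. \<Prod>x\<in>S \<union> T. p' x)
        \<le> (\<Sum>T\<in>{T\<in>?Q j. S \<inter> T \<noteq> {}}. p ^ 4 * p ^ card (T - S))"
        using w by (intro sum_mono) auto
      also have "\<dots> = p ^ 4 * (\<Sum>T\<in>{T\<in>?Q j. S \<inter> T \<noteq> {}}. p ^ card (T - S))"
        by (simp add: sum_distrib_left)
      also have "(\<Sum>T\<in>{T\<in>?Q j. S \<inter> T \<noteq> {}}. p ^ card (T - S)) \<le>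
         (\<Sum>T\<in>?T S \<union> (if S \<in> ?Q j then {S} else {}). p ^ card (T - S))"
        using fT p by (intro sum_mono2) auto
      also have "\<dots> = (\<Sum>T\<in>?T S. p ^ card (T - S)) + (if S \<in> ?Q j then 1 else 0)"
        using fT by (subst sum.union_disjoint) auto
      also have "(\<Sum>T\<in>?T S. p ^ card (T - S)) \<le> 320 * (p * \<alpha> + p\<^sup>2 * (\<beta> * \<alpha>))"
        by (rule sum_quads_overlap_le[OF V near[OF ij(2)] adj pos(1,2) p(1) small SV cS sym(1) sym(2)])
      finally show "(\<Sum>T\<in>{T\<in>?Q j. S \<inter> T \<noteq> {}}. \<Prod>x\<in>S \<union> T. p' x)
        \<le> p ^ 4 * (320 * (p * \<alpha> + p\<^sup>2 * (\<beta> * \<alpha>))) + (if S \<in> ?Q j then p ^ 4 else 0)"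
        using p4(1) by (simp add: mult_left_mono distrib_left split: if_splits)
    qed
    also have "\<dots> = real (card (?Q i)) * (p ^ 4 * (320 * (p * \<alpha> + p\<^sup>2 * (\<beta> * \<alpha>)))) + real (card (?Q i \<inter> ?Q j)) * p ^ 4"
    proof -
      have "(\<Sum>S\<in>?Q i. if S \<in> ?Q j then p ^ 4 else 0) = real (card (?Q i \<inter> ?Q j)) * p ^ 4"
        using sum.inter_restrict[OF fQ[of i], of "\<lambda>_. p ^ 4" "?Q j"] by simp
      then show ?thesis by (simp add: sum.distrib)
    qed
    also have "\<dots> \<le> (card V * \<alpha> * (\<beta> * \<alpha>)) * (p ^ 4 * (320 * (p * \<alpha> + p\<^sup>2 * (\<beta> * \<alpha>))))
        + (card V * \<alpha> * (\<beta>2 * \<alpha>)) * p ^ 4"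
    proof (intro add_mono mult_right_mono)
      show "real (card (?Q i)) \<le> card V * \<alpha> * (\<beta> * \<alpha>)" by (rule cQ[OF iN])
      show "real (card (?Q i \<inter> ?Q j)) \<le> card V * \<alpha> * (\<beta>2 * \<alpha>)"
      proof (rule card_near_edge_pairs_le[OF V near2 adj pos(1,3)])
        fix S assume "S \<in> ?Q i \<inter> ?Q j"
        then have S: "S \<in> ?Q i" "S \<in> ?Q j" by auto
        show "\<exists>a b c d. S = {a, b, c, d} \<and> {a, b, c, d} \<subseteq> V \<and> adj a b \<and> near2 a c \<and> adj c d"
          by (rule quads_Int_cases[OF S sym(1) both[OF ij] sym(2) local])
      qed
    qed (use p pos in auto)
    also have "\<dots> = ?e" by (simp add: algebra_simps)
    finally show ?thesis .
  qed
  have e0: "0 \<le> ?e" using p pos by simp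
  have fI: "finite ?I" and cI: "card ?I \<le> N * N"
  proof -
    have sub: "?I \<subseteq> {..<N} \<times> {..<N}" by auto
    then show "finite ?I" by (rule finite_subset) auto
    show "card ?I \<le> N * N" using card_mono[OF _ sub] by (simp add: card_cartesian_product)
  qed
  have "(\<Sum>(i, j)\<in>?I. \<Sum>(S, T)\<in>{(S, T). S \<in> ?Q i \<and> T \<in> ?Q j \<and> S \<inter> T \<noteq> {}}. \<Prod>x\<in>S \<union> T. p' x)
    \<le> (\<Sum>(i, j)\<in>?I. ?e)"
    by (intro sum_mono) (use err in auto)
  also have "\<dots> = real (card ?I) * ?e" by (simp add: case_prod_unfold)
  also have "\<dots> \<le> (real N)\<^sup>2 * ?e"
  proof (rule mult_right_mono[OF _ e0])
    show "real (card ?I) \<le> (real N)\<^sup>2"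
      using cI unfolding power2_eq_square of_nat_mult[symmetric] of_nat_le_iff .
  qed
  finally have "(\<Sum>(i, j)\<in>?I. \<Sum>(S, T)\<in>{(S, T). S \<in> ?Q i \<and> T \<in> ?Q j \<and> S \<inter> T \<noteq> {}}. \<Prod>x\<in>S \<union> T. p' x)
    \<le> (real N)\<^sup>2 * ?e" .
  moreover have "subset_prob V p' (\<lambda>H. \<forall>i<N. contains_some (?Q i) H)
     \<le> (\<Prod>i<N. subset_prob V p' (contains_some (?Q i)))
       + (\<Sum>(i, j)\<in>?I. \<Sum>(S, T)\<in>{(S, T). S \<in> ?Q i \<and> T \<in> ?Q j \<and> S \<inter> T \<noteq> {}}. \<Prod>x\<in>S \<union> T. p' x)"
    using subset_prob_all_families_hit_le[where V=V and p=p' and \<Q>="?Q" and n=N] V p2 fQ quadsD(1) by blast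
  ultimately show ?thesis using main by linarith
qed

section \<open>Lattice cells\<close>

definition cell_index :: "real \<Rightarrow> real^'d \<Rightarrow> 'd \<Rightarrow> int" where
  "cell_index h x = (\<lambda>j. \<lfloor>x $ j / h\<rfloor>)"

lemma lattice_box:
  fixes a b :: "'d::finite \<Rightarrow> real"
  assumes "\<And>j. 0 \<le> b j"
  shows "finite {k :: 'd \<Rightarrow> int. \<forall>j. \<bar>real_of_int (k j) - a j\<bar> \<le> b j}" (is "finite ?K")
    and "real (card {k :: 'd \<Rightarrow> int. \<forall>j. \<bar>real_of_int (k j) - a j\<bar> \<le> b j}) \<le> (\<Prod>j\<in>UNIV. 2 * b j + 1)"
proof -
  have eq: "?K = PiE UNIV (\<lambda>j. {\<lceil>a j - b j\<rceil>..\<lfloor>a j + b j\<rfloor>})"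
  proof -
    have "\<bar>real_of_int m - a j\<bar> \<le> b j \<longleftrightarrow> m \<in> {\<lceil>a j - b j\<rceil>..\<lfloor>a j + b j\<rfloor>}" for m j
      by (auto simp: abs_le_iff ceiling_le_iff le_floor_iff)
    then show ?thesis by (auto simp: PiE_UNIV_domain)
  qed
  show "finite ?K" unfolding eq by (intro finite_PiE) auto
  have "real (card ?K) = (\<Prod>j\<in>UNIV. real (card {\<lceil>a j - b j\<rceil>..\<lfloor>a j + b j\<rfloor>}))"
    unfolding eq by (subst card_PiE) auto
  also have "\<dots> \<le> (\<Prod>j\<in>UNIV. 2 * b j + 1)"
  proof (intro prod_mono conjI)
    fix j
    have "real_of_int \<lfloor>a j + b j\<rfloor> \<le> a j + b j" "a j - b j \<le> real_of_int \<lceil>a j - b j\<rceil>" by auto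
    moreover have "0 \<le> b j" by (rule assms)
    moreover have "real (card {\<lceil>a j - b j\<rceil>..\<lfloor>a j + b j\<rfloor>})
        = max 0 (real_of_int \<lfloor>a j + b j\<rfloor> - real_of_int \<lceil>a j - b j\<rceil> + 1)"
      by auto
    ultimately show "real (card {\<lceil>a j - b j\<rceil>..\<lfloor>a j + b j\<rfloor>}) \<le> 2 * b j + 1"
      by linarith
  qed auto
  finally show "real (card ?K) \<le> (\<Prod>j\<in>UNIV. 2 * b j + 1)" .
qed

text \<open>Distances between cells are measured in units of the side length \<open>h\<close>, with \<open>R = r / h\<close>.
The constants leave room for the rounding error of at most \<open>1 \<le> R\<close> per coordinate.\<close>

definition cell_adj :: "real \<Rightarrow> ('d \<Rightarrow> int) \<Rightarrow> ('d \<Rightarrow> int) \<Rightarrow> bool" where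
  "cell_adj R k l \<longleftrightarrow> (\<forall>j. \<bar>real_of_int (k j - l j)\<bar> \<le> 2 * R)"

text \<open>Distance of order \<open>R\<close> after projection to the plane that is spanned by the unit vector in direction
\<open>i1\<close> and by the sum of the one in direction \<open>i2\<close> and \<open>s\<close> times the one in direction \<open>i3\<close>.\<close>

definition cell_near :: "'d \<Rightarrow> 'd \<Rightarrow> 'd \<Rightarrow> real \<Rightarrow> real \<Rightarrow> ('d \<Rightarrow> int) \<Rightarrow> ('d \<Rightarrow> int) \<Rightarrow> bool" where
  "cell_near i1 i2 i3 R s k l \<longleftrightarrow> \<bar>real_of_int (k i1 - l i1)\<bar> \<le> 5 * R \<and>
     \<bar>real_of_int (k i2 - l i2) + s * real_of_int (k i3 - l i3)\<bar> \<le> 10 * R"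

text \<open>A box that contains all cells that are near for two planes whose slopes differ by at least \<open>1 / N\<close>. Nearness
for one plane restricts two directions to order \<open>R\<close>, nearness for both planes restricts three, at the price of
factors \<open>N\<close> from the small angle.\<close>

definition cell_near2 :: "'d \<Rightarrow> 'd \<Rightarrow> 'd \<Rightarrow> real \<Rightarrow> real \<Rightarrow> ('d \<Rightarrow> int) \<Rightarrow> ('d \<Rightarrow> int) \<Rightarrow> bool" where
  "cell_near2 i1 i2 i3 R N k l \<longleftrightarrow> \<bar>real_of_int (k i1 - l i1)\<bar> \<le> 5 * R \<and>
     \<bar>real_of_int (k i2 - l i2)\<bar> \<le> 30 * (N * R) \<and> \<bar>real_of_int (k i3 - l i3)\<bar> \<le> 20 * (N * R)"

lemma symp_cell_adj: "symp (cell_adj R)"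
  by (intro sympI) (simp add: cell_adj_def abs_minus_commute)

lemma symp_cell_near: "symp (cell_near i1 i2 i3 R s)"
proof (intro sympI)
  fix k l assume a: "cell_near i1 i2 i3 R s k l"
  have "real_of_int (l i2 - k i2) + s * real_of_int (l i3 - k i3) =
     - (real_of_int (k i2 - l i2) + s * real_of_int (k i3 - l i3))" by (simp add: algebra_simps)
  then show "cell_near i1 i2 i3 R s l k"
    using a unfolding cell_near_def by (simp only: abs_minus_cancel) (simp add: abs_minus_commute)
qed

text \<open>Subtracting the two conditions on the coordinates \<open>i2\<close> and \<open>i3\<close> isolates the coordinate \<open>i3\<close>.\<close>

lemma cell_near_both:
  assumes "cell_near i1 i2 i3 R s k l" "cell_near i1 i2 i3 R s' k l"
    and s: "0 \<le> s" "s \<le> 1" "1 \<le> N * \<bar>s - s'\<bar>" and N: "1 \<le> N" and R: "0 \<le> R"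
  shows "cell_near2 i1 i2 i3 R N k l"
proof -
  define x y where xy: "x = real_of_int (k i2 - l i2)" "y = real_of_int (k i3 - l i3)"
  have 1: "\<bar>x + s * y\<bar> \<le> 10 * R" "\<bar>x + s' * y\<bar> \<le> 10 * R"
    using assms unfolding cell_near_def xy by auto
  have "\<bar>s - s'\<bar> * \<bar>y\<bar> = \<bar>(x + s * y) - (x + s' * y)\<bar>"
    by (simp add: algebra_simps flip: abs_mult)
  also have "\<dots> \<le> 20 * R" using 1 by linarith
  finally have 2: "\<bar>s - s'\<bar> * \<bar>y\<bar> \<le> 20 * R" .
  have "1 * \<bar>y\<bar> \<le> (N * \<bar>s - s'\<bar>) * \<bar>y\<bar>" using s by (intro mult_right_mono) auto
  also have "\<dots> = N * (\<bar>s - s'\<bar> * \<bar>y\<bar>)" by simp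
  also have "\<dots> \<le> N * (20 * R)" using 2 N by (intro mult_left_mono) auto
  finally have y: "\<bar>y\<bar> \<le> 20 * (N * R)" by simp
  have "\<bar>s * y\<bar> \<le> 1 * \<bar>y\<bar>" unfolding abs_mult using s by (intro mult_right_mono) auto
  moreover have "1 * R \<le> N * R" using N R by (intro mult_right_mono) auto
  ultimately have "\<bar>x\<bar> \<le> 30 * (N * R)" using 1 y by linarith
  with y show ?thesis using assms unfolding cell_near_def cell_near2_def xy by simp
qed

lemma cell_adj_imp_near2:
  assumes "cell_adj R k l" "1 \<le> N" "0 \<le> R"
  shows "cell_near2 i1 i2 i3 R N k l"
proof -
  have "1 * R \<le> N * R" using assms by (intro mult_right_mono) auto
  moreover have "\<bar>real_of_int (k j - l j)\<bar> \<le> 2 * R" for j using assms unfolding cell_adj_def by auto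
  ultimately show ?thesis
    unfolding cell_near2_def using assms(3) by (smt (verit))
qed

lemma card_cell_adj_le:
  fixes V :: "('d::finite \<Rightarrow> int) set"
  assumes "1 \<le> R"
  shows "real (card {l\<in>V. cell_adj R k l}) \<le> (5 * R) ^ CARD('d)"
proof -
  let ?K = "{l :: 'd \<Rightarrow> int. \<forall>j. \<bar>real_of_int (l j) - real_of_int (k j)\<bar> \<le> 2 * R}"
  have "finite ?K" and c: "real (card ?K) \<le> (\<Prod>j\<in>(UNIV::'d set). 2 * (2 * R) + 1)"
    using assms by (intro lattice_box; simp)+
  then have "card {l\<in>V. cell_adj R k l} \<le> card ?K"
    by (intro card_mono) (auto simp: cell_adj_def abs_minus_commute)
  then have "real (card {l\<in>V. cell_adj R k l}) \<le> (2 * (2 * R) + 1) ^ CARD('d)" using c by simp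
  also have "\<dots> \<le> (5 * R) ^ CARD('d)" using assms by (intro power_mono) auto
  finally show ?thesis .
qed

lemma card_cells_le:
  fixes V :: "('d::finite \<Rightarrow> int) set"
  assumes "1 \<le> M" "\<And>k j. k \<in> V \<Longrightarrow> \<bar>real_of_int (k j)\<bar> \<le> M"
  shows "finite V" "real (card V) \<le> (3 * M) ^ CARD('d)"
proof -
  let ?K = "{l :: 'd \<Rightarrow> int. \<forall>j. \<bar>real_of_int (l j) - 0\<bar> \<le> M}"
  have f: "finite ?K" and c: "real (card ?K) \<le> (\<Prod>j\<in>(UNIV::'d set). 2 * M + 1)"
    using assms by (intro lattice_box; simp)+
  have sub: "V \<subseteq> ?K" using assms by auto
  show "finite V" using f sub finite_subset by blast
  have "real (card V) \<le> (2 * M + 1) ^ CARD('d)" using card_mono[OF f sub] c by simp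
  also have "\<dots> \<le> (3 * M) ^ CARD('d)" using assms by (intro power_mono) auto
  finally show "real (card V) \<le> (3 * M) ^ CARD('d)" .
qed

lemma prod_except3:
  fixes f :: "'d::finite \<Rightarrow> real"
  assumes "distinct [i1, i2, i3]" "\<And>j. j \<notin> {i1, i2, i3} \<Longrightarrow> f j = c"
  shows "(\<Prod>j\<in>UNIV. f j) = f i1 * f i2 * f i3 * c ^ (CARD('d) - 3)"
proof -
  have "(\<Prod>j\<in>UNIV. f j) = (\<Prod>j\<in>{i1,i2,i3}. f j) * (\<Prod>j\<in>UNIV - {i1,i2,i3}. f j)"
    by (subst prod.subset_diff[of "{i1,i2,i3}"]) (auto simp: mult.commute)
  also have "(\<Prod>j\<in>UNIV - {i1,i2,i3}. f j) = c ^ card (UNIV - {i1,i2,i3})"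
    using assms by simp
  also have "card (UNIV - {i1,i2,i3}) = CARD('d) - 3"
    using assms by (subst card_Diff_subset) auto
  also have "(\<Prod>j\<in>{i1,i2,i3}. f j) = f i1 * f i2 * f i3" using assms by auto
  finally show ?thesis .
qed

text \<open>The region is a sheared box. An integer shear along \<open>i2\<close> maps it injectively into a straight
box at the cost of a rounding error.\<close>

lemma card_cell_near_le:
  fixes V :: "('d::finite \<Rightarrow> int) set"
  assumes i: "distinct [i1, i2, i3]" and R: "1 \<le> R" and M: "1 \<le> M"
    and V: "\<And>k j. k \<in> V \<Longrightarrow> \<bar>real_of_int (k j)\<bar> \<le> M" and s: "0 \<le> s" "s \<le> 1" and k: "k \<in> V"
  shows "real (card {l\<in>V. cell_near i1 i2 i3 R s k l}) \<le> 253 * R\<^sup>2 * (5 * M) ^ (CARD('d) - 2)"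
proof -
  define b where "b j = (if j = i1 then 5 * R else if j = i2 then 11 * R else 2 * M)" for j
  let ?K = "{l :: 'd \<Rightarrow> int. \<forall>j. \<bar>real_of_int (l j) - real_of_int (k j)\<bar> \<le> b j}"
  let ?f = "\<lambda>l :: 'd \<Rightarrow> int. l(i2 := l i2 + \<lfloor>s * real_of_int (l i3 - k i3)\<rfloor>)"
  have fK: "finite ?K" and c: "real (card ?K) \<le> (\<Prod>j\<in>(UNIV::'d set). 2 * b j + 1)"
    using R M unfolding b_def by (intro lattice_box; simp)+
  have "?f l \<in> ?K" if l: "l \<in> V" "cell_near i1 i2 i3 R s k l" for l
  proof -
    have n: "\<bar>real_of_int (l i1 - k i1)\<bar> \<le> 5 * R"
      "\<bar>real_of_int (l i2 - k i2) + s * real_of_int (l i3 - k i3)\<bar> \<le> 10 * R"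
      using sympD[OF symp_cell_near[of i1 i2 i3 R s], of k l] l(2) unfolding cell_near_def by auto
    have "\<bar>real_of_int (?f l j) - real_of_int (k j)\<bar> \<le> b j" for j
    proof -
      consider "j = i1" | "j = i2" | "j \<noteq> i1" "j \<noteq> i2" by blast
      then show ?thesis
      proof cases
        case 1 then show ?thesis using n i by (auto simp: b_def)
      next
        case 2
        define z where "z = s * real_of_int (l i3 - k i3)"
        have "real_of_int \<lfloor>z\<rfloor> \<le> z" "z - 1 \<le> real_of_int \<lfloor>z\<rfloor>" by linarith+
        then have "\<bar>real_of_int (l i2 - k i2) + real_of_int \<lfloor>z\<rfloor>\<bar> \<le> 11 * R"
          using n(2) R unfolding z_def[symmetric] by linarith
        moreover have "real_of_int (?f l j) - real_of_int (k j) = real_of_int (l i2 - k i2) + real_of_int \<lfloor>z\<rfloor>"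
          using 2 by (simp add: z_def)
        moreover have "b j = 11 * R" using 2 i by (auto simp: b_def)
        ultimately show ?thesis by (simp only:)
      next
        case 3
        then show ?thesis using V[OF l(1), of j] V[OF k, of j] by (simp add: b_def)
      qed
    qed
    then show ?thesis by blast
  qed
  moreover have "inj_on ?f {l\<in>V. cell_near i1 i2 i3 R s k l}"
  proof (rule inj_onI)
    fix l l' assume "?f l = ?f l'"
    then have e: "?f l j = ?f l' j" for j by metis
    have "l j = l' j" if "j \<noteq> i2" for j using e[of j] that by simp
    moreover from this[of i3] have "l i3 = l' i3" using i by auto
    then have "l i2 = l' i2" using e[of i2] by simp
    ultimately show "l = l'" by (metis ext)
  qed
  ultimately have "card {l\<in>V. cell_near i1 i2 i3 R s k l} \<le> card ?K"
    by (intro card_inj_on_le[of ?f] fK) auto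
  then have "real (card {l\<in>V. cell_near i1 i2 i3 R s k l}) \<le> (\<Prod>j\<in>(UNIV::'d set). 2 * b j + 1)"
    using c by simp
  also have "\<dots> = (2 * (5*R) + 1) * (2 * (11 * R) + 1) * (2 * (2*M) + 1) * (2 * (2*M) + 1) ^ (CARD('d) - 3)"
    using i by (subst prod_except3[OF i, of _ "2 * (2*M) + 1"]) (auto simp: b_def)
  also have "\<dots> \<le> (11 * R) * (23 * R) * (5 * M) * (5 * M) ^ (CARD('d) - 3)"
    using R M by (intro mult_mono power_mono) auto
  also have "\<dots> = 253 * R\<^sup>2 * (5 * M) ^ Suc (CARD('d) - 3)"
    by (simp add: power2_eq_square)
  also have "Suc (CARD('d) - 3) = CARD('d) - 2"
  proof -
    have "card {i1, i2, i3} \<le> CARD('d)" by (intro card_mono) auto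
    then show ?thesis using i by simp
  qed
  finally show ?thesis .
qed

lemma card_cell_near2_le:
  fixes V :: "('d::finite \<Rightarrow> int) set"
  assumes i: "distinct [i1, i2, i3]" and R: "1 \<le> R" and M: "1 \<le> M" and N: "1 \<le> N"
    and V: "\<And>k j. k \<in> V \<Longrightarrow> \<bar>real_of_int (k j)\<bar> \<le> M" and k: "k \<in> V"
  shows "real (card {l\<in>V. cell_near2 i1 i2 i3 R N k l}) \<le> 27511 * N\<^sup>2 * R ^ 3 * (5 * M) ^ (CARD('d) - 3)"
proof -
  define b where "b j = (if j = i1 then 5 * R else if j = i2 then 30 * (N * R)
     else if j = i3 then 20 * (N * R) else 2 * M)" for j
  let ?K = "{l :: 'd \<Rightarrow> int. \<forall>j. \<bar>real_of_int (l j) - real_of_int (k j)\<bar> \<le> b j}"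
  have NR: "1 \<le> N * R" using mult_mono[of 1 N 1 R] N R by simp
  have fK: "finite ?K" and c: "real (card ?K) \<le> (\<Prod>j\<in>(UNIV::'d set). 2 * b j + 1)"
    using R M NR unfolding b_def by (intro lattice_box; simp)+
  have "{l\<in>V. cell_near2 i1 i2 i3 R N k l} \<subseteq> ?K"
  proof clarify
    fix l j assume l: "l \<in> V" "cell_near2 i1 i2 i3 R N k l"
    show "\<bar>real_of_int (l j) - real_of_int (k j)\<bar> \<le> b j"
      using l(2) V[OF l(1), of j] V[OF k, of j] unfolding b_def cell_near2_def
      by (auto simp: abs_minus_commute)
  qed
  then have "card {l\<in>V. cell_near2 i1 i2 i3 R N k l} \<le> card ?K" by (rule card_mono[OF fK])
  then have "real (card {l\<in>V. cell_near2 i1 i2 i3 R N k l}) \<le> (\<Prod>j\<in>(UNIV::'d set). 2 * b j + 1)"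
    using c by linarith
  also have "\<dots> = (2 * (5*R) + 1) * (2 * (30 * (N * R)) + 1) * (2 * (20 * (N * R)) + 1) * (2 * (2*M) + 1) ^ (CARD('d) - 3)"
    using i by (subst prod_except3[OF i, of _ "2 * (2*M) + 1"]) (auto simp: b_def)
  also have "\<dots> \<le> (11 * R) * (61 * (N * R)) * (41 * (N * R)) * (5 * M) ^ (CARD('d) - 3)"
    using R M N NR by (intro mult_mono power_mono mult_nonneg_nonneg) auto
  also have "\<dots> = 27511 * N\<^sup>2 * R ^ 3 * (5 * M) ^ (CARD('d) - 3)"
    by (simp add: power2_eq_square power3_eq_cube)
  finally show ?thesis .
qed

lemma borel_cell: "{x :: real^'d::finite. cell_index h x = k} \<in> sets borel"
proof -
  have "{x :: real^'d. cell_index h x = k} = (\<Inter>j\<in>UNIV. {x. \<lfloor>x $ j / h\<rfloor> = k j})"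
    by (auto simp: cell_index_def fun_eq_iff)
  also have "\<dots> \<in> sets borel"
  proof (intro sets.finite_INT)
    fix j :: 'd
    have "{x :: real^'d \<in> space borel. \<lfloor>x $ j / h\<rfloor> = k j} \<in> sets borel" by measurable
    then show "{x :: real^'d. \<lfloor>x $ j / h\<rfloor> = k j} \<in> sets borel" by simp
  qed auto
  finally show ?thesis .
qed

lemma measure_cell_le:
  fixes W :: "(real^'d::finite) set"
  assumes h: "0 < h"
  shows "measure lborel (W \<inter> {x. cell_index h x = k}) \<le> h ^ CARD('d)"
proof -
  define a b :: "real^'d" where "a = (\<chi> j. h * k j)" "b = (\<chi> j. h * (k j + 1))"
  have sub: "W \<inter> {x. cell_index h x = k} \<subseteq> cbox a b"
  proof
    fix x assume "x \<in> W \<inter> {x. cell_index h x = k}"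
    then have "\<lfloor>x $ j / h\<rfloor> = k j" for j by (auto simp: cell_index_def)
    then have "real_of_int (k j) \<le> x $ j / h \<and> x $ j / h \<le> real_of_int (k j) + 1" for j
      by (metis of_int_floor_le floor_correct less_eq_real_def of_int_add of_int_1)
    then have "h * k j \<le> x $ j \<and> x $ j \<le> h * (k j + 1)" for j
      using h by (simp add: field_simps)
    then show "x \<in> cbox a b" by (simp add: mem_box_cart a_b_def)
  qed
  have c: "measure lborel (cbox a b) = h ^ CARD('d)"
  proof -
    have "cbox a b \<noteq> {}" using h by (auto simp: interval_ne_empty_cart a_b_def)
    then have "measure lborel (cbox a b) = (\<Prod>j\<in>UNIV. b $ j - a $ j)"
      by (rule content_cbox_cart)
    also have "\<dots> = h ^ CARD('d)" by (simp add: a_b_def algebra_simps)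
    finally show ?thesis .
  qed
  show ?thesis
  proof (cases "W \<inter> {x. cell_index h x = k} \<in> sets lborel")
    case True
    have "measure lborel (W \<inter> {x. cell_index h x = k}) \<le> measure lborel (cbox a b)"
      by (rule measure_mono_fmeasurable[OF sub True]) (simp add: fmeasurable_cbox)
    then show ?thesis using c by simp
  next
    case False
    then show ?thesis using h by (simp add: measure_notin_sets)
  qed
qed

section \<open>The Poisson process on disjoint cells\<close>

lemma space_config_space: "space (config_space W) = {\<eta>. finite \<eta> \<and> \<eta> \<subseteq> W}"
  unfolding config_space_def by (rule space_measure_of) auto

lemma sets_config_count:
  assumes "A \<in> sets borel"
  shows "{\<eta> \<in> space (config_space W). card (\<eta> \<inter> A) = k} \<in> sets (config_space W)"
proof -
  have "{\<eta>. finite \<eta> \<and> \<eta> \<subseteq> W \<and> card (\<eta> \<inter> A) = k} \<in> sets (config_space W)"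
    unfolding config_space_def by (subst sets_measure_of) (use assms in auto)
  then show ?thesis by (simp add: space_config_space conj_assoc)
qed

lemma measurable_config_count:
  assumes "A \<in> sets borel"
  shows "(\<lambda>\<eta>. card (\<eta> \<inter> A)) \<in> measurable (config_space W) (count_space UNIV)"
  unfolding measurable_count_space_eq2_countable
proof (intro conjI ballI)
  fix k
  have "(\<lambda>\<eta>. card (\<eta> \<inter> A)) -` {k} \<inter> space (config_space W) = {\<eta> \<in> space (config_space W). card (\<eta> \<inter> A) = k}"
    by auto
  then show "(\<lambda>\<eta>. card (\<eta> \<inter> A)) -` {k} \<inter> space (config_space W) \<in> sets (config_space W)"
    using sets_config_count[OF assms] by simp
qed auto

context
  fixes t :: real and W :: "'a::euclidean_space set" and P
  assumes PP: "poisson_process t W P"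
begin

lemma poisson_prob_space: "prob_space P"
  and poisson_space: "space P = {\<eta>. finite \<eta> \<and> \<eta> \<subseteq> W}"
  and poisson_sets: "sets P = sets (config_space W)"
  using PP by (auto simp: poisson_process_def space_config_space)

lemma poisson_count_measurable:
  assumes "A \<in> sets borel"
  shows "(\<lambda>\<eta>. card (\<eta> \<inter> A)) \<in> measurable P (count_space UNIV)"
  using measurable_config_count[OF assms, of W] by (simp add: measurable_cong_sets[OF poisson_sets refl])

lemma poisson_count_eq:
  assumes "A \<in> sets borel"
  shows "measure P {\<eta>\<in>space P. card (\<eta> \<inter> A) = k} =
    (t * measure lborel (W \<inter> A)) ^ k / fact k * exp (- (t * measure lborel (W \<inter> A)))"
  using PP assms unfolding poisson_process_def by blast

lemma poisson_hit_eq: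
  fixes I :: "'i set" and A :: "'i \<Rightarrow> 'a set"
  assumes I: "finite I" and A: "\<And>i. i \<in> I \<Longrightarrow> A i \<in> sets borel" "disjoint_family_on A I"
    and H: "H \<subseteq> I"
  shows "measure P {\<eta>\<in>space P. {i\<in>I. \<eta> \<inter> A i \<noteq> {}} = H} =
    (\<Prod>i\<in>I. if i \<in> H then 1 - exp (- (t * measure lborel (W \<inter> A i))) else 1 - (1 - exp (- (t * measure lborel (W \<inter> A i)))))"
proof (cases "I = {}")
  case True
  then show ?thesis using H prob_space.prob_space[OF poisson_prob_space] by simp
next
  case False
  interpret prob_space P by (rule poisson_prob_space)
  obtain f where f: "bij_betw f {..<card I} I"
    using ex_bij_betw_nat_finite[OF I] by (auto simp: atLeast0LessThan)
  let ?J = "{..<card I}"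
  let ?X = "\<lambda>i \<eta>. card (\<eta> \<inter> A (f i))"
  let ?Y = "\<lambda>i. if f i \<in> H then - {0::nat} else {0}"
  let ?m = "\<lambda>i. t * measure lborel (W \<inter> A i)"
  have fI: "f i \<in> I" if "i \<in> ?J" for i using f that by (auto simp: bij_betw_def)
  have J: "?J \<noteq> {}" "finite ?J" using False I by (auto simp: lessThan_empty_iff)
  have "disjoint_family_on (\<lambda>i. A (f i)) ?J"
    unfolding disjoint_family_on_def
  proof (intro ballI impI)
    fix m n assume mn: "m \<in> ?J" "n \<in> ?J" "m \<noteq> n"
    then have "f m \<noteq> f n" using f by (auto simp: bij_betw_def inj_on_def)
    then show "A (f m) \<inter> A (f n) = {}"
      using A(2) fI[OF mn(1)] fI[OF mn(2)] by (auto simp: disjoint_family_on_def)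
  qed
  then have indep: "indep_vars (\<lambda>_. count_space UNIV) ?X ?J"
    using PP A(1) fI unfolding poisson_process_def by auto
  have "{\<eta>\<in>space P. {i\<in>I. \<eta> \<inter> A i \<noteq> {}} = H} = (\<Inter>i\<in>?J. ?X i -` ?Y i \<inter> space P)"
  proof (intro set_eqI iffI)
    fix \<eta> assume a: "\<eta> \<in> {\<eta>\<in>space P. {i\<in>I. \<eta> \<inter> A i \<noteq> {}} = H}"
    have fin: "finite \<eta>" using a poisson_space by auto
    show "\<eta> \<in> (\<Inter>i\<in>?J. ?X i -` ?Y i \<inter> space P)"
      using a fin fI by auto
  next
    fix \<eta> assume a: "\<eta> \<in> (\<Inter>i\<in>?J. ?X i -` ?Y i \<inter> space P)"
    then have sp: "\<eta> \<in> space P" using J by auto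
    then have fin: "finite \<eta>" using poisson_space by auto
    have "\<eta> \<inter> A i \<noteq> {} \<longleftrightarrow> i \<in> H" if i: "i \<in> I" for i
    proof -
      obtain j where j: "j \<in> ?J" "i = f j" using f i by (auto simp: bij_betw_def)
      have "\<eta> \<in> ?X j -` ?Y j \<inter> space P" using a j(1) by (rule INT_D)
      then have "?X j \<eta> \<in> ?Y j" by simp
      moreover have "?X j \<eta> = 0 \<longleftrightarrow> \<eta> \<inter> A i = {}" using fin j by simp
      ultimately show ?thesis using j(2) by (auto split: if_splits)
    qed
    then show "\<eta> \<in> {\<eta>\<in>space P. {i\<in>I. \<eta> \<inter> A i \<noteq> {}} = H}" using sp H by auto
  qed
  then have "prob {\<eta>\<in>space P. {i\<in>I. \<eta> \<inter> A i \<noteq> {}} = H} = (\<Prod>i\<in>?J. prob (?X i -` ?Y i \<inter> space P))"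
    using indep_varsD_finite[OF indep J] by simp
  also have "\<dots> = (\<Prod>i\<in>?J. if f i \<in> H then 1 - exp (- ?m (f i)) else 1 - (1 - exp (- ?m (f i))))"
  proof (intro prod.cong refl)
    fix i assume i: "i \<in> ?J"
    have meas: "?X i -` {0} \<inter> space P \<in> events"
      using measurable_sets[OF poisson_count_measurable[OF A(1)[OF fI[OF i]]]] by simp
    have "?X i -` {0} \<inter> space P = {\<eta>\<in>space P. ?X i \<eta> = 0}" by auto
    then have p0: "prob (?X i -` {0} \<inter> space P) = exp (- ?m (f i))"
      using poisson_count_eq[OF A(1)[OF fI[OF i]], of 0] by simp
    have "?X i -` (- {0}) \<inter> space P = space P - (?X i -` {0} \<inter> space P)" by auto
    then have "prob (?X i -` (- {0}) \<inter> space P) = 1 - exp (- ?m (f i))"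
      using prob_compl[OF meas] p0 by simp
    with p0 show "prob (?X i -` ?Y i \<inter> space P) =
       (if f i \<in> H then 1 - exp (- ?m (f i)) else 1 - (1 - exp (- ?m (f i))))" by simp
  qed
  also have "\<dots> = (\<Prod>i\<in>I. if i \<in> H then 1 - exp (- ?m i) else 1 - (1 - exp (- ?m i)))"
    by (rule prod.reindex_bij_betw[OF f])
  finally show ?thesis .
qed

text \<open>By independence of the counts, the set of occupied cells is a random subset with independent elements.\<close>

lemma poisson_hit_law:
  fixes I :: "'i set" and A :: "'i \<Rightarrow> 'a set"
  assumes I: "finite I" and A: "\<And>i. i \<in> I \<Longrightarrow> A i \<in> sets borel" "disjoint_family_on A I"
  shows "measure P {\<eta>\<in>space P. Q {i\<in>I. \<eta> \<inter> A i \<noteq> {}}} =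
      subset_prob I (\<lambda>i. 1 - exp (- (t * measure lborel (W \<inter> A i)))) Q"
proof -
  interpret prob_space P by (rule poisson_prob_space)
  let ?E = "\<lambda>H. {\<eta>\<in>space P. {i\<in>I. \<eta> \<inter> A i \<noteq> {}} = H}"
  have E: "?E H \<in> events" for H
  proof (cases "H \<subseteq> I")
    case True
    have "{\<eta>\<in>space P. \<eta> \<inter> A i \<noteq> {} \<longleftrightarrow> i \<in> H} \<in> events" if "i \<in> I" for i
    proof -
      have "{\<eta>\<in>space P. \<eta> \<inter> A i \<noteq> {} \<longleftrightarrow> i \<in> H} = (\<lambda>\<eta>. card (\<eta> \<inter> A i)) -` (if i \<in> H then -{0} else {0}) \<inter> space P"
        using poisson_space by auto
      then show ?thesis
        using measurable_sets[OF poisson_count_measurable[OF A(1)[OF that]]] by simp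
    qed
    then have "{\<eta>\<in>space P. \<forall>i\<in>I. \<eta> \<inter> A i \<noteq> {} \<longleftrightarrow> i \<in> H} \<in> events"
      by (intro sets.sets_Collect_finite_All' sets.sets_Collect_finite_All I) auto
    also have "{\<eta>\<in>space P. \<forall>i\<in>I. \<eta> \<inter> A i \<noteq> {} \<longleftrightarrow> i \<in> H} = ?E H" using True by auto
    finally show ?thesis .
  next
    case False
    then have e: "?E H = {}" by auto
    show ?thesis unfolding e by simp
  qed
  have eq: "{\<eta>\<in>space P. Q {i\<in>I. \<eta> \<inter> A i \<noteq> {}}} = (\<Union>H\<in>{H\<in>Pow I. Q H}. ?E H)" by auto
  have "prob (\<Union>H\<in>{H\<in>Pow I. Q H}. ?E H) = (\<Sum>H\<in>{H\<in>Pow I. Q H}. prob (?E H))"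
    using I E by (intro finite_measure_finite_Union) (auto simp: disjoint_family_on_def)
  also have "\<dots> = (\<Sum>H\<in>Pow I. if Q H then prob (?E H) else 0)"
    using I by (subst sum.inter_filter) auto
  also have "\<dots> = subset_prob I (\<lambda>i. 1 - exp (- (t * measure lborel (W \<inter> A i)))) Q"
    unfolding subset_prob_def using poisson_hit_eq[OF I A] by (intro sum.cong) auto
  finally show "prob {\<eta>\<in>space P. Q {i\<in>I. \<eta> \<inter> A i \<noteq> {}}} =
      subset_prob I (\<lambda>i. 1 - exp (- (t * measure lborel (W \<inter> A i)))) Q" unfolding eq .
qed

lemma poisson_two_points:
  assumes t0: "0 \<le> t" and A: "A \<in> sets borel"
  shows "{\<eta>\<in>space P. 2 \<le> card (\<eta> \<inter> A)} \<in> sets P"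
    and "measure P {\<eta>\<in>space P. 2 \<le> card (\<eta> \<inter> A)} \<le> (t * measure lborel (W \<inter> A))\<^sup>2"
proof -
  interpret prob_space P by (rule poisson_prob_space)
  let ?x = "t * measure lborel (W \<inter> A)"
  have x: "0 \<le> ?x" using t0 by simp
  have meas: "(\<lambda>\<eta>. card (\<eta> \<inter> A)) -` Y \<inter> space P \<in> events" for Y
    using measurable_sets[OF poisson_count_measurable[OF A]] by simp
  have e: "{\<eta>\<in>space P. 2 \<le> card (\<eta> \<inter> A)} = (\<lambda>\<eta>. card (\<eta> \<inter> A)) -` {2..} \<inter> space P" by auto
  show "{\<eta>\<in>space P. 2 \<le> card (\<eta> \<inter> A)} \<in> sets P" unfolding e by (rule meas)
  have e01: "(\<lambda>\<eta>. card (\<eta> \<inter> A)) -` {k} \<inter> space P = {\<eta>\<in>space P. card (\<eta> \<inter> A) = k}" for k by auto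
  let ?E = "\<lambda>k. {\<eta>\<in>space P. card (\<eta> \<inter> A) = k}"
  have E: "?E k \<in> events" for k using meas[of "{k}"] unfolding e01 .
  have "{\<eta>\<in>space P. 2 \<le> card (\<eta> \<inter> A)} = space P - (?E 0 \<union> ?E 1)" by auto
  then have "prob {\<eta>\<in>space P. 2 \<le> card (\<eta> \<inter> A)} = 1 - prob (?E 0 \<union> ?E 1)"
    using prob_compl[of "?E 0 \<union> ?E 1"] E by simp
  also have "prob (?E 0 \<union> ?E 1) = prob (?E 0) + prob (?E 1)"
    by (intro finite_measure_Union E) auto
  also have "prob (?E 0) + prob (?E 1) = (1 + ?x) * exp (- ?x)"
    using poisson_count_eq[OF A, of 0] poisson_count_eq[OF A, of 1] by (simp add: algebra_simps)
  also have "1 - (1 + ?x) * exp (- ?x) \<le> 1 - (1 + ?x) * (1 - ?x)"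
  proof -
    have "1 - ?x \<le> exp (- ?x)" using exp_ge_add_one_self[of "- ?x"] by simp
    then have "(1 + ?x) * (1 - ?x) \<le> (1 + ?x) * exp (- ?x)" using x by (intro mult_left_mono) auto
    then show ?thesis by simp
  qed
  also have "\<dots> = ?x\<^sup>2" by (simp add: power2_eq_square algebra_simps)
  finally show "prob {\<eta>\<in>space P. 2 \<le> card (\<eta> \<inter> A)} \<le> ?x\<^sup>2" .
qed

text \<open>Events that are determined by the occupied cells whenever no cell contains two points can be
estimated in the discrete model. The error is the probability of a doubly occupied cell, which is quadratic
in the mass of the cell.\<close>

lemma poisson_cells_bound:
  fixes I :: "'i set" and A :: "'i \<Rightarrow> 'a set"
  assumes t0: "0 \<le> t" and I: "finite I"
    and A: "\<And>i. i \<in> I \<Longrightarrow> A i \<in> sets borel" "disjoint_family_on A I"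
    and U: "U \<in> sets P"
    and sub: "\<And>\<eta>. \<eta> \<in> space P \<Longrightarrow> (\<And>i. i \<in> I \<Longrightarrow> card (\<eta> \<inter> A i) \<le> 1) \<Longrightarrow>
       Q {i\<in>I. \<eta> \<inter> A i \<noteq> {}} \<Longrightarrow> \<eta> \<in> U"
  shows "subset_prob I (\<lambda>i. 1 - exp (- (t * measure lborel (W \<inter> A i)))) Q
     \<le> measure P U + (\<Sum>i\<in>I. (t * measure lborel (W \<inter> A i))\<^sup>2)"
proof -
  interpret prob_space P by (rule poisson_prob_space)
  let ?D = "\<lambda>i. {\<eta>\<in>space P. 2 \<le> card (\<eta> \<inter> A i)}"
  have D: "?D i \<in> events" if "i \<in> I" for i using poisson_two_points(1)[OF t0 A(1)[OF that]] .
  have UD: "(\<Union>i\<in>I. ?D i) \<in> events" using D I by blast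
  have "subset_prob I (\<lambda>i. 1 - exp (- (t * measure lborel (W \<inter> A i)))) Q = prob {\<eta>\<in>space P. Q {i\<in>I. \<eta> \<inter> A i \<noteq> {}}}"
    using poisson_hit_law[OF I A] by simp
  also have "\<dots> \<le> prob (U \<union> (\<Union>i\<in>I. ?D i))"
  proof (rule finite_measure_mono)
    show "{\<eta>\<in>space P. Q {i\<in>I. \<eta> \<inter> A i \<noteq> {}}} \<subseteq> U \<union> (\<Union>i\<in>I. ?D i)"
    proof
      fix \<eta> assume a: "\<eta> \<in> {\<eta>\<in>space P. Q {i\<in>I. \<eta> \<inter> A i \<noteq> {}}}"
      show "\<eta> \<in> U \<union> (\<Union>i\<in>I. ?D i)"
      proof (cases "\<forall>i\<in>I. card (\<eta> \<inter> A i) \<le> 1")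
        case True
        then show ?thesis using a sub by blast
      next
        case False
        then obtain i where "i \<in> I" "2 \<le> card (\<eta> \<inter> A i)" by force
        then show ?thesis using a by blast
      qed
    qed
  qed (use U UD in auto)
  also have "\<dots> \<le> prob U + prob (\<Union>i\<in>I. ?D i)" by (intro measure_Un_le U UD)
  also have "prob (\<Union>i\<in>I. ?D i) \<le> (\<Sum>i\<in>I. prob (?D i))"
    using D by (intro finite_measure_subadditive_finite I) auto
  also have "\<dots> \<le> (\<Sum>i\<in>I. (t * measure lborel (W \<inter> A i))\<^sup>2)"
    using poisson_two_points(2)[OF t0 A(1)] by (intro sum_mono) auto
  finally show ?thesis by simp
qed

end

section \<open>Planes, crossings and the uniform measure\<close>

lemma crossing_number_eq_0_iff:
  assumes "finite \<eta>"
  shows "crossing_number \<rho> \<eta> L = 0 \<longleftrightarrow>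
    (\<forall>a\<in>\<eta>. \<forall>b\<in>\<eta>. \<forall>c\<in>\<eta>. \<forall>d\<in>\<eta>. distinct [a, b, c, d] \<longrightarrow> \<not> edges_cross \<rho> L a b c d)"
proof -
  let ?X = "{(a, b, c, d). {a, b, c, d} \<subseteq> \<eta> \<and> distinct [a, b, c, d]}"
  have fX: "finite ?X"
  proof (rule finite_subset)
    show "?X \<subseteq> \<eta> \<times> \<eta> \<times> \<eta> \<times> \<eta>" by auto
  qed (use assms in auto)
  have nn: "0 \<le> crossing_kernel \<rho> L a b c d" for a b c d
    by (simp add: crossing_kernel_def)
  have "crossing_number \<rho> \<eta> L = 0 \<longleftrightarrow> (\<forall>(a, b, c, d)\<in>?X. crossing_kernel \<rho> L a b c d = 0)"
  proof -
    have "(\<Sum>(a, b, c, d)\<in>?X. crossing_kernel \<rho> L a b c d) = 0 \<longleftrightarrow>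
       (\<forall>x\<in>?X. (case x of (a, b, c, d) \<Rightarrow> crossing_kernel \<rho> L a b c d) = 0)"
      by (rule sum_nonneg_eq_0_iff[OF fX]) (auto simp: nn split: prod.split)
    then show ?thesis unfolding crossing_number_def by (simp add: case_prod_unfold)
  qed
  also have "\<dots> \<longleftrightarrow> (\<forall>(a, b, c, d)\<in>?X. \<not> edges_cross \<rho> L a b c d \<and> \<not> edges_cross \<rho> L a c b d \<and> \<not> edges_cross \<rho> L a d b c)"
    unfolding crossing_kernel_def by (intro ball_cong refl) (auto simp: of_bool_def)
  also have "\<dots> \<longleftrightarrow> (\<forall>a\<in>\<eta>. \<forall>b\<in>\<eta>. \<forall>c\<in>\<eta>. \<forall>d\<in>\<eta>. distinct [a, b, c, d] \<longrightarrow> \<not> edges_cross \<rho> L a b c d)"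
    (is "?l \<longleftrightarrow> ?r")
  proof
    assume l: ?l
    show ?r
    proof (intro ballI impI)
      fix a b c d assume "a \<in> \<eta>" "b \<in> \<eta>" "c \<in> \<eta>" "d \<in> \<eta>" "distinct [a, b, c, d]"
      then have "(a, b, c, d) \<in> ?X" by auto
      with l show "\<not> edges_cross \<rho> L a b c d" by auto
    qed
  next
    assume r: ?r
    show ?l
    proof (clarify, intro conjI)
      fix a b c d assume X: "{a, b, c, d} \<subseteq> \<eta>" "distinct [a, b, c, d]"
      then show "\<not> edges_cross \<rho> L a b c d" "\<not> edges_cross \<rho> L a c b d" "\<not> edges_cross \<rho> L a d b c"
        using r[rule_format, of a b c d] r[rule_format, of a c b d] r[rule_format, of a d b c] by auto
    qed
  qed
  finally show ?thesis .
qed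

lemma inner_eq_of_orth_proj_eq:
  assumes L: "subspace L" and e: "orth_proj L y = orth_proj L z" and w: "w \<in> L"
  shows "w \<bullet> y = w \<bullet> z"
proof -
  have "w \<bullet> (y - orth_proj L y) = 0" "w \<bullet> (z - orth_proj L z) = 0"
    using orth_proj(2)[OF L] w by (auto simp: orthogonal_comp_def orthogonal_def)
  then show ?thesis using e by (simp add: inner_diff_right)
qed

text \<open>The only geometric consequence of a crossing that is needed for the upper bounds: along every direction of the
plane, the end points of the two edges differ by at most twice the edge length.\<close>

lemma edges_cross_inner_le:
  assumes L: "subspace L" and ec: "edges_cross \<rho> L a b c d" and w: "w \<in> L"
    and u: "u \<in> {a, b}" and v: "v \<in> {c, d}"
  shows "\<bar>w \<bullet> (u - v)\<bar> \<le> norm w * (2 * \<rho>)"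
proof -
  obtain y z where yz: "y \<in> closed_segment a b" "z \<in> closed_segment c d" "orth_proj L y = orth_proj L z"
    using ec unfolding edges_cross_def by auto
  have ab: "norm (a - b) \<le> \<rho>" "norm (c - d) \<le> \<rho>" using ec unfolding edges_cross_def by auto
  have uy: "norm (u - y) \<le> \<rho>"
    using segment_bound[OF yz(1)] u ab by (auto simp: norm_minus_commute intro: order_trans)
  have zv: "norm (z - v) \<le> \<rho>"
    using segment_bound[OF yz(2)] v ab by (auto simp: norm_minus_commute intro: order_trans)
  have "w \<bullet> (u - v) = w \<bullet> ((u - y) + (z - v))"
    using inner_eq_of_orth_proj_eq[OF L yz(3) w] by (simp add: inner_diff_right inner_add_right)
  then have "\<bar>w \<bullet> (u - v)\<bar> \<le> norm w * norm ((u - y) + (z - v))"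
    using Cauchy_Schwarz_ineq2 by metis
  also have "\<dots> \<le> norm w * (2 * \<rho>)"
    using norm_triangle_ineq[of "u - y" "z - v"] uy zv by (intro mult_left_mono) auto
  finally show ?thesis .
qed

lemma linear_orth_proj:
  assumes L: "subspace L"
  shows "linear (orth_proj L)"
proof (rule linearI)
  have unique: "orth_proj L x = y" if "y \<in> L" "x - y \<in> L\<^sup>\<bottom>" for x y
    using orth_proj_unique[OF L, of x] orth_proj[OF L, of x] that by blast
  note S = subspace_orthogonal_comp[of L]
  fix x y :: 'a and c :: real
  have "x + y - (orth_proj L x + orth_proj L y) = (x - orth_proj L x) + (y - orth_proj L y)" by simp
  also have "\<dots> \<in> L\<^sup>\<bottom>" by (intro subspace_add S orth_proj L)
  finally show "orth_proj L (x + y) = orth_proj L x + orth_proj L y"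
    by (intro unique subspace_add L orth_proj)
  have "c *\<^sub>R x - c *\<^sub>R orth_proj L x = c *\<^sub>R (x - orth_proj L x)" by (simp add: scaleR_diff_right)
  also have "\<dots> \<in> L\<^sup>\<bottom>" by (intro subspace_scale S orth_proj L)
  finally show "orth_proj L (c *\<^sub>R x) = c *\<^sub>R orth_proj L x"
    by (intro unique subspace_scale L orth_proj)
qed

lemma orth_proj_matrix:
  fixes L :: "(real^'d::finite) set"
  assumes L: "subspace L"
  shows "matrix (orth_proj L) *v x = orth_proj L x"
  using fun_cong[OF matrix_vector_mul(2)[OF linear_orth_proj[OF L]], of x] by simp

lemma orth_proj_rotate:
  fixes L :: "(real^'d::finite) set" and Q :: "real^'d^'d"
  assumes L: "subspace L" and Q: "orthogonal_matrix Q"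
  shows "transpose Q ** matrix (orth_proj ((*v) Q ` L)) ** Q = matrix (orth_proj L)"
proof -
  have QL: "subspace ((*v) Q ` L)"
    using L by (intro linear_subspace_image) auto
  have QQ: "transpose Q ** Q = mat 1" using Q by (simp add: orthogonal_matrix_def)
  have inner: "(Q *v x) \<bullet> (Q *v y) = x \<bullet> y" for x y
    by (metis QQ dot_lmul_matrix matrix_vector_mul_assoc matrix_vector_mul_lid vector_transpose_matrix inner_commute transpose_transpose)
  have proj: "orth_proj ((*v) Q ` L) (Q *v x) = Q *v orth_proj L x" for x
  proof -
    have "Q *v orth_proj L x \<in> (*v) Q ` L" using orth_proj(1)[OF L] by auto
    moreover have "Q *v x - Q *v orth_proj L x \<in> ((*v) Q ` L)\<^sup>\<bottom>"
      unfolding matrix_vector_mult_diff_distrib[symmetric]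
      using orth_proj(2)[OF L, of x] by (auto simp: orthogonal_comp_def orthogonal_def inner)
    ultimately show ?thesis
      using orth_proj_unique[OF QL, of "Q *v x"] orth_proj[OF QL, of "Q *v x"] by blast
  qed
  show ?thesis
    unfolding matrix_eq
  proof
    fix x
    have "(transpose Q ** matrix (orth_proj ((*v) Q ` L)) ** Q) *v x
      = transpose Q *v (matrix (orth_proj ((*v) Q ` L)) *v (Q *v x))"
      by (simp only: matrix_vector_mul_assoc matrix_mul_assoc)
    also have "\<dots> = (transpose Q ** Q) *v orth_proj L x"
      by (simp only: orth_proj_matrix[OF QL] proj) (simp only: matrix_vector_mul_assoc)
    finally show "(transpose Q ** matrix (orth_proj ((*v) Q ` L)) ** Q) *v x = matrix (orth_proj L) *v x"
      by (simp add: QQ orth_proj_matrix[OF L])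
  qed
qed

text \<open>Extend an orthonormal basis of \<open>L\<close> to one of the whole space and take it as the columns of \<open>Q\<close>.
Changing the sign of the first vector changes the determinant but not the plane.\<close>

lemma rotation_onto_plane:
  fixes L :: "(real^'d::finite) set"
  assumes L: "L \<in> planes" and i: "i1 \<noteq> (i2 :: 'd)"
  obtains Q :: "real^'d^'d" where "rotation_matrix Q" "(*v) Q ` span {axis i1 1, axis i2 1} = L"
proof -
  have sL: "subspace L" and dL: "dim L = 2" using L by (auto simp: planes_def)
  obtain B where B: "B \<subseteq> L" "pairwise orthogonal B" "\<And>x. x \<in> B \<Longrightarrow> norm x = 1" "card B = 2" "span B = L"
    using orthonormal_basis_subspace[OF sL] dL by metis
  obtain C where C: "C \<subseteq> L\<^sup>\<bottom>" "pairwise orthogonal C" "\<And>x. x \<in> C \<Longrightarrow> norm x = 1" "card C = dim (L\<^sup>\<bottom>)"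
      "independent C"
    using orthonormal_basis_subspace[OF subspace_orthogonal_comp[of L]] by metis
  have "dim {y \<in> UNIV. \<forall>x\<in>L. orthogonal x y} + dim L = dim (UNIV :: (real^'d) set)"
    by (rule dim_subspace_orthogonal_to_vectors[OF sL subspace_UNIV]) auto
  moreover have "{y \<in> UNIV. \<forall>x\<in>L. orthogonal x y} = L\<^sup>\<bottom>"
    by (auto simp: orthogonal_comp_def)
  ultimately have cC: "card C = CARD('d) - 2" using dL C(4) by (simp add: dim_UNIV)
  have fC: "finite C" using C(5) by (rule independent_imp_finite)
  obtain u v where uv: "B = {u, v}" "u \<noteq> v" using B(4) by (auto simp: card_2_iff)
  have "card (UNIV - {i1, i2}) = card C" using i cC by (subst card_Diff_subset) auto
  then obtain f where f: "bij_betw f (UNIV - {i1, i2}) C"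
    using fC finite_same_card_bij[of "UNIV - {i1, i2}" C] by auto
  \<comment> \<open>the sign of the first column decides the determinant\<close>
  define q where "q \<epsilon> j = (if j = i1 then \<epsilon> *\<^sub>R u else if j = i2 then v else f j)" for \<epsilon> :: real and j
  define Q where "Q \<epsilon> = transpose (\<chi> j. q \<epsilon> j)" for \<epsilon> :: real
  have fjC: "f j \<in> C" if "j \<noteq> i1" "j \<noteq> i2" for j using f that by (auto simp: bij_betw_def)
  have ort: "orthogonal x y" if "x \<in> C" "y \<in> B" for x y
    using that B(1) C(1) by (auto simp: orthogonal_comp_def orthogonal_commute)
  have uv0: "orthogonal u v" using B(2) uv by (auto simp: pairwise_def)
  have on: "orthogonal_matrix (Q \<epsilon>)" if \<epsilon>: "\<bar>\<epsilon>\<bar> = 1" for \<epsilon>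
    unfolding orthogonal_matrix_orthonormal_columns
  proof (intro conjI allI impI)
    have col: "column j (Q \<epsilon>) = q \<epsilon> j" for j
      by (simp add: column_def Q_def transpose_def vec_eq_iff)
    show "norm (column j (Q \<epsilon>)) = 1" for j
      unfolding col q_def using B(3) C(3) fjC[of j] uv \<epsilon> by auto
    fix j k :: 'd assume jk: "j \<noteq> k"
    have "orthogonal (f j) (f k)" if "j \<noteq> i1" "j \<noteq> i2" "k \<noteq> i1" "k \<noteq> i2"
    proof -
      have "f j \<noteq> f k" using f that jk by (auto simp: bij_betw_def inj_on_def)
      then show ?thesis using C(2) fjC that by (auto simp: pairwise_def)
    qed
    then show "orthogonal (column j (Q \<epsilon>)) (column k (Q \<epsilon>))"
      unfolding col q_def using jk uv0 ort[OF fjC[of j]] ort[OF fjC[of k]] uv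
      by (auto simp: orthogonal_clauses orthogonal_commute)
  qed
  have det: "det (Q \<epsilon>) = \<epsilon> * det (Q 1)" for \<epsilon>
    using det_row_mul[of i1 \<epsilon> "\<lambda>j. q 1 j" "\<lambda>j. q 1 j"]
    by (simp add: Q_def q_def scalar_mult_eq_scaleR if_distrib cong: if_cong)
  have "det (Q 1) = 1 \<or> det (Q 1) = -1"
    using det_orthogonal_matrix[OF on[of 1]] by auto
  then obtain \<epsilon> where \<epsilon>: "\<bar>\<epsilon>\<bar> = 1" "det (Q \<epsilon>) = 1"
    using det[of "-1"] by (metis abs_minus abs_one mult_minus1 minus_minus)
  have rot: "rotation_matrix (Q \<epsilon>)" using on \<epsilon> by (simp add: rotation_matrix_def)
  have ax: "Q \<epsilon> *v axis j 1 = q \<epsilon> j" for j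
    by (simp add: matrix_vector_mult_basis column_def Q_def transpose_def vec_eq_iff)
  have "(*v) (Q \<epsilon>) ` span {axis i1 1, axis i2 1} = span ((*v) (Q \<epsilon>) ` {axis i1 1, axis i2 1})"
    by (rule linear_span_image[symmetric]) simp
  also have "(*v) (Q \<epsilon>) ` {axis i1 1, axis i2 1} = {\<epsilon> *\<^sub>R u, v}"
    using i by (simp add: ax q_def)
  also have "span {\<epsilon> *\<^sub>R u, v} = span {u, v}"
  proof (rule span_eq[THEN iffD2], intro conjI)
    show "{\<epsilon> *\<^sub>R u, v} \<subseteq> span {u, v}" by (auto intro: span_base span_scale)
    have "u = \<epsilon> *\<^sub>R (\<epsilon> *\<^sub>R u)" using \<epsilon>(1) by (auto simp: abs_if split: if_splits)
    then have "u \<in> span {\<epsilon> *\<^sub>R u, v}" by (metis span_base span_scale insertI1)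
    then show "{u, v} \<subseteq> span {\<epsilon> *\<^sub>R u, v}" by (auto intro: span_base)
  qed
  finally have "(*v) (Q \<epsilon>) ` span {axis i1 1, axis i2 1} = L" using uv B(5) by simp
  with rot show ?thesis by (rule that)
qed

lemma rotation_between_planes:
  fixes L L' :: "(real^'d::finite) set"
  assumes "L \<in> planes" "L' \<in> planes"
  obtains Q :: "real^'d^'d" where "rotation_matrix Q" "(*v) Q ` L = L'"
proof -
  have "2 \<le> CARD('d)" using assms(1) dim_subset_UNIV[of L] by (simp add: planes_def)
  then obtain i1 i2 :: 'd where i: "i1 \<noteq> i2"
    by (metis card_2_iff' ex_card subset_UNIV)
  obtain Q Q' :: "real^'d^'d" where Q: "rotation_matrix Q" "(*v) Q ` span {axis i1 1, axis i2 1} = L"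
    and Q': "rotation_matrix Q'" "(*v) Q' ` span {axis i1 1, axis i2 1} = L'"
    using rotation_onto_plane[OF assms(1) i] rotation_onto_plane[OF assms(2) i] by metis
  have oQ: "orthogonal_matrix Q" "orthogonal_matrix Q'" and dQ: "det Q = 1" "det Q' = 1"
    using Q Q' by (auto simp: rotation_matrix_def)
  have "rotation_matrix (Q' ** transpose Q)"
    using oQ dQ by (simp add: rotation_matrix_def orthogonal_matrix_mul det_mul det_transpose)
  moreover have "(*v) (Q' ** transpose Q) ` L = L'"
  proof -
    have "(Q' ** transpose Q) *v (Q *v x) = Q' *v x" for x
      using oQ(1) by (simp add: orthogonal_matrix_def matrix_vector_mul_assoc flip: matrix_mul_assoc)
    then show ?thesis using Q(2) Q'(2) by (metis (no_types, lifting) image_cong image_image)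
  qed
  ultimately show ?thesis by (rule that)
qed

lemma grassmann_vimage:
  assumes "B \<in> sets borel"
  shows "{L \<in> planes. matrix (orth_proj L) \<in> B} \<in> sets (grassmann_borel :: (real^'d::finite) set measure)"
proof -
  have "(\<lambda>L. matrix (orth_proj L)) -` B \<inter> planes \<in> sets (grassmann_borel :: (real^'d) set measure)"
    unfolding grassmann_borel_def using assms by (rule in_vimage_algebra)
  also have "(\<lambda>L. matrix (orth_proj L)) -` B \<inter> planes = {L \<in> planes. matrix (orth_proj L) \<in> B}" by auto
  finally show ?thesis .
qed

text \<open>If an open set of planes containing \<open>L\<close> were null, so would be all its rotated copies. These
are open and, by transitivity of the rotations, cover all planes; by Lindeloef's theorem countably many
of them do, so that the whole space would be null.\<close>

lemma uniform_plane_measure_open_pos: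
  fixes \<nu> :: "(real^'d::finite) set measure"
  assumes \<nu>: "uniform_plane_measure \<nu>" and G: "open G" and L: "L \<in> planes" "matrix (orth_proj L) \<in> G"
  shows "0 < measure \<nu> {L \<in> planes. matrix (orth_proj L) \<in> G}"
proof (rule ccontr)
  interpret prob_space \<nu> using \<nu> by (simp add: uniform_plane_measure_def)
  have sp: "space \<nu> = planes" and st: "sets \<nu> = sets grassmann_borel"
    and inv: "\<And>Q A. rotation_matrix Q \<Longrightarrow> A \<in> sets \<nu> \<Longrightarrow> emeasure \<nu> ((\<lambda>L. (*v) Q ` L) ` A) = emeasure \<nu> A"
    using \<nu> by (auto simp: uniform_plane_measure_def)
  let ?U = "\<lambda>G. {L \<in> planes. matrix (orth_proj L) \<in> G}"
  let ?T = "\<lambda>Q. {M :: real^'d^'d. transpose Q ** M ** Q \<in> G}"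
  have U: "?U S \<in> sets \<nu>" if "open S" for S unfolding st using that by (intro grassmann_vimage) auto
  assume "\<not> 0 < measure \<nu> (?U G)"
  then have "emeasure \<nu> (?U G) = 0"
    using measure_nonneg[of \<nu> "?U G"] by (simp add: emeasure_eq_measure)
  have oT: "open (?T Q)" for Q
  proof -
    have "continuous_on UNIV (\<lambda>M :: real^'d^'d. transpose Q ** M ** Q)"
      unfolding matrix_matrix_mult_def by (intro continuous_intros)
    then have "open ((\<lambda>M :: real^'d^'d. transpose Q ** M ** Q) -` G)"
      using G continuous_on_open_vimage[OF open_UNIV] by auto
    then show ?thesis by (simp add: vimage_def)
  qed
  \<comment> \<open>the planes with projection in \<open>?T Q\<close> are the images under \<open>Q\<close> of those with projection in \<open>G\<close>\<close>
  have null: "emeasure \<nu> (?U (?T Q)) = 0" if Q: "rotation_matrix Q" for Q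
  proof -
    have oQ: "orthogonal_matrix Q" and dQ: "det Q = 1" using Q by (auto simp: rotation_matrix_def)
    have Q1: "Q *v (transpose Q *v x) = x" and Q2: "transpose Q *v (Q *v x) = x" for x
      unfolding matrix_vector_mul_assoc using oQ by (simp_all add: orthogonal_matrix_def)
    have "?U (?T Q) = (\<lambda>L. (*v) Q ` L) ` ?U G"
    proof (intro set_eqI iffI)
      fix L assume L: "L \<in> ?U (?T Q)"
      define L0 where "L0 = (*v) (transpose Q) ` L"
      have sL: "subspace L" "dim L = 2" using L by (auto simp: planes_def)
      have "subspace L0" unfolding L0_def using sL by (intro linear_subspace_image) auto
      moreover have "dim L0 = 2"
      proof -
        have "inj ((*v) (transpose Q))"
          by (rule inj_on_inverseI[of _ "(*v) Q"]) (rule Q1)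
        then show ?thesis unfolding L0_def using sL
          by (subst dim_image_eq) (auto intro: inj_on_subset)
      qed
      ultimately have L0: "L0 \<in> planes" by (simp add: planes_def)
      have LL: "L = (*v) Q ` L0"
        by (simp only: L0_def image_image Q1 image_ident)
      have "matrix (orth_proj L0) \<in> G"
        using L orth_proj_rotate[OF _ oQ, of L0] L0 LL by (simp add: planes_def)
      then show "L \<in> (\<lambda>L. (*v) Q ` L) ` ?U G" using L0 LL by auto
    next
      fix L assume "L \<in> (\<lambda>L. (*v) Q ` L) ` ?U G"
      then obtain L0 where L0: "L = (*v) Q ` L0" "L0 \<in> planes" "matrix (orth_proj L0) \<in> G" by auto
      have s0: "subspace L0" "dim L0 = 2" using L0 by (auto simp: planes_def)
      have "subspace L" unfolding L0 using s0 by (intro linear_subspace_image) auto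
      moreover have "dim L = 2"
      proof -
        have "inj ((*v) Q)"
          by (rule inj_on_inverseI[of _ "(*v) (transpose Q)"]) (rule Q2)
        then show ?thesis unfolding L0 using s0
          by (subst dim_image_eq) (auto intro: inj_on_subset)
      qed
      ultimately show "L \<in> ?U (?T Q)"
        using orth_proj_rotate[OF s0(1) oQ] L0 by (simp add: planes_def)
    qed
    then show ?thesis using inv[OF Q U[OF G]] \<open>emeasure \<nu> (?U G) = 0\<close> by simp
  qed
  obtain \<F> where \<F>: "\<F> \<subseteq> ?T ` {Q. rotation_matrix Q}" "countable \<F>" "\<Union>\<F> = \<Union>(?T ` {Q. rotation_matrix Q})"
    using Lindelof[of "?T ` {Q. rotation_matrix Q}"] oT by (metis (no_types, lifting) imageE)
  have "planes \<subseteq> (\<Union>S\<in>\<F>. ?U S)"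
  proof
    fix L' :: "(real^'d) set" assume L': "L' \<in> planes"
    obtain Q :: "real^'d^'d" where Q: "rotation_matrix Q" "(*v) Q ` L = L'"
      using rotation_between_planes[OF L(1) L'] by blast
    have "matrix (orth_proj L') \<in> ?T Q"
      using orth_proj_rotate[of L Q] Q L by (simp add: planes_def rotation_matrix_def)
    then have "matrix (orth_proj L') \<in> \<Union>\<F>" using Q(1) \<F>(3) by blast
    then show "L' \<in> (\<Union>S\<in>\<F>. ?U S)" using L' by auto
  qed
  moreover have "(\<Union>S\<in>\<F>. ?U S) \<in> null_sets \<nu>"
  proof (rule null_sets_UN')
    show "countable \<F>" by fact
    fix S assume "S \<in> \<F>"
    then obtain Q where "rotation_matrix Q" "S = ?T Q" using \<F>(1) by auto
    then show "?U S \<in> null_sets \<nu>" using null U[OF oT[of Q]] by (auto intro!: null_setsI)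
  qed
  ultimately have "space \<nu> \<in> null_sets \<nu>"
    unfolding sp[symmetric] using null_sets_subset[OF _ sets.top] by blast
  then show False using emeasure_space_1 by (simp add: null_setsD1)
qed

lemma open_disjoint_images:
  fixes K K' :: "(real^'d::finite) set"
  assumes "compact K" "compact K'"
  shows "open {M :: real^'d^'d. (*v) M ` K \<inter> (*v) M ` K' = {}}"
proof -
  let ?T = "{((y, z), M :: real^'d^'d). M *v y = M *v z}"
  have "?T = {p. snd p *v fst (fst p) = snd p *v snd (fst p)}" by auto
  moreover have "closed {p :: ((real^'d) \<times> (real^'d)) \<times> (real^'d^'d). snd p *v fst (fst p) = snd p *v snd (fst p)}"
    unfolding matrix_vector_mult_def by (intro closed_Collect_eq continuous_intros)
  ultimately have "closed ?T" by simp
  then have "closed {M. \<exists>x. x \<in> K \<times> K' \<and> (x, M) \<in> ?T}"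
    by (rule closed_compact_projection[OF compact_Times[OF assms]])
  moreover have "{M :: real^'d^'d. (*v) M ` K \<inter> (*v) M ` K' = {}} = - {M. \<exists>x. x \<in> K \<times> K' \<and> (x, M) \<in> ?T}"
    by auto
  ultimately show ?thesis by (simp add: open_Compl)
qed

text \<open>Pairs of compact segments with disjoint projections keep this property for nearby projections, and there are
finitely many pairs of edges. So the crossing-free planes form an open set.\<close>

lemma zero_crossing_measure_pos_iff:
  fixes \<nu> :: "(real^'d::finite) set measure"
  assumes \<nu>: "uniform_plane_measure \<nu>" and \<eta>: "finite \<eta>"
  shows "0 < zero_crossing_measure \<nu> \<rho> \<eta> \<longleftrightarrow> (\<exists>L\<in>planes. crossing_number \<rho> \<eta> L = 0)"
proof -
  let ?I = "{(a, b, c, d). a \<in> \<eta> \<and> b \<in> \<eta> \<and> c \<in> \<eta> \<and> d \<in> \<eta> \<and> distinct [a, b, c, d] \<and>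
     norm (a - b) \<le> \<rho> \<and> norm (c - d) \<le> \<rho>}"
  let ?G = "\<lambda>(a, b, c, d). {M :: real^'d^'d. (*v) M ` closed_segment a b \<inter> (*v) M ` closed_segment c d = {}}"
  have "finite ?I"
  proof (rule finite_subset)
    show "?I \<subseteq> \<eta> \<times> \<eta> \<times> \<eta> \<times> \<eta>" by auto
  qed (use \<eta> in auto)
  then have op: "open (\<Inter>i\<in>?I. ?G i)"
    by (intro open_INT) (auto intro!: open_disjoint_images)
  have iff: "crossing_number \<rho> \<eta> L = 0 \<longleftrightarrow> matrix (orth_proj L) \<in> (\<Inter>i\<in>?I. ?G i)" if "L \<in> planes" for L
  proof -
    have "(*v) (matrix (orth_proj L)) = orth_proj L"
      using that orth_proj_matrix by (auto simp: planes_def fun_eq_iff)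
    then show ?thesis
      unfolding crossing_number_eq_0_iff[OF \<eta>] edges_cross_def by fastforce
  qed
  have eq: "{L \<in> planes. crossing_number \<rho> \<eta> L = 0} = {L \<in> planes. matrix (orth_proj L) \<in> (\<Inter>i\<in>?I. ?G i)}"
    by (rule Collect_cong) (rule conj_cong[OF refl iff])
  have pos: "0 < zero_crossing_measure \<nu> \<rho> \<eta>" if "L \<in> planes" "crossing_number \<rho> \<eta> L = 0" for L
    unfolding zero_crossing_measure_def eq
    by (rule uniform_plane_measure_open_pos[OF \<nu> op that(1)]) (rule iff[OF that(1), THEN iffD1, OF that(2)])
  moreover have "zero_crossing_measure \<nu> \<rho> \<eta> = 0" if "\<not> (\<exists>L\<in>planes. crossing_number \<rho> \<eta> L = 0)"
  proof -
    have e: "{L \<in> planes. crossing_number \<rho> \<eta> L = 0} = {}" using that by auto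
    show ?thesis unfolding zero_crossing_measure_def e by simp
  qed
  ultimately show ?thesis by force
qed

section \<open>Measurability of the existence of a crossing-free plane\<close>

lemma dist_same_cell:
  fixes x y :: "real^'d::finite" and h :: real
  assumes "0 < h" "cell_index h x = cell_index h y"
  shows "dist x y \<le> CARD('d) * h"
proof -
  have "\<bar>(x - y) $ j\<bar> \<le> h" for j
  proof -
    have "\<lfloor>x $ j / h\<rfloor> = \<lfloor>y $ j / h\<rfloor>" using assms(2) by (metis cell_index_def)
    then have "\<bar>x $ j / h - y $ j / h\<bar> \<le> 1" by linarith
    then have "\<bar>(x $ j - y $ j) / h\<bar> \<le> 1" by (simp add: diff_divide_distrib)
    then show ?thesis using assms(1) by (simp add: abs_divide)
  qed
  then have "(\<Sum>j\<in>UNIV. \<bar>(x - y) $ j\<bar>) \<le> (\<Sum>j\<in>(UNIV :: 'd set). h)" by (intro sum_mono)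
  then show ?thesis using norm_le_l1_cart[of "x - y"] by (simp add: dist_norm)
qed

lemma finite_separated:
  assumes "finite (\<eta> :: 'a::metric_space set)"
  shows "\<exists>e>0. \<forall>x\<in>\<eta>. \<forall>y\<in>\<eta>. x \<noteq> y \<longrightarrow> e \<le> dist x y"
proof (intro exI conjI)
  let ?D = "insert 1 ((\<lambda>(x, y). dist x y) ` {(x, y). x \<in> \<eta> \<and> y \<in> \<eta> \<and> x \<noteq> y})"
  have "finite {(x, y). x \<in> \<eta> \<and> y \<in> \<eta> \<and> x \<noteq> y}"
  proof (rule finite_subset)
    show "{(x, y). x \<in> \<eta> \<and> y \<in> \<eta> \<and> x \<noteq> y} \<subseteq> \<eta> \<times> \<eta>" by auto
  qed (use assms in auto)
  then have f: "finite ?D" by auto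
  show "0 < Min ?D" using f by (subst Min_gr_iff) auto
  show "\<forall>x\<in>\<eta>. \<forall>y\<in>\<eta>. x \<noteq> y \<longrightarrow> Min ?D \<le> dist x y"
    using f by (intro ballI impI Min_le) auto
qed

text \<open>Sets of configurations that are open under small movements of the points are measurable: a configuration in the
set is recognised by the finite set of occupied cells of a sufficiently fine grid, and there are only countably
many grids and finite sets of cells.\<close>

lemma perturbation_stable_measurable:
  fixes W :: "(real^'d::finite) set"
  assumes sub: "U \<subseteq> {\<eta>. finite \<eta> \<and> \<eta> \<subseteq> W}"
    and stable: "\<And>\<eta>. \<eta> \<in> U \<Longrightarrow>
      \<exists>e>0. \<forall>f. inj_on f \<eta> \<longrightarrow> (\<forall>x\<in>\<eta>. dist (f x) x < e) \<longrightarrow> f ` \<eta> \<subseteq> W \<longrightarrow> f ` \<eta> \<in> U"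
  shows "U \<in> sets (config_space W)"
proof -
  let ?h = "\<lambda>m::nat. 1 / real (Suc m)"
  let ?c = "\<lambda>m k. {x :: real^'d. cell_index (?h m) x = k}"
  \<comment> \<open>the occupied cells of the grid \<open>m\<close> are those in \<open>S\<close>, each of them by a single point\<close>
  define E where "E m S = {\<eta> \<in> space (config_space W). \<forall>k. card (\<eta> \<inter> ?c m k) = (if k \<in> S then 1 else 0)}" for m S
  have E: "E m S \<in> sets (config_space W)" for m S
    unfolding E_def by (intro sets.sets_Collect_countable_All sets_config_count borel_cell)
  let ?I = "{(m, S). finite S \<and> E m S \<subseteq> U}"
  have "countable ?I"
  proof (rule countable_subset)
    show "?I \<subseteq> UNIV \<times> {S. finite S}" by auto
    show "countable ((UNIV :: nat set) \<times> {S :: ('d \<Rightarrow> int) set. finite S})"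
      by (intro countable_SIGMA countable_Collect_finite) auto
  qed
  then have "(\<Union>(m, S)\<in>?I. E m S) \<in> sets (config_space W)"
    using E by (intro sets.countable_UN'') auto
  moreover have "(\<Union>(m, S)\<in>?I. E m S) = U"
  proof
    show "(\<Union>(m, S)\<in>?I. E m S) \<subseteq> U" by auto
    show "U \<subseteq> (\<Union>(m, S)\<in>?I. E m S)"
    proof
      fix \<eta> assume \<eta>: "\<eta> \<in> U"
      have fin: "finite \<eta>" and W: "\<eta> \<subseteq> W" using sub \<eta> by auto
      obtain e where e: "e > 0"
        "\<forall>f. inj_on f \<eta> \<longrightarrow> (\<forall>x\<in>\<eta>. dist (f x) x < e) \<longrightarrow> f ` \<eta> \<subseteq> W \<longrightarrow> f ` \<eta> \<in> U"
        using stable[OF \<eta>] by (elim exE conjE)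
      obtain e' where e': "e' > 0" "\<And>x y. x \<in> \<eta> \<Longrightarrow> y \<in> \<eta> \<Longrightarrow> x \<noteq> y \<Longrightarrow> e' \<le> dist x y"
        using finite_separated[OF fin] by blast
      \<comment> \<open>a grid that separates the points of \<open>\<eta>\<close> and whose cells have diameter less than \<open>e\<close>\<close>
      have "0 < min e e' / CARD('d)" using e(1) e'(1) by simp
      then obtain m where m: "?h m < min e e' / CARD('d)"
        using reals_Archimedean[of "min e e' / CARD('d)"] by (auto simp: inverse_eq_divide)
      then have "CARD('d) * ?h m < min e e'" by (simp add: field_simps)
      then have close: "dist x y < min e e'" if "cell_index (?h m) x = cell_index (?h m) y" for x y :: "real^'d"
        using dist_same_cell[OF _ that] by (rule le_less_trans[rotated]) simp
      define S where "S = cell_index (?h m) ` \<eta>"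
      have \<eta>E: "\<eta> \<in> E m S"
        unfolding E_def
      proof (intro CollectI conjI allI)
        show "\<eta> \<in> space (config_space W)" using fin W by (simp add: space_config_space)
        fix k
        show "card (\<eta> \<inter> ?c m k) = (if k \<in> S then 1 else 0)"
        proof (cases "k \<in> S")
          case True
          then obtain x where x: "x \<in> \<eta>" "cell_index (?h m) x = k" by (auto simp: S_def)
          have "\<eta> \<inter> ?c m k = {x}"
            using x close e'(2) by (force simp: dist_commute)
          then show ?thesis using True by simp
        next
          case False
          then have "\<eta> \<inter> ?c m k = {}" by (auto simp: S_def)
          then show ?thesis using False by simp
        qed
      qed
      have "E m S \<subseteq> U"
      proof
        fix \<eta>' assume \<eta>': "\<eta>' \<in> E m S"
        have fin': "finite \<eta>'" and W': "\<eta>' \<subseteq> W" using \<eta>' by (auto simp: E_def space_config_space)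
        have cs: "card (\<eta>' \<inter> ?c m k) = (if k \<in> S then 1 else 0)" for k using \<eta>' by (simp add: E_def)
        have "\<exists>y. \<eta>' \<inter> ?c m (cell_index (?h m) x) = {y}" if "x \<in> \<eta>" for x
          using cs[of "cell_index (?h m) x"] that by (auto simp: S_def card_1_singleton_iff)
        then obtain f where f: "\<And>x. x \<in> \<eta> \<Longrightarrow> \<eta>' \<inter> ?c m (cell_index (?h m) x) = {f x}" by metis
        have fx: "f x \<in> \<eta>'" "cell_index (?h m) (f x) = cell_index (?h m) x" if "x \<in> \<eta>" for x
          using f[OF that] by auto
        have "inj_on f \<eta>"
        proof (rule inj_onI)
          fix x y assume xy: "x \<in> \<eta>" "y \<in> \<eta>" "f x = f y"
          then have "cell_index (?h m) x = cell_index (?h m) y" using fx by metis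
          then show "x = y" using close e'(2) xy by force
        qed
        moreover have "dist (f x) x < e" if "x \<in> \<eta>" for x using close fx(2)[OF that] by force
        moreover have "f ` \<eta> = \<eta>'"
        proof
          show "f ` \<eta> \<subseteq> \<eta>'" using fx by auto
          show "\<eta>' \<subseteq> f ` \<eta>"
          proof
            fix y assume y: "y \<in> \<eta>'"
            then have "card (\<eta>' \<inter> ?c m (cell_index (?h m) y)) \<noteq> 0" using fin' by auto
            then have "cell_index (?h m) y \<in> S" using cs by metis
            then obtain x where x: "x \<in> \<eta>" "cell_index (?h m) y = cell_index (?h m) x" by (auto simp: S_def)
            then have "y = f x" using f[OF x(1)] y by auto
            then show "y \<in> f ` \<eta>" using x by auto
          qed
        qed
        ultimately show "\<eta>' \<in> U" using e(2)[rule_format, of f] W' by auto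
      qed
      then have "(m, S) \<in> ?I" using fin by (simp add: S_def)
      then show "\<eta> \<in> (\<Union>(m, S)\<in>?I. E m S)" using \<eta>E by blast
    qed
  qed
  ultimately show ?thesis by simp
qed

text \<open>A crossing is witnessed by a pair of parameters in a compact square, and projecting along a compact factor preserves
closedness.\<close>

lemma closed_edges_cross:
  fixes L :: "'a::euclidean_space set"
  assumes L: "subspace L"
  shows "closed {(a, b, c, d). edges_cross \<rho> L a b c d}"
proof -
  have cont: "continuous_on UNIV (orth_proj L)"
    using linear_orth_proj[OF L] by (simp add: linear_continuous_on linear_conv_bounded_linear)
  let ?T = "{p :: (real \<times> real) \<times> 'a \<times> 'a \<times> 'a \<times> 'a.
     norm (fst (snd p) - fst (snd (snd p))) \<le> \<rho> \<and>
     norm (fst (snd (snd (snd p))) - snd (snd (snd (snd p)))) \<le> \<rho> \<and>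
     orth_proj L ((1 - fst (fst p)) *\<^sub>R fst (snd p) + fst (fst p) *\<^sub>R fst (snd (snd p)))
     = orth_proj L ((1 - snd (fst p)) *\<^sub>R fst (snd (snd (snd p))) + snd (fst p) *\<^sub>R snd (snd (snd (snd p))))}"
  have "closed ?T"
    by (intro closed_Collect_conj closed_Collect_le closed_Collect_eq continuous_intros
        continuous_on_compose2[OF cont]) auto
  then have "closed {q. \<exists>p. p \<in> {0..1} \<times> {0..1} \<and> (p, q) \<in> ?T}"
    by (intro closed_compact_projection compact_Times) auto
  moreover have "(\<exists>p. p \<in> {0..1} \<times> {0..1} \<and> (p, a, b, c, d) \<in> ?T) \<longleftrightarrow> edges_cross \<rho> L a b c d" for a b c d
  proof -
    have "edges_cross \<rho> L a b c d \<longleftrightarrow> (\<exists>u\<in>{0..1}. \<exists>v\<in>{0..1}. norm (a - b) \<le> \<rho> \<and> norm (c - d) \<le> \<rho> \<and>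
      orth_proj L ((1 - u) *\<^sub>R a + u *\<^sub>R b) = orth_proj L ((1 - v) *\<^sub>R c + v *\<^sub>R d))"
      unfolding edges_cross_def closed_segment_image_interval image_image by blast
    then show ?thesis by (simp add: Bex_def mem_Times_iff) blast
  qed
  then have "{q. \<exists>p. p \<in> {0..1} \<times> {0..1} \<and> (p, q) \<in> ?T} = {(a, b, c, d). edges_cross \<rho> L a b c d}"
    by (simp add: set_eq_iff split: prod.split)
  ultimately show ?thesis by simp
qed

lemma not_edges_cross_stable:
  fixes L :: "'a::euclidean_space set"
  assumes L: "subspace L" and n: "\<not> edges_cross \<rho> L a b c d"
  shows "\<exists>e>0. \<forall>a' b' c' d'. dist a' a < e \<longrightarrow> dist b' b < e \<longrightarrow> dist c' c < e \<longrightarrow> dist d' d < e \<longrightarrow>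
    \<not> edges_cross \<rho> L a' b' c' d'"
proof -
  have "open (- {(a, b, c, d). edges_cross \<rho> L a b c d})" using closed_edges_cross[OF L] by (rule open_Compl)
  moreover have "(a, b, c, d) \<in> - {(a, b, c, d). edges_cross \<rho> L a b c d}" using n by simp
  ultimately obtain e where e: "e > 0"
    "\<And>p. dist p (a, b, c, d) < e \<Longrightarrow> p \<in> - {(a, b, c, d). edges_cross \<rho> L a b c d}"
    unfolding open_dist by blast
  have pair: "dist (x, y) (x', y') \<le> dist x x' + dist y y'" for x x' :: "'b::metric_space" and y y' :: "'c::metric_space"
    unfolding dist_Pair_Pair using sqrt_sum_squares_le_sum_abs[of "dist x x'" "dist y y'"] by simp
  show ?thesis
  proof (intro exI[of _ "e / 4"] conjI allI impI)
    show "0 < e / 4" using e by simp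
    fix a' b' c' d' assume "dist a' a < e / 4" "dist b' b < e / 4" "dist c' c < e / 4" "dist d' d < e / 4"
    then have "dist (a', b', c', d') (a, b, c, d) < e"
      using pair[of a' "(b', c', d')" a "(b, c, d)"] pair[of b' "(c', d')" b "(c, d)"] pair[of c' d' c d]
      by linarith
    from e(2)[OF this] show "\<not> edges_cross \<rho> L a' b' c' d'" by simp
  qed
qed

lemma crossing_free_measurable:
  fixes W :: "(real^'d::finite) set"
  shows "{\<eta>. finite \<eta> \<and> \<eta> \<subseteq> W \<and> (\<exists>L\<in>planes. crossing_number \<rho> \<eta> L = 0)} \<in> sets (config_space W)"
    (is "?U \<in> _")
proof (rule perturbation_stable_measurable)
  show "?U \<subseteq> {\<eta>. finite \<eta> \<and> \<eta> \<subseteq> W}" by auto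
  fix \<eta> assume "\<eta> \<in> ?U"
  then obtain L where fin: "finite \<eta>" and L: "L \<in> planes" "crossing_number \<rho> \<eta> L = 0" by auto
  have sL: "subspace L" using L by (simp add: planes_def)
  let ?I = "{(a, b, c, d). a \<in> \<eta> \<and> b \<in> \<eta> \<and> c \<in> \<eta> \<and> d \<in> \<eta> \<and> distinct [a, b, c, d]}"
  have fI: "finite ?I"
  proof (rule finite_subset)
    show "?I \<subseteq> \<eta> \<times> \<eta> \<times> \<eta> \<times> \<eta>" by auto
  qed (use fin in auto)
  define stable where "stable e p \<longleftrightarrow> 0 < e \<and> (\<forall>a' b' c' d'. dist a' (fst p) < e \<longrightarrow> dist b' (fst (snd p)) < e \<longrightarrow>
      dist c' (fst (snd (snd p))) < e \<longrightarrow> dist d' (snd (snd (snd p))) < e \<longrightarrow>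
    \<not> edges_cross \<rho> L a' b' c' d')" for e p
  have "\<forall>p\<in>?I. \<exists>e. stable e p"
  proof
    fix p assume p: "p \<in> ?I"
    obtain a b c d where p': "p = (a, b, c, d)" by (rule prod_cases4)
    then have "\<not> edges_cross \<rho> L a b c d"
      using p crossing_number_eq_0_iff[OF fin, THEN iffD1, OF L(2)] by simp
    from not_edges_cross_stable[OF sL this] show "\<exists>e. stable e p" unfolding stable_def p' by simp
  qed
  then obtain e where e': "\<forall>p\<in>?I. stable (e p) p" by (rule bchoice[THEN exE])
  note e = bspec[OF e']
  let ?e = "Min (insert 1 (e ` ?I))"
  have e0: "0 < ?e" using fI e unfolding stable_def by (subst Min_gr_iff) auto
  have el: "?e \<le> e p" if "p \<in> ?I" for p using fI that by (intro Min_le) auto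
  show "\<exists>e>0. \<forall>f. inj_on f \<eta> \<longrightarrow> (\<forall>x\<in>\<eta>. dist (f x) x < e) \<longrightarrow> f ` \<eta> \<subseteq> W \<longrightarrow> f ` \<eta> \<in> ?U"
  proof (intro exI[of _ ?e] conjI allI impI e0)
    fix f assume f: "inj_on f \<eta>" "\<forall>x\<in>\<eta>. dist (f x) x < ?e" "f ` \<eta> \<subseteq> W"
    have "crossing_number \<rho> (f ` \<eta>) L = 0"
      unfolding crossing_number_eq_0_iff[OF finite_imageI[OF fin]]
    proof (intro ballI impI)
      fix a' b' c' d' assume "a' \<in> f ` \<eta>" "b' \<in> f ` \<eta>" "c' \<in> f ` \<eta>" "d' \<in> f ` \<eta>" and dis: "distinct [a', b', c', d']"
      then obtain a b c d where abcd: "a \<in> \<eta>" "b \<in> \<eta>" "c \<in> \<eta>" "d \<in> \<eta>" "a' = f a" "b' = f b" "c' = f c" "d' = f d"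
        by blast
      then have I: "(a, b, c, d) \<in> ?I" using dis by auto
      have "dist (f x) x < e (a, b, c, d)" if "x \<in> \<eta>" for x using f(2) that el[OF I] by force
      then show "\<not> edges_cross \<rho> L a' b' c' d'" using e[OF I] abcd unfolding stable_def by simp
    qed
    then show "f ` \<eta> \<in> ?U" using f(3) fin L(1) by auto
  qed
qed

section \<open>A one-parameter family of planes\<close>

text \<open>Different slopes \<open>s \<in> {0..1}\<close> give planes that form an angle of the order of the difference of the slopes.\<close>

definition tilted_plane :: "'d \<Rightarrow> 'd \<Rightarrow> 'd \<Rightarrow> real \<Rightarrow> (real^'d::finite) set" where
  "tilted_plane i1 i2 i3 s = span {axis i1 1, axis i2 1 + s *\<^sub>R axis i3 1}"

lemma tilted_plane_in_planes:
  fixes i1 i2 i3 :: "'d::finite"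
  assumes "distinct [i1, i2, i3]"
  shows "tilted_plane i1 i2 i3 s \<in> planes"
proof -
  let ?u = "axis i1 1 :: real^'d" and ?v = "axis i2 1 + s *\<^sub>R axis i3 1 :: real^'d"
  have v: "?v $ i2 = 1" "?v $ i1 = 0" and u: "?u $ i1 = 1" using assms by (auto simp: axis_def)
  have ne: "?u \<noteq> ?v" using u(1) v(2) by (metis zero_neq_one)
  have "?u \<bullet> ?v = 0" using v by (simp add: inner_axis')
  then have "pairwise orthogonal {?u, ?v}"
    by (auto simp: pairwise_def orthogonal_def inner_commute)
  moreover have "0 \<notin> {?u, ?v}" using u v by (metis insert_iff singleton_iff zero_index zero_neq_one)
  ultimately have "independent {?u, ?v}" by (rule pairwise_orthogonal_independent)
  then have "dim (tilted_plane i1 i2 i3 s) = 2"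
    unfolding tilted_plane_def using ne by (simp add: dim_eq_card_independent)
  then show ?thesis by (simp add: planes_def tilted_plane_def)
qed

lemma floor_diff_approx: "\<bar>real_of_int (\<lfloor>x\<rfloor> - \<lfloor>y\<rfloor>) - (x - y)\<bar> \<le> 1" for x y :: real
  by linarith

text \<open>Rounding to cells changes each coordinate, in units of \<open>h\<close>, by at most \<open>1\<close>.\<close>

lemma edges_cross_imp_quads:
  fixes a b c d :: "real^'d::finite"
  assumes i: "distinct [i1, i2, i3]" and s: "0 \<le> s" "s \<le> 1" and h: "0 < h" "h \<le> r"
    and ec: "edges_cross r (tilted_plane i1 i2 i3 s) a b c d"
    and cells: "cell_index h a \<in> V" "cell_index h b \<in> V" "cell_index h c \<in> V" "cell_index h d \<in> V"
    and dis: "distinct [cell_index h a, cell_index h b, cell_index h c, cell_index h d]"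
  shows "{cell_index h a, cell_index h b, cell_index h c, cell_index h d}
    \<in> quads V (cell_adj (r / h)) (cell_near i1 i2 i3 (r / h) s)"
proof -
  let ?L = "tilted_plane i1 i2 i3 s" and ?R = "r / h"
  have R: "1 \<le> ?R" using h by simp
  have L: "subspace ?L" by (simp add: tilted_plane_def)
  have adj: "cell_adj ?R (cell_index h x) (cell_index h y)" if "norm (x - y) \<le> r" for x y :: "real^'d"
    unfolding cell_adj_def
  proof
    fix j
    have "\<bar>(x - y) $ j\<bar> \<le> r" using component_le_norm_cart[of "x - y" j] that by linarith
    then have "\<bar>(x $ j - y $ j) / h\<bar> \<le> ?R" using h by (simp add: abs_divide divide_right_mono)
    then have "\<bar>x $ j / h - y $ j / h\<bar> \<le> ?R" by (simp add: diff_divide_distrib)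
    then show "\<bar>real_of_int (cell_index h x j - cell_index h y j)\<bar> \<le> 2 * ?R"
      using floor_diff_approx[of "x $ j / h" "y $ j / h"] R unfolding cell_index_def by linarith
  qed
  have near: "cell_near i1 i2 i3 ?R s (cell_index h u) (cell_index h v)" if uv: "u \<in> {a, b}" "v \<in> {c, d}" for u v
  proof -
    have w1: "axis i1 1 \<in> ?L" and w2: "axis i2 1 + s *\<^sub>R axis i3 1 \<in> ?L"
      by (auto simp: tilted_plane_def intro: span_base)
    have "norm (axis i2 1 + s *\<^sub>R axis i3 1 :: real^'d) \<le> 2"
      using norm_triangle_ineq[of "axis i2 1 :: real^'d" "s *\<^sub>R axis i3 1"] s by (simp add: norm_axis_1)
    then have n2: "norm (axis i2 1 + s *\<^sub>R axis i3 1 :: real^'d) * (2 * r) \<le> 4 * r"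
      using h by simp
    define x1 x2 x3 where x: "x1 = (u $ i1 - v $ i1) / h" "x2 = (u $ i2 - v $ i2) / h" "x3 = (u $ i3 - v $ i3) / h"
    have "\<bar>u $ i1 - v $ i1\<bar> \<le> 2 * r"
      using edges_cross_inner_le[OF L ec w1 uv] by (simp add: inner_axis' norm_axis_1)
    then have 1: "\<bar>x1\<bar> \<le> 2 * ?R" unfolding x using h by (simp add: abs_divide divide_right_mono)
    have "\<bar>(u $ i2 - v $ i2) + s * (u $ i3 - v $ i3)\<bar> \<le> 4 * r"
      using order_trans[OF edges_cross_inner_le[OF L ec w2 uv] n2] by (simp add: inner_axis' inner_add_left)
    moreover have "((u $ i2 - v $ i2) + s * (u $ i3 - v $ i3)) / h = x2 + s * x3"
      unfolding x by (simp add: add_divide_distrib)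
    moreover have "\<bar>y / h\<bar> \<le> 4 * ?R" if "\<bar>y\<bar> \<le> 4 * r" for y
      using h that by (simp add: abs_divide divide_right_mono)
    ultimately have 2: "\<bar>x2 + s * x3\<bar> \<le> 4 * ?R" by metis
    define k1 k2 k3 where k: "k1 = real_of_int (cell_index h u i1 - cell_index h v i1)"
      "k2 = real_of_int (cell_index h u i2 - cell_index h v i2)"
      "k3 = real_of_int (cell_index h u i3 - cell_index h v i3)"
    have kx: "\<bar>k1 - x1\<bar> \<le> 1" "\<bar>k2 - x2\<bar> \<le> 1" "\<bar>k3 - x3\<bar> \<le> 1"
      unfolding k x cell_index_def diff_divide_distrib by (rule floor_diff_approx)+
    have "\<bar>s * (k3 - x3)\<bar> \<le> 1 * 1" unfolding abs_mult using s kx(3) by (intro mult_mono) auto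
    moreover have "k2 + s * k3 = (k2 - x2) + s * (k3 - x3) + (x2 + s * x3)" by (simp add: algebra_simps)
    ultimately have "\<bar>k2 + s * k3\<bar> \<le> 10 * ?R" using 2 kx(2) R by linarith
    moreover have "\<bar>k1\<bar> \<le> 5 * ?R" using 1 kx(1) R by linarith
    ultimately show ?thesis unfolding cell_near_def k by simp
  qed
  have ab: "norm (a - b) \<le> r" "norm (c - d) \<le> r" using ec by (auto simp: edges_cross_def)
  show ?thesis
    unfolding quads_def
  proof (rule CollectI, intro exI conjI)
    show "cell_adj ?R (cell_index h a) (cell_index h b)" "cell_adj ?R (cell_index h c) (cell_index h d)"
      using ab by (auto intro: adj)
    show "cell_near i1 i2 i3 ?R s (cell_index h a) (cell_index h c)"
      "cell_near i1 i2 i3 ?R s (cell_index h a) (cell_index h d)"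
      "cell_near i1 i2 i3 ?R s (cell_index h b) (cell_index h c)"
      "cell_near i1 i2 i3 ?R s (cell_index h b) (cell_index h d)"
      by (rule near; simp)+
    show "{cell_index h a, cell_index h b, cell_index h c, cell_index h d} \<subseteq> V" using cells by simp
  qed (rule refl, rule dis)
qed

lemma crossing_free_of_cells:
  fixes \<eta> :: "(real^'d::finite) set"
  assumes i: "distinct [i1, i2, i3]" and s: "0 \<le> s" "s \<le> 1" and h: "0 < h" "h \<le> r"
    and fin: "finite \<eta>" and V: "cell_index h ` \<eta> \<subseteq> V"
    and single: "\<And>k. k \<in> V \<Longrightarrow> card (\<eta> \<inter> {x. cell_index h x = k}) \<le> 1"
    and free: "\<not> contains_some (quads V (cell_adj (r / h)) (cell_near i1 i2 i3 (r / h) s))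
       {k\<in>V. \<eta> \<inter> {x. cell_index h x = k} \<noteq> {}}"
  shows "crossing_number r \<eta> (tilted_plane i1 i2 i3 s) = 0"
  unfolding crossing_number_eq_0_iff[OF fin]
proof (intro ballI impI notI)
  fix a b c d assume abcd: "a \<in> \<eta>" "b \<in> \<eta>" "c \<in> \<eta>" "d \<in> \<eta>" and dis: "distinct [a, b, c, d]"
    and ec: "edges_cross r (tilted_plane i1 i2 i3 s) a b c d"
  have inj: "inj_on (cell_index h) \<eta>"
  proof (rule inj_onI)
    fix x y assume xy: "x \<in> \<eta>" "y \<in> \<eta>" "cell_index h x = cell_index h y"
    have "card (\<eta> \<inter> {z. cell_index h z = cell_index h x}) \<le> 1" using single V xy by auto
    then show "x = y" using xy fin by (auto simp: card_le_Suc0_iff_eq)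
  qed
  then have "distinct [cell_index h a, cell_index h b, cell_index h c, cell_index h d]"
    using abcd dis by (auto simp: inj_on_def)
  then have "{cell_index h a, cell_index h b, cell_index h c, cell_index h d}
    \<in> quads V (cell_adj (r / h)) (cell_near i1 i2 i3 (r / h) s)"
    using abcd V by (intro edges_cross_imp_quads[OF i s h ec]) auto
  moreover have "{cell_index h a, cell_index h b, cell_index h c, cell_index h d} \<subseteq> {k\<in>V. \<eta> \<inter> {x. cell_index h x = k} \<noteq> {}}"
    using abcd V by auto
  ultimately show False using free unfolding contains_some_def by blast
qed

section \<open>Asymptotics\<close>

lemma cell_index_bound:
  fixes x :: "real^'d::finite"
  assumes "0 < h" "h \<le> 1" "\<bar>x $ j\<bar> \<le> D - 1"
  shows "\<bar>real_of_int (cell_index h x j)\<bar> \<le> D / h"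
proof -
  have "\<bar>x $ j / h\<bar> \<le> (D - 1) / h" using assms by (simp add: abs_divide divide_right_mono)
  moreover have "(D - 1) / h + 1 \<le> D / h" using assms by (simp add: field_simps)
  moreover have "\<bar>real_of_int (cell_index h x j)\<bar> \<le> \<bar>x $ j / h\<bar> + 1"
    unfolding cell_index_def by linarith
  ultimately show ?thesis by linarith
qed

text \<open>The estimate for a fixed intensity \<open>t\<close>, a number \<open>N\<close> of planes with slopes \<open>i / N\<close> and cells of side
length \<open>h\<close>. Apart from the last term, which stems from doubly occupied cells, the mesh size disappears:
\<open>p * \<alpha>\<close>, \<open>p * \<beta>\<close> and \<open>p * card V\<close> are bounds for the expected numbers of points in
regions that do not depend on \<open>h\<close>.\<close>

lemma poisson_crossing_free_lower_bound:
  fixes W :: "(real^'d::finite) set" and \<nu> :: "(real^'d) set measure" and N :: nat and t r h D :: real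
  assumes i: "distinct [i1, i2, i3 :: 'd]"
    and W: "\<And>x j. x \<in> W \<Longrightarrow> \<bar>x $ j\<bar> \<le> D - 1" and D: "1 \<le> D"
    and \<nu>: "uniform_plane_measure \<nu>" and P: "poisson_process t W P"
    and t: "0 < t" and h: "0 < h" "h \<le> r" "h \<le> 1" and N: "1 \<le> N"
    and p: "t * h ^ CARD('d) \<le> 1/2"
    and C1: "C1 = (3 * D) ^ CARD('d) * 25 ^ CARD('d) * (253 * (5 * D) ^ (CARD('d) - 2))"
    and C2: "C2 = (3 * D) ^ CARD('d) * 25 ^ CARD('d) * (27511 * (5 * D) ^ (CARD('d) - 3))"
    and C3: "C3 = 5 ^ CARD('d) * (1 + 253 * (5 * D) ^ (CARD('d) - 2))"
    and lam: "\<kappa> = t ^ 4 * r ^ (2 * CARD('d) + 2)"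
    and mu: "\<mu> = t * r ^ CARD('d) + t\<^sup>2 * r ^ (CARD('d) + 2)"
    and small: "C3 * \<mu> \<le> 1"
  shows "1 - (exp (- (N * exp (- (2 * (C1 * \<kappa>)))))
      + (real N)\<^sup>2 * (C1 * \<kappa> * (320 * (C3 * \<mu>)) + C2 * (real N)\<^sup>2 * (\<kappa> * r))
      + (3 * D) ^ CARD('d) * (t\<^sup>2 * h ^ CARD('d)))
    \<le> measure P {\<eta>\<in>space P. 0 < zero_crossing_measure \<nu> r \<eta>}"
proof -
  define R where "R = r / h"
  define M where "M = D / h"
  define p where "p = t * h ^ CARD('d)"
  define V where "V = cell_index h ` W"
  define p' where "p' k = 1 - exp (- (t * measure lborel (W \<inter> {x. cell_index h x = k})))" for k
  define s where "s i = real i / real N" for i :: nat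
  define near where "near i = cell_near i1 i2 i3 R (s i)" for i
  define near2 where "near2 = cell_near2 i1 i2 i3 R (real N)"
  define \<alpha> where "\<alpha> = (5 * R) ^ CARD('d)"
  define \<beta> where "\<beta> = 253 * R\<^sup>2 * (5 * M) ^ (CARD('d) - 2)"
  define \<beta>2 where "\<beta>2 = 27511 * (real N)\<^sup>2 * R ^ 3 * (5 * M) ^ (CARD('d) - 3)"
  have r: "0 < r" using h by simp
  have "card {i1, i2, i3} \<le> CARD('d)" by (intro card_mono) auto
  then have "3 \<le> CARD('d)" using i by simp
  then obtain e where e: "CARD('d) = e + 3" by (metis add.commute le_Suc_ex)
  have R: "1 \<le> R" using h by (simp add: R_def)
  have M: "1 \<le> M" using h D by (simp add: M_def)
  have VM: "\<bar>real_of_int (k j)\<bar> \<le> M" if "k \<in> V" for k j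
  proof -
    obtain x where x: "x \<in> W" "k = cell_index h x" using \<open>k \<in> V\<close> by (auto simp: V_def)
    show ?thesis unfolding x(2) M_def by (rule cell_index_bound[OF h(1,3) W[OF x(1)]])
  qed
  have fV: "finite V" and cV: "real (card V) \<le> (3 * M) ^ CARD('d)"
    by (rule card_cells_le[OF M], rule VM, assumption)+
  have s01: "0 \<le> s i" "s i \<le> 1" if "i < N" for i using that by (auto simp: s_def)
  have p0: "0 \<le> p" "p \<le> 1/2" using t h p by (auto simp: p_def)
  have mass: "0 \<le> t * measure lborel (W \<inter> {x. cell_index h x = k})"
    "t * measure lborel (W \<inter> {x. cell_index h x = k}) \<le> p" for k
    using measure_cell_le[OF h(1), of W k] t by (auto simp: p_def mult_left_mono)
  have p': "0 \<le> p' k \<and> p' k \<le> p" for k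
    using mass[of k] exp_ge_add_one_self[of "- (t * measure lborel (W \<inter> {x. cell_index h x = k}))"]
    unfolding p'_def by auto
  have pos: "0 \<le> \<alpha>" "0 \<le> \<beta>" "0 \<le> \<beta>2" using R M by (auto simp: \<alpha>_def \<beta>_def \<beta>2_def)
  \<comment> \<open>the mesh size cancels in all of the following products\<close>
  have pn: "p * card V \<le> (3 * D) ^ CARD('d) * t"
  proof -
    have "p * card V \<le> p * (3 * M) ^ CARD('d)" by (rule mult_left_mono[OF cV p0(1)])
    also have "\<dots> = (3 * D) ^ CARD('d) * t"
      using h by (simp add: p_def M_def power_mult_distrib power_divide)
    finally show ?thesis .
  qed
  have pa: "p * \<alpha> = 5 ^ CARD('d) * (t * r ^ CARD('d))"
    using h by (simp add: p_def \<alpha>_def R_def power_mult_distrib power_divide)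
  have pb: "p * \<beta> = 253 * (5 * D) ^ (CARD('d) - 2) * (t * r\<^sup>2)"
    using h by (simp add: p_def \<beta>_def R_def M_def e power_mult_distrib power_divide power_add
        power2_eq_square power3_eq_cube)
  have pb2: "p * \<beta>2 = 27511 * (real N)\<^sup>2 * (5 * D) ^ (CARD('d) - 3) * (t * r ^ 3)"
    using h by (simp add: p_def \<beta>2_def R_def M_def e power_mult_distrib power_divide power_add
        power2_eq_square power3_eq_cube)
  have r2: "r ^ (2 * CARD('d) + 2) = r ^ CARD('d) * r ^ CARD('d) * r\<^sup>2"
    by (simp add: power_add mult_2 power2_eq_square)
  have p25: "(25::real) ^ CARD('d) = 5 ^ CARD('d) * 5 ^ CARD('d)"
    by (simp flip: power_mult_distrib)
  have X1: "p ^ 4 * (card V * \<alpha> * (\<beta> * \<alpha>)) \<le> C1 * \<kappa>"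
  proof -
    have "p ^ 4 * (card V * \<alpha> * (\<beta> * \<alpha>)) = (p * card V) * ((p * \<alpha>) * ((p * \<beta>) * (p * \<alpha>)))"
      by (simp add: power4_eq_xxxx)
    also have "\<dots> \<le> ((3 * D) ^ CARD('d) * t) * ((p * \<alpha>) * ((p * \<beta>) * (p * \<alpha>)))"
      using pn p0 pos by (intro mult_right_mono) auto
    also have "\<dots> = C1 * \<kappa>"
      unfolding pa pb C1 lam r2 p25 by (simp add: power4_eq_xxxx)
    finally show ?thesis .
  qed
  have X2: "p ^ 4 * (card V * \<alpha> * (\<beta>2 * \<alpha>)) \<le> C2 * (real N)\<^sup>2 * (\<kappa> * r)"
  proof -
    have "p ^ 4 * (card V * \<alpha> * (\<beta>2 * \<alpha>)) = (p * card V) * ((p * \<alpha>) * ((p * \<beta>2) * (p * \<alpha>)))"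
      by (simp add: power4_eq_xxxx)
    also have "\<dots> \<le> ((3 * D) ^ CARD('d) * t) * ((p * \<alpha>) * ((p * \<beta>2) * (p * \<alpha>)))"
      using pn p0 pos by (intro mult_right_mono) auto
    also have "\<dots> = C2 * (real N)\<^sup>2 * (\<kappa> * r)"
      unfolding pa pb2 C2 lam r2 p25 by (simp add: power4_eq_xxxx power3_eq_cube power2_eq_square)
    finally show ?thesis .
  qed
  have pab: "p\<^sup>2 * (\<beta> * \<alpha>) = 5 ^ CARD('d) * (253 * (5 * D) ^ (CARD('d) - 2)) * (t\<^sup>2 * r ^ (CARD('d) + 2))"
  proof -
    have "p\<^sup>2 * (\<beta> * \<alpha>) = (p * \<beta>) * (p * \<alpha>)" by (simp add: power2_eq_square)
    then show ?thesis unfolding pa pb by (simp add: power2_eq_square power_add)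
  qed
  have X3: "p * \<alpha> + p\<^sup>2 * (\<beta> * \<alpha>) \<le> C3 * \<mu>"
  proof -
    let ?a = "5 ^ CARD('d) :: real" and ?b = "253 * (5 * D) ^ (CARD('d) - 2)"
    let ?u = "t * r ^ CARD('d)" and ?v = "t\<^sup>2 * r ^ (CARD('d) + 2)"
    have "C3 * \<mu> = ?a * ?u + ?a * ?b * ?v + (?a * ?v + ?a * ?b * ?u)"
      unfolding C3 mu by (simp add: algebra_simps)
    moreover have "0 \<le> ?a * ?v + ?a * ?b * ?u" using t r D by simp
    ultimately show ?thesis unfolding pa pab by linarith
  qed
  have small': "p * \<alpha> \<le> 1" "p\<^sup>2 * (\<beta> * \<alpha>) \<le> 1"
  proof -
    have "0 \<le> p * \<alpha>" "0 \<le> p\<^sup>2 * (\<beta> * \<alpha>)" using p0 pos by auto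
    then show "p * \<alpha> \<le> 1" "p\<^sup>2 * (\<beta> * \<alpha>) \<le> 1" using X3 small by linarith+
  qed
  let ?Q = "\<lambda>i. quads V (cell_adj R) (near i)"
  let ?A = "\<lambda>H. \<forall>i<N. contains_some (?Q i) H"
  have "subset_prob V p' ?A \<le> exp (- (real N * exp (- (2 * (p ^ 4 * (card V * \<alpha> * (\<beta> * \<alpha>)))))))
      + (real N)\<^sup>2 * (p ^ 4 * (card V * \<alpha> * (\<beta> * \<alpha>)) * (320 * (p * \<alpha> + p\<^sup>2 * (\<beta> * \<alpha>)))
          + p ^ 4 * (card V * \<alpha> * (\<beta>2 * \<alpha>)))"
  proof (rule subset_prob_all_quads_hit_le[OF fV p' p0])
    show "real (card {z \<in> V. cell_adj R y z}) \<le> \<alpha>" for y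
      unfolding \<alpha>_def by (rule card_cell_adj_le[OF R])
    show "real (card {y \<in> V. near i x y}) \<le> \<beta>" if "i < N" "x \<in> V" for i x
      unfolding \<beta>_def near_def by (rule card_cell_near_le[OF i R M _ s01[OF that(1)] that(2)], rule VM)
    show "real (card {y \<in> V. near2 x y}) \<le> \<beta>2" if "x \<in> V" for x
      unfolding \<beta>2_def near2_def using N VM by (intro card_cell_near2_le[OF i R M _ _ that]) auto
    show "near2 x y" if ij: "i < j" "j < N" and n: "near i x y" "near j x y" for i j x y
    proof -
      have "N * \<bar>s i - s j\<bar> = \<bar>real i - real j\<bar>"
        using N by (simp add: s_def abs_divide flip: diff_divide_distrib)
      also have "1 \<le> \<bar>real i - real j\<bar>" using ij by linarith
      finally have "1 \<le> N * \<bar>s i - s j\<bar>" .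
      then show ?thesis
        using cell_near_both[OF n[unfolded near_def] s01(1) s01(2)] ij N R unfolding near2_def by simp
    qed
    show "near2 x y" if "cell_adj R x y" for x y
      unfolding near2_def using cell_adj_imp_near2[OF that] N R by simp
    show "symp (near i)" for i unfolding near_def by (rule symp_cell_near)
  qed (use pos small' symp_cell_adj in auto)
  also have "\<dots> \<le> exp (- (N * exp (- (2 * (C1 * \<kappa>)))))
      + (real N)\<^sup>2 * (C1 * \<kappa> * (320 * (C3 * \<mu>)) + C2 * (real N)\<^sup>2 * (\<kappa> * r))"
  proof (intro add_mono mult_left_mono)
    show "exp (- (real N * exp (- (2 * (p ^ 4 * (card V * \<alpha> * (\<beta> * \<alpha>)))))))
      \<le> exp (- (N * exp (- (2 * (C1 * \<kappa>)))))"
      using X1 by (simp add: mult_left_mono)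
    show "p ^ 4 * (card V * \<alpha> * (\<beta> * \<alpha>)) * (320 * (p * \<alpha> + p\<^sup>2 * (\<beta> * \<alpha>))) \<le> C1 * \<kappa> * (320 * (C3 * \<mu>))"
    proof (rule mult_mono[OF X1])
      show "320 * (p * \<alpha> + p\<^sup>2 * (\<beta> * \<alpha>)) \<le> 320 * (C3 * \<mu>)" using X3 by simp
      show "0 \<le> C1 * \<kappa>" using D t r by (simp add: C1 lam)
      show "0 \<le> 320 * (p * \<alpha> + p\<^sup>2 * (\<beta> * \<alpha>))" using p0 pos by simp
    qed
  qed (use X2 in auto)
  finally have bad: "subset_prob V p' ?A \<le> exp (- (N * exp (- (2 * (C1 * \<kappa>)))))
      + (real N)\<^sup>2 * (C1 * \<kappa> * (320 * (C3 * \<mu>)) + C2 * (real N)\<^sup>2 * (\<kappa> * r))" .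
  let ?U = "{\<eta>\<in>space P. 0 < zero_crossing_measure \<nu> r \<eta>}"
  note sp = poisson_space[OF P]
  have eqU: "?U = {\<eta>. finite \<eta> \<and> \<eta> \<subseteq> W \<and> (\<exists>L\<in>planes. crossing_number r \<eta> L = 0)}"
    unfolding sp using zero_crossing_measure_pos_iff[OF \<nu>] by auto
  have U: "?U \<in> sets P"
    unfolding eqU poisson_sets[OF P] by (rule crossing_free_measurable)
  have "subset_prob V p' (\<lambda>H. \<not> ?A H) \<le> measure P ?U + (\<Sum>k\<in>V. (t * measure lborel (W \<inter> {x. cell_index h x = k}))\<^sup>2)"
    unfolding p'_def
  proof (rule poisson_cells_bound[OF P _ fV borel_cell _ U])
    show "0 \<le> t" using t by simp
    show "disjoint_family_on (\<lambda>k. {x. cell_index h x = k}) V" by (auto simp: disjoint_family_on_def)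
    fix \<eta> assume \<eta>: "\<eta> \<in> space P" and one: "\<And>k. k \<in> V \<Longrightarrow> card (\<eta> \<inter> {x. cell_index h x = k}) \<le> 1"
      and free: "\<not> ?A {k \<in> V. \<eta> \<inter> {x. cell_index h x = k} \<noteq> {}}"
    have fin: "finite \<eta>" and \<eta>W: "\<eta> \<subseteq> W" using \<eta> sp by auto
    obtain j where j: "j < N" "\<not> contains_some (?Q j) {k \<in> V. \<eta> \<inter> {x. cell_index h x = k} \<noteq> {}}"
      using free by blast
    have "crossing_number r \<eta> (tilted_plane i1 i2 i3 (s j)) = 0"
    proof (rule crossing_free_of_cells[OF i s01[OF j(1)] h(1,2) fin _ one])
      show "cell_index h ` \<eta> \<subseteq> V" using \<eta>W by (auto simp: V_def)
      show "\<not> contains_some (quads V (cell_adj (r / h)) (cell_near i1 i2 i3 (r / h) (s j)))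
         {k \<in> V. \<eta> \<inter> {x. cell_index h x = k} \<noteq> {}}"
        using j(2) unfolding near_def R_def .
    qed
    then have "0 < zero_crossing_measure \<nu> r \<eta>"
      using zero_crossing_measure_pos_iff[OF \<nu> fin] tilted_plane_in_planes[OF i] by blast
    then show "\<eta> \<in> ?U" using \<eta> by simp
  qed
  moreover have "(\<Sum>k\<in>V. (t * measure lborel (W \<inter> {x. cell_index h x = k}))\<^sup>2) \<le> (3 * D) ^ CARD('d) * (t\<^sup>2 * h ^ CARD('d))"
  proof -
    have "(\<Sum>k\<in>V. (t * measure lborel (W \<inter> {x. cell_index h x = k}))\<^sup>2) \<le> (\<Sum>k\<in>V. p\<^sup>2)"
      using mass by (intro sum_mono power_mono) auto
    also have "\<dots> = (p * card V) * p" by (simp add: power2_eq_square)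
    also have "\<dots> \<le> ((3 * D) ^ CARD('d) * t) * p" using pn p0 by (intro mult_right_mono) auto
    also have "\<dots> = (3 * D) ^ CARD('d) * (t\<^sup>2 * h ^ CARD('d))" by (simp add: p_def power2_eq_square)
    finally show ?thesis .
  qed
  moreover have "subset_prob V p' (\<lambda>H. \<not> ?A H) = 1 - subset_prob V p' ?A" by (rule subset_prob_not[OF fV])
  ultimately show ?thesis using bad by linarith
qed

text \<open>The hypothesis makes the radius polynomially small in \<open>t\<close>; bounding the logarithm by a power of \<open>t\<close>
is affordable because any negative power would do.\<close>

lemma radius_bound:
  fixes t r c :: real and d :: nat
  assumes t: "1 \<le> t" and r: "0 < r" and c: "0 \<le> c" "c \<le> 1" and le: "t ^ 4 * r ^ (2 * d + 2) \<le> c * ln t"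
  shows "r \<le> t powr (- 1 / (real d + 1))"
proof -
  have "c * ln t \<le> 1 * ln t" using c t by (intro mult_right_mono) auto
  also have "\<dots> \<le> t" using ln_le_minus_one[of t] t by simp
  also have "\<dots> \<le> t\<^sup>2" using t by (simp add: power2_eq_square)
  finally have "t\<^sup>2 * (t\<^sup>2 * r ^ (2 * d + 2)) \<le> t\<^sup>2 * 1" using le by (simp add: power4_eq_xxxx power2_eq_square)
  then have "t\<^sup>2 * r ^ (2 * d + 2) \<le> 1" using t by (subst (asm) mult_le_cancel_left_pos) auto
  then have "r ^ (2 * d + 2) \<le> 1 / t\<^sup>2" using t by (simp add: field_simps)
  also have "1 / t\<^sup>2 = t powr (- 2)" using t by (simp add: powr_minus powr_numeral divide_inverse)
  also have "\<dots> = (t powr (- 1 / (real d + 1))) ^ (2 * d + 2)"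
  proof -
    have "(t powr (- 1 / (real d + 1))) ^ (2 * d + 2) = t powr (real (2 * d + 2) * (- 1 / (real d + 1)))"
      using t powr_realpow[of "t powr (- 1 / (real d + 1))" "2 * d + 2", symmetric]
      by (simp only: powr_powr mult.commute) simp
    also have "real (2 * d + 2) * (- 1 / (real d + 1)) = - 2" by (simp add: field_simps)
    finally show ?thesis ..
  qed
  finally have "r ^ Suc (2 * d + 1) \<le> (t powr (- 1 / (real d + 1))) ^ Suc (2 * d + 1)" by simp
  then show ?thesis by (rule power_le_imp_le_base) simp
qed

text \<open>The two summands are, up to constants, the expected number of neighbours of a point and the expected number of
edges near a point. The first one is \<open>\<kappa> powr (1/4) * r powr ((d - 1) / 2)\<close>, where the exponent of \<open>r\<close> is
at least \<open>1\<close> because of \<open>d \<ge> 3\<close>, and the second one is \<open>sqrt \<kappa> * r\<close>.\<close>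

lemma local_density_bound:
  fixes t r \<kappa> :: real and d :: nat
  assumes t: "0 < t" and r: "0 < r" "r \<le> 1" and d: "3 \<le> d" and lam: "\<kappa> = t ^ 4 * r ^ (2 * d + 2)"
  shows "t * r ^ d + t\<^sup>2 * r ^ (d + 2) \<le> 2 * ((1 + \<kappa>) * r)"
proof -
  have l0: "0 \<le> \<kappa>" using t r by (simp add: lam)
  have "\<kappa> \<le> 1 + \<kappa>" by simp
  also have "\<dots> \<le> (1 + \<kappa>) ^ 4" using l0 self_le_power[of "1 + \<kappa>" 4] by simp
  finally have l4: "\<kappa> \<le> (1 + \<kappa>) ^ 4" .
  have l2: "\<kappa> \<le> (1 + \<kappa>)\<^sup>2" using l0 by (simp add: power2_eq_square algebra_simps)
  have "(t * r ^ d) ^ 4 = \<kappa> * r ^ (2 * d - 2)"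
  proof -
    have "d * 4 = (2 * d + 2) + (2 * d - 2)" using d by simp
    then have "r ^ (d * 4) = r ^ (2 * d + 2) * r ^ (2 * d - 2)" by (simp only: power_add)
    then show ?thesis unfolding lam by (simp only: power_mult_distrib power_mult[symmetric] mult.assoc)
  qed
  also have "\<dots> \<le> (1 + \<kappa>) ^ 4 * r ^ 4"
    using l4 r d l0 by (intro mult_mono power_decreasing) auto
  also have "\<dots> = ((1 + \<kappa>) * r) ^ 4" by (simp add: power_mult_distrib)
  finally have 1: "t * r ^ d \<le> (1 + \<kappa>) * r"
    using power_le_imp_le_base[of "t * r ^ d" 3 "(1 + \<kappa>) * r"] l0 r by simp
  have "(t\<^sup>2 * r ^ (d + 2))\<^sup>2 = \<kappa> * r\<^sup>2"
    unfolding lam by (simp add: power_mult_distrib power_add mult_2 power2_eq_square power4_eq_xxxx)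
  also have "\<dots> \<le> (1 + \<kappa>)\<^sup>2 * r\<^sup>2" using l2 by (intro mult_right_mono) auto
  also have "\<dots> = ((1 + \<kappa>) * r)\<^sup>2" by (simp add: power_mult_distrib)
  finally have 2: "t\<^sup>2 * r ^ (d + 2) \<le> (1 + \<kappa>) * r"
    by (rule power2_le_imp_le) (use l0 r in simp)
  show ?thesis using 1 2 by simp
qed

lemma error_bound_tendsto_0:
  fixes \<delta> A B :: real
  assumes "0 < \<delta>"
  shows "((\<lambda>t. exp (- (t powr (\<delta> / 2))) + (A * t powr (- 2 * \<delta>) + B / t)) \<longlongrightarrow> 0) at_top"
proof -
  have "((\<lambda>t :: real. exp (- (t powr (\<delta> / 2)))) \<longlongrightarrow> 0) at_top"
  proof (rule tendsto_sandwich[where f="\<lambda>_. 0" and h="\<lambda>t. t powr (- (\<delta> / 2))"])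
    show "((\<lambda>t :: real. t powr (- (\<delta> / 2))) \<longlongrightarrow> 0) at_top"
      using assms by (intro tendsto_neg_powr filterlim_ident) simp
    show "\<forall>\<^sub>F t :: real in at_top. exp (- (t powr (\<delta> / 2))) \<le> t powr (- (\<delta> / 2))"
      using eventually_gt_at_top[of 0]
    proof eventually_elim
      case (elim t)
      have "t powr (\<delta> / 2) \<le> exp (t powr (\<delta> / 2))"
        using exp_ge_add_one_self[of "t powr (\<delta> / 2)"] by linarith
      then show ?case using elim by (simp add: exp_minus powr_minus le_imp_inverse_le)
    qed
  qed auto
  moreover have "((\<lambda>t :: real. A * t powr (- 2 * \<delta>)) \<longlongrightarrow> A * 0) at_top"
    using assms by (intro tendsto_mult tendsto_const tendsto_neg_powr filterlim_ident) simp
  moreover have "((\<lambda>t :: real. B / t) \<longlongrightarrow> 0) at_top"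
    by (intro tendsto_divide_0[OF tendsto_const] filterlim_at_top_imp_at_infinity filterlim_ident)
  ultimately show ?thesis
    using tendsto_add[of "\<lambda>t. exp (- (t powr (\<delta> / 2)))" 0 at_top "\<lambda>t. A * t powr (- 2 * \<delta>) + B / t" 0]
      tendsto_add[of "\<lambda>t. A * t powr (- 2 * \<delta>)" 0 at_top "\<lambda>t. B / t" 0] by simp
qed

text \<open>The choice of parameters. With \<open>N\<close> of order \<open>t powr \<delta>\<close>, where \<open>8 * \<delta>\<close> is the exponent in
\<open>radius_bound\<close>, the sum over intersecting patterns is at most of order \<open>N ^ 4 * (1 + \<kappa>)\<^sup>2 * r\<close>,
that is \<open>t powr (4 * \<delta> + 2 * \<delta> - 8 * \<delta>)\<close>. The value of \<open>c\<close> makes the probability that a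
single plane is crossing-free at least \<open>t powr (- \<delta> / 2)\<close>, so that the
expected number of crossing-free planes is at least \<open>t powr (\<delta> / 2)\<close>.\<close>

lemma crossing_free_error_le:
  fixes t r c \<delta> \<kappa> \<mu> C1 C2 C3 h D :: real and d :: nat
  assumes t: "1 \<le> t" and r: "0 < r" and d: "3 \<le> d"
    and \<delta>: "\<delta> = 1 / (8 * (real d + 1))" and C1: "1 \<le> C1" and C2: "0 \<le> C2" and C3: "0 \<le> C3"
    and c: "c = \<delta> / (4 * C1)"
    and kap: "\<kappa> = t ^ 4 * r ^ (2 * d + 2)" and mu: "\<mu> = t * r ^ d + t\<^sup>2 * r ^ (d + 2)"
    and le: "\<kappa> \<le> c * ln t"
    and N: "N = nat \<lceil>t powr \<delta>\<rceil>" and h: "h = min r (1 / t)" and D: "0 \<le> D"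
  shows "1 \<le> N" "0 < h" "h \<le> r" "h \<le> 1" "t * h ^ d \<le> 1 / t\<^sup>2"
    and "\<mu> \<le> 4 * t powr (- 7 * \<delta>)"
    and "exp (- (real N * exp (- (2 * (C1 * \<kappa>)))))
      + (real N)\<^sup>2 * (C1 * \<kappa> * (320 * (C3 * \<mu>)) + C2 * (real N)\<^sup>2 * (\<kappa> * r))
      + D * (t\<^sup>2 * h ^ d)
     \<le> exp (- (t powr (\<delta> / 2))) + ((16 * (4 * (320 * C1 * C3 * 2 + C2))) * t powr (- 2 * \<delta>) + D / t)"
proof -
  have \<delta>0: "0 < \<delta>" "\<delta> \<le> 1" using d by (auto simp: \<delta> field_simps)
  have c0: "0 < c" using \<delta>0 C1 by (simp add: c)
  have "\<delta> / (4 * C1) \<le> \<delta> / 1" using \<delta>0 C1 by (intro divide_left_mono) auto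
  then have c\<delta>: "c \<le> \<delta>" and c1: "c \<le> 1" using \<delta>0 by (auto simp: c)
  have k0: "0 \<le> \<kappa>" using t r by (simp add: kap)
  have "r \<le> t powr (- 1 / (real d + 1))"
    using le c0 c1 kap by (intro radius_bound[OF t r, of c]) auto
  also have "- 1 / (real d + 1) = - 8 * \<delta>" by (simp add: \<delta> field_simps)
  finally have rt: "r \<le> t powr (- 8 * \<delta>)" .
  also have "\<dots> \<le> t powr 0" using t \<delta>0 by (intro powr_mono) auto
  finally have r1: "r \<le> 1" using t by simp
  have ti: "0 < 1 / t" "1 / t \<le> 1" using t by auto
  show h0: "0 < h" "h \<le> r" "h \<le> 1" using r ti by (auto simp: h min_le_iff_disj)
  have "h ^ d \<le> h ^ 3" using h0 d by (intro power_decreasing) auto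
  also have "\<dots> \<le> (1 / t) ^ 3" using h0 by (intro power_mono) (auto simp: h)
  finally have hd: "h ^ d \<le> 1 / t ^ 3" by (simp add: power_one_over)
  then have "t * h ^ d \<le> t * (1 / t ^ 3)" using t by (intro mult_left_mono) auto
  then show "t * h ^ d \<le> 1 / t\<^sup>2" using t by (simp add: power3_eq_cube power2_eq_square)
  have "t\<^sup>2 * h ^ d \<le> t\<^sup>2 * (1 / t ^ 3)" using t hd by (intro mult_left_mono) auto
  then have "t\<^sup>2 * h ^ d \<le> 1 / t" using t by (simp add: power3_eq_cube power2_eq_square)
  then have "D * (t\<^sup>2 * h ^ d) \<le> D * (1 / t)" using D by (rule mult_left_mono)
  then have e3: "D * (t\<^sup>2 * h ^ d) \<le> D / t" by simp
  have td1: "1 \<le> t powr \<delta>" using t \<delta>0 by (intro ge_one_powr_ge_zero) auto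
  have Nr: "t powr \<delta> \<le> real N" "real N \<le> 2 * t powr \<delta>" using td1 unfolding N by linarith+
  show N1: "1 \<le> N" using Nr(1) td1 by linarith
  \<comment> \<open>logarithms are absorbed by small powers\<close>
  have "\<kappa> \<le> \<delta> * ln t" using le c\<delta> mult_right_mono[OF c\<delta>, of "ln t"] t by simp
  also have "\<dots> \<le> \<delta> * (t powr \<delta> / \<delta>)" using ln_powr_bound[OF t \<delta>0(1)] \<delta>0 by (intro mult_left_mono) auto
  finally have kt: "\<kappa> \<le> t powr \<delta>" using \<delta>0 by simp
  then have k1: "1 + \<kappa> \<le> 2 * t powr \<delta>" using td1 by simp
  have mu1: "\<mu> \<le> 2 * ((1 + \<kappa>) * r)"
    unfolding mu using local_density_bound[OF _ r r1 d kap] t by simp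
  have "(1 + \<kappa>) * r \<le> (2 * t powr \<delta>) * t powr (- 8 * \<delta>)"
    using k1 rt r k0 by (intro mult_mono) auto
  also have "\<dots> = 2 * t powr (- 7 * \<delta>)" using t by (simp add: powr_add[symmetric])
  finally show "\<mu> \<le> 4 * t powr (- 7 * \<delta>)" using mu1 by simp
  have "t powr (\<delta> / 2) \<le> real N * exp (- (2 * (C1 * \<kappa>)))"
  proof -
    have "2 * (C1 * \<kappa>) \<le> 2 * (C1 * (c * ln t))" using le C1 by (intro mult_left_mono) auto
    also have "\<dots> = \<delta> / 2 * ln t" using C1 by (simp add: c)
    finally have "exp (- (\<delta> / 2 * ln t)) \<le> exp (- (2 * (C1 * \<kappa>)))" by simp
    moreover have "exp (- (\<delta> / 2 * ln t)) = t powr (- (\<delta> / 2))" using t by (simp add: powr_def)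
    ultimately have "t powr (- (\<delta> / 2)) \<le> exp (- (2 * (C1 * \<kappa>)))" by (simp only:)
    then have "t powr \<delta> * t powr (- (\<delta> / 2)) \<le> real N * exp (- (2 * (C1 * \<kappa>)))"
      using Nr(1) by (intro mult_mono) auto
    then show ?thesis by (simp add: powr_add[symmetric])
  qed
  then have e1: "exp (- (real N * exp (- (2 * (C1 * \<kappa>))))) \<le> exp (- (t powr (\<delta> / 2)))" by simp
  have "(real N)\<^sup>2 * (C1 * \<kappa> * (320 * (C3 * \<mu>)) + C2 * (real N)\<^sup>2 * (\<kappa> * r))
     \<le> (real N)\<^sup>2 * ((real N)\<^sup>2 * ((320 * C1 * C3 * 2 + C2) * ((1 + \<kappa>)\<^sup>2 * r)))"
  proof (rule mult_left_mono)
    have N2: "1 \<le> (real N)\<^sup>2" using N1 by simp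
    have "C1 * \<kappa> * (320 * (C3 * \<mu>)) \<le> C1 * (1 + \<kappa>) * (320 * (C3 * (2 * ((1 + \<kappa>) * r))))"
      using mu1 C1 C3 k0 r t by (intro mult_mono) (auto simp: mu)
    also have "\<dots> = (320 * C1 * C3 * 2) * ((1 + \<kappa>)\<^sup>2 * r)" by (simp add: power2_eq_square)
    also have "\<dots> \<le> (real N)\<^sup>2 * ((320 * C1 * C3 * 2) * ((1 + \<kappa>)\<^sup>2 * r))"
      using mult_right_mono[OF N2, of "(320 * C1 * C3 * 2) * ((1 + \<kappa>)\<^sup>2 * r)"] C1 C3 r by simp
    finally have 1: "C1 * \<kappa> * (320 * (C3 * \<mu>)) \<le> (real N)\<^sup>2 * ((320 * C1 * C3 * 2) * ((1 + \<kappa>)\<^sup>2 * r))" .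
    have "\<kappa> \<le> (1 + \<kappa>)\<^sup>2" using k0 by (simp add: power2_eq_square algebra_simps)
    then have "C2 * (real N)\<^sup>2 * (\<kappa> * r) \<le> C2 * (real N)\<^sup>2 * ((1 + \<kappa>)\<^sup>2 * r)"
      using C2 r by (intro mult_left_mono mult_right_mono) auto
    with 1 show "C1 * \<kappa> * (320 * (C3 * \<mu>)) + C2 * (real N)\<^sup>2 * (\<kappa> * r)
      \<le> (real N)\<^sup>2 * ((320 * C1 * C3 * 2 + C2) * ((1 + \<kappa>)\<^sup>2 * r))"
      by (simp add: algebra_simps)
  qed simp
  also have "\<dots> = (real N) ^ 4 * ((1 + \<kappa>)\<^sup>2 * r) * (320 * C1 * C3 * 2 + C2)"
    by (simp add: power4_eq_xxxx power2_eq_square)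
  also have "\<dots> \<le> (2 * t powr \<delta>) ^ 4 * ((2 * t powr \<delta>)\<^sup>2 * t powr (- 8 * \<delta>)) * (320 * C1 * C3 * 2 + C2)"
    using Nr(2) k1 k0 rt r C1 C2 C3 by (intro mult_right_mono mult_mono power_mono) auto
  also have "\<dots> = (16 * (4 * (320 * C1 * C3 * 2 + C2))) * ((t powr \<delta>) ^ 4 * (t powr \<delta>)\<^sup>2 * t powr (- 8 * \<delta>))"
    by (simp add: power_mult_distrib)
  also have "(t powr \<delta>) ^ 4 * (t powr \<delta>)\<^sup>2 * t powr (- 8 * \<delta>) = t powr (- 2 * \<delta>)"
    by (simp add: power4_eq_xxxx power2_eq_square powr_add[symmetric])
  finally have e2: "(real N)\<^sup>2 * (C1 * \<kappa> * (320 * (C3 * \<mu>)) + C2 * (real N)\<^sup>2 * (\<kappa> * r))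
     \<le> (16 * (4 * (320 * C1 * C3 * 2 + C2))) * t powr (- 2 * \<delta>)" .
  show "exp (- (real N * exp (- (2 * (C1 * \<kappa>)))))
      + (real N)\<^sup>2 * (C1 * \<kappa> * (320 * (C3 * \<mu>)) + C2 * (real N)\<^sup>2 * (\<kappa> * r))
      + D * (t\<^sup>2 * h ^ d)
     \<le> exp (- (t powr (\<delta> / 2))) + ((16 * (4 * (320 * C1 * C3 * 2 + C2))) * t powr (- 2 * \<delta>) + D / t)"
    using e1 e2 e3 by linarith
qed

theorem theorem1:
  fixes W :: "(real^'d) set"
  assumes "CARD('d) \<ge> 3"
    and "convex_body W"
  shows "\<exists>c>0. \<forall>(\<nu> :: (real^'d) set measure) (P :: real \<Rightarrow> (real^'d) set measure)
           (r :: real \<Rightarrow> real) (c' :: real).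
           uniform_plane_measure \<nu> \<longrightarrow>
           (\<forall>t>0. poisson_process t W (P t)) \<longrightarrow>
           (\<forall>t>0. r t > 0) \<longrightarrow>
           (r \<longlongrightarrow> 0) at_top \<longrightarrow>
           c' < c \<longrightarrow>
           (\<forall>\<^sub>F t in at_top. t ^ 4 * r t ^ (2 * CARD('d) + 2) \<le> c' * ln t) \<longrightarrow>
           ((\<lambda>t. measure (P t) {\<eta> \<in> space (P t). zero_crossing_measure \<nu> (r t) \<eta> > 0})
              \<longlongrightarrow> 1) at_top"
proof -
  have "bounded W" using assms(2) by (simp add: convex_body_def compact_imp_bounded)
  then obtain B where B: "\<And>x. x \<in> W \<Longrightarrow> norm x \<le> B" by (auto simp: bounded_iff)
  define D where "D = max 0 B + 1"
  have W: "\<bar>x $ j\<bar> \<le> D - 1" if "x \<in> W" for x j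
    using B[OF that] component_le_norm_cart[of x j] by (auto simp: D_def)
  have D: "1 \<le> D" by (simp add: D_def)
  obtain T :: "'d set" where "T \<subseteq> UNIV" "card T = 3"
    using obtain_subset_with_card_n[OF assms(1)] by metis
  then obtain i1 i2 i3 :: 'd where i: "distinct [i1, i2, i3]" by (auto simp: card_3_iff)
  define d where "d = CARD('d)"
  define C1 where "C1 = (3 * D) ^ d * 25 ^ d * (253 * (5 * D) ^ (d - 2))"
  define C2 where "C2 = (3 * D) ^ d * 25 ^ d * (27511 * (5 * D) ^ (d - 3))"
  define C3 where "C3 = 5 ^ d * (1 + 253 * (5 * D) ^ (d - 2))"
  define \<delta> where "\<delta> = 1 / (8 * (real d + 1))"
  define c where "c = \<delta> / (4 * C1)"
  have \<delta>: "0 < \<delta>" by (simp add: \<delta>_def)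
  have "1 * 1 \<le> (3 * D) ^ d * (25::real) ^ d" using D by (intro mult_mono one_le_power) auto
  moreover have "1 * 1 \<le> 253 * (5 * D) ^ (d - 2)" using D by (intro mult_mono one_le_power) auto
  ultimately have "1 * 1 \<le> C1" unfolding C1_def by (intro mult_mono) auto
  then have C1: "1 \<le> C1" by simp
  have C2: "0 \<le> C2" and C3: "0 \<le> C3" using D by (auto simp: C2_def C3_def)
  have c: "0 < c" using \<delta> C1 by (simp add: c_def)
  let ?err = "\<lambda>t. exp (- (t powr (\<delta> / 2))) +
     ((16 * (4 * (320 * C1 * C3 * 2 + C2))) * t powr (- 2 * \<delta>) + (3 * D) ^ d / t)"
  have err: "(?err \<longlongrightarrow> 0) at_top" by (rule error_bound_tendsto_0[OF \<delta>])
  show ?thesis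
  proof (intro exI[of _ c] conjI c allI impI)
    fix \<nu> :: "(real^'d) set measure" and P :: "real \<Rightarrow> (real^'d) set measure" and r :: "real \<Rightarrow> real" and c'
    assume \<nu>: "uniform_plane_measure \<nu>" and P: "\<forall>t>0. poisson_process t W (P t)" and r: "\<forall>t>0. r t > 0"
      and c': "c' < c" and le: "\<forall>\<^sub>F t in at_top. t ^ 4 * r t ^ (2 * CARD('d) + 2) \<le> c' * ln t"
    let ?m = "\<lambda>t. measure (P t) {\<eta> \<in> space (P t). zero_crossing_measure \<nu> (r t) \<eta> > 0}"
    have "((\<lambda>t :: real. C3 * (4 * t powr (- 7 * \<delta>))) \<longlongrightarrow> C3 * (4 * 0)) at_top"
      using \<delta> by (intro tendsto_mult tendsto_const tendsto_neg_powr filterlim_ident) simp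
    then have small: "\<forall>\<^sub>F t :: real in at_top. C3 * (4 * t powr (- 7 * \<delta>)) < 1"
      by (rule order_tendstoD) simp
    have lower: "\<forall>\<^sub>F t in at_top. 1 - ?err t \<le> ?m t"
      using le small eventually_ge_at_top[of 2]
    proof eventually_elim
      case (elim t)
      have t: "1 \<le> t" "0 < t" and r0: "0 < r t" using elim r by auto
      have "c' * ln t \<le> c * ln t" using c' t by (intro mult_right_mono) auto
      then have le': "t ^ 4 * r t ^ (2 * d + 2) \<le> c * ln t" using elim unfolding d_def by linarith
      define N where "N = nat \<lceil>t powr \<delta>\<rceil>"
      define h where "h = min (r t) (1 / t)"
      note b = crossing_free_error_le[OF t(1) r0 assms(1)[folded d_def] \<delta>_def C1 C2 C3 c_def refl refl le' N_def h_def,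
          of "(3 * D) ^ d"]
      have D0: "0 \<le> (3 * D) ^ d" using D by simp
      have "1 / t\<^sup>2 \<le> 1 / 2\<^sup>2" using elim by (intro divide_left_mono power_mono) auto
      then have p: "t * h ^ d \<le> 1 / 2" using b(5)[OF D0] by simp
      have "C3 * (t * r t ^ d + t\<^sup>2 * r t ^ (d + 2)) \<le> C3 * (4 * t powr (- 7 * \<delta>))"
        using b(6)[OF D0] C3 by (rule mult_left_mono)
      then have s: "C3 * (t * r t ^ d + t\<^sup>2 * r t ^ (d + 2)) \<le> 1" using elim by linarith
      have "1 - (exp (- (real N * exp (- (2 * (C1 * (t ^ 4 * r t ^ (2 * d + 2)))))))
        + (real N)\<^sup>2 * (C1 * (t ^ 4 * r t ^ (2 * d + 2)) * (320 * (C3 * (t * r t ^ d + t\<^sup>2 * r t ^ (d + 2))))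
            + C2 * (real N)\<^sup>2 * (t ^ 4 * r t ^ (2 * d + 2) * r t))
        + (3 * D) ^ d * (t\<^sup>2 * h ^ d)) \<le> ?m t"
        using poisson_crossing_free_lower_bound[OF i W D \<nu> P[rule_format, OF t(2)] t(2) b(2-4)[OF D0] b(1)[OF D0]
            p[unfolded d_def] C1_def[unfolded d_def] C2_def[unfolded d_def] C3_def[unfolded d_def] refl refl
            s[unfolded d_def]]
        unfolding d_def .
      then show ?case using b(7)[OF D0] by linarith
    qed
    have upper: "\<forall>\<^sub>F t in at_top. ?m t \<le> 1"
      using eventually_gt_at_top[of 0]
    proof eventually_elim
      case (elim t)
      then interpret prob_space "P t" by (rule poisson_prob_space[OF P[rule_format]])
      show ?case by (rule prob_le_1)
    qed
    have "((\<lambda>t. 1 - ?err t) \<longlongrightarrow> 1 - 0) at_top" by (intro tendsto_diff tendsto_const err)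
    then show "(?m \<longlongrightarrow> 1) at_top"
      by (intro tendsto_sandwich[OF lower upper]) auto
  qed
qed

end
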